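(* Let $W$ be a complete discrete valuation ring of characteristic zero, with uniformizer $u$, residue field $k$ of characteristic $p>0$, and absolute ramification index $e<p$. Let $R$ be a formal $W$-algebra. Then $R$ is smooth if and only if the following three conditions hold: (i) There is a $W$-algebra homomorphism $R\to W$. (ii) Given an integer $m\ge0$, each $W$-algebra homomorphism $R\to W_{m+1}[\epsilon]/(u^m\epsilon)$ lifts to $W_{m+1}[\epsilon]$. (iii) Given integers $m,d>0$, each $W$-algebra homomorphism $R\to W_{m,d}$ lifts to $W_{m,d+1}$.
   Context: The absolute ramification index $e>0$ is defined by $u^eW=pW$. A formal $W$-algebra is a quotient $R$ of some power series algebra $W[[T_1,\ldots,T_r]]$ such that the map of residue fields $W/\mathfrak{m}_W\to R/\mathfrak{m}_R$ is bijective. A formal $W$-algebra is smooth if it is isomorphic as $W$-algebra to $W[[T_1,\ldots,T_r]]$ for some $r\ge0$. For $m\ge0$, $W_m=W/(u^m)$. The symbol $\epsilon$ is an indeterminate with $\epsilon^2=0$, e.g. $W_m[\epsilon]=W_m[T]/(T^2)$. For $m>0$, $W_m\langle T\rangle=\bigoplus_{n\ge0}W_m\cdot\gamma^n(T)$ is the free divided power algebra in one variable, with $\gamma^0(T)=1$, $\gamma^1(T)=T$, $\gamma^i(T)\gamma^j(T)=\binom{i+j}{i}\gamma^{i+j}(T)$; for $m,d>0$, $W_{m,d}=W_m\langle T\rangle/(\gamma^d(T),\gamma^{d+1}(T),\gamma^{d+2}(T),\ldots)$. Lifts are $W$-algebra homomorphisms with respect to the canonical projections $W_{m+1}[\epsilon]\to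 W_{m+1}[\epsilon]/(u^m\epsilon)$ and $W_{m,d+1}\to W_{m,d}$. *)

theory Defs
  imports "HOL-Algebra.Algebra"
begin

section \<open>Algebras over a ring\<close>

text \<open>An algebra over \<open>W\<close> is a commutative ring \<open>A\<close> together with its structure homomorphism
  \<open>\<alpha> : W \<rightarrow> A\<close>.\<close>

definition alg_hom ::
    "('w, 'm) ring_scheme \<Rightarrow> ('a, 'n) ring_scheme \<Rightarrow> ('w \<Rightarrow> 'a) \<Rightarrow>
     ('b, 'l) ring_scheme \<Rightarrow> ('w \<Rightarrow> 'b) \<Rightarrow> ('a \<Rightarrow> 'b) set"
  where "alg_hom W A \<alpha> B \<beta> = {f \<in> ring_hom A B. \<forall>w\<in>carrier W. f (\<alpha> w) = \<beta> w}"

text \<open>The map induced on cosets by a map \<open>h\<close> that is constant on each of them; the same encoding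
  as in \<^theory>\<open>HOL-Algebra.QuotRing\<close>.\<close>

definition induced_map :: "('a \<Rightarrow> 'b) \<Rightarrow> 'a set \<Rightarrow> 'b"
  where "induced_map h C = the_elem (h ` C)"


section \<open>Complete discrete valuation rings\<close>

definition local_cring :: "('a, 'm) ring_scheme \<Rightarrow> bool"
  where "local_cring A \<longleftrightarrow> cring A \<and> (\<exists>!M. maximalideal M A)"

definition max_ideal :: "('a, 'm) ring_scheme \<Rightarrow> 'a set"
  where "max_ideal A = (THE M. maximalideal M A)"

definition residue_ring_of :: "('a, 'm) ring_scheme \<Rightarrow> 'a set ring"
  where "residue_ring_of A = A Quot max_ideal A"

text \<open>The non-negative generator of the kernel of \<open>\<int> \<rightarrow> A\<close>, as for the type class
  constant \<open>CHAR\<close>.\<close>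

definition characteristic :: "('a, 'm) ring_scheme \<Rightarrow> nat"
  where "characteristic A = Gcd {n::nat. add_pow A n \<one>\<^bsub>A\<^esub> = \<zero>\<^bsub>A\<^esub>}"

definition discrete_valuation_ring :: "('a, 'm) ring_scheme \<Rightarrow> bool"
  where "discrete_valuation_ring W \<longleftrightarrow> principal_domain W \<and> local_cring W \<and> \<not> field W"

definition uniformizer :: "('a, 'm) ring_scheme \<Rightarrow> 'a \<Rightarrow> bool"
  where "uniformizer W u \<longleftrightarrow> u \<in> carrier W \<and> max_ideal W = PIdl\<^bsub>W\<^esub> u"

text \<open>Every Cauchy sequence for the \<open>(u)\<close>-adic topology converges. For a uniformizer \<open>u\<close> this is
  the topology of the valuation, and it is automatically separated.\<close>

definition adically_complete :: "('a, 'm) ring_scheme \<Rightarrow> 'a \<Rightarrow> bool"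
  where "adically_complete W u \<longleftrightarrow>
    (\<forall>x::nat \<Rightarrow> 'a. (\<forall>i. x i \<in> carrier W) \<longrightarrow>
      (\<forall>N::nat. \<exists>M. \<forall>i\<ge>M. \<forall>j\<ge>M. x i \<ominus>\<^bsub>W\<^esub> x j \<in> PIdl\<^bsub>W\<^esub> (u [^]\<^bsub>W\<^esub> N)) \<longrightarrow>
      (\<exists>y\<in>carrier W. \<forall>N::nat. \<exists>M. \<forall>i\<ge>M. x i \<ominus>\<^bsub>W\<^esub> y \<in> PIdl\<^bsub>W\<^esub> (u [^]\<^bsub>W\<^esub> N)))"


section \<open>Power series and formal algebras\<close>

text \<open>The ring \<open>W[[T\<^sub>0, \<dots>, T\<^sub>r\<^sub>-\<^sub>1]]\<close>. As in \<^theory>\<open>HOL-Algebra.Indexed_Polynomials\<close>, a monomial is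
  the multiset of its variables, so that multiplication of monomials is addition of multisets; a
  power series is its coefficient function, which vanishes on the monomials involving a variable
  of index \<open>\<ge> r\<close>.\<close>

definition power_series_ring :: "('a, 'm) ring_scheme \<Rightarrow> nat \<Rightarrow> (nat multiset \<Rightarrow> 'a) ring"
  where "power_series_ring W r = \<lparr>
    carrier = {f. \<forall>M. f M \<in> carrier W \<and> (\<not> set_mset M \<subseteq> {..<r} \<longrightarrow> f M = \<zero>\<^bsub>W\<^esub>)},
    monoid.mult = (\<lambda>f g M. \<Oplus>\<^bsub>W\<^esub>K\<in>{K. K \<subseteq># M}. f K \<otimes>\<^bsub>W\<^esub> g (M - K)),
    one = (\<lambda>M. if M = {#} then \<one>\<^bsub>W\<^esub> else \<zero>\<^bsub>W\<^esub>),
    ring.zero = (\<lambda>M. \<zero>\<^bsub>W\<^esub>),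
    add = (\<lambda>f g M. f M \<oplus>\<^bsub>W\<^esub> g M)\<rparr>"

definition power_series_const :: "('a, 'm) ring_scheme \<Rightarrow> 'a \<Rightarrow> (nat multiset \<Rightarrow> 'a)"
  where "power_series_const W w = (\<lambda>M. if M = {#} then w else \<zero>\<^bsub>W\<^esub>)"

definition formal_algebra ::
    "('w, 'm) ring_scheme \<Rightarrow> ('a, 'n) ring_scheme \<Rightarrow> ('w \<Rightarrow> 'a) \<Rightarrow> bool"
  where "formal_algebra W R \<rho> \<longleftrightarrow>
    local_cring R \<and> \<rho> \<in> ring_hom W R \<and>
    (\<exists>r. \<exists>\<phi> \<in> alg_hom W (power_series_ring W r) (power_series_const W) R \<rho>.
       \<phi> ` carrier (power_series_ring W r) = carrier R) \<and>
    bij_betw (induced_map (\<lambda>w. max_ideal R +>\<^bsub>R\<^esub> \<rho> w))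
      (carrier (residue_ring_of W)) (carrier (residue_ring_of R))"

definition smooth_algebra ::
    "('w, 'm) ring_scheme \<Rightarrow> ('a, 'n) ring_scheme \<Rightarrow> ('w \<Rightarrow> 'a) \<Rightarrow> bool"
  where "smooth_algebra W R \<rho> \<longleftrightarrow>
    (\<exists>r. \<exists>h \<in> alg_hom W R \<rho> (power_series_ring W r) (power_series_const W).
       bij_betw h (carrier R) (carrier (power_series_ring W r)))"


section \<open>The test algebras\<close>

definition trunc :: "('a, 'm) ring_scheme \<Rightarrow> 'a \<Rightarrow> nat \<Rightarrow> 'a set ring"
  where "trunc W u m = W Quot (PIdl\<^bsub>W\<^esub> (u [^]\<^bsub>W\<^esub> m))"

definition trunc_of :: "('a, 'm) ring_scheme \<Rightarrow> 'a \<Rightarrow> nat \<Rightarrow> 'a \<Rightarrow> 'a set"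
  where "trunc_of W u m w = PIdl\<^bsub>W\<^esub> (u [^]\<^bsub>W\<^esub> m) +>\<^bsub>W\<^esub> w"

text \<open>For a ring \<open>A\<close>: the ring \<open>A[\<epsilon>] = A[T]/(T\<^sup>2)\<close>, the inclusion \<open>A \<rightarrow> A[\<epsilon>]\<close>, and \<open>\<epsilon>\<close> itself.\<close>

definition sq_ideal :: "('a, 'm) ring_scheme \<Rightarrow> (nat \<Rightarrow> 'a) set"
  where "sq_ideal A = PIdl\<^bsub>UP A\<^esub> (monom (UP A) \<one>\<^bsub>A\<^esub> 2)"

definition dual_numbers :: "('a, 'm) ring_scheme \<Rightarrow> (nat \<Rightarrow> 'a) set ring"
  where "dual_numbers A = UP A Quot sq_ideal A"

definition dual_const :: "('a, 'm) ring_scheme \<Rightarrow> 'a \<Rightarrow> (nat \<Rightarrow> 'a) set"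
  where "dual_const A a = sq_ideal A +>\<^bsub>UP A\<^esub> monom (UP A) a 0"

definition dual_eps :: "('a, 'm) ring_scheme \<Rightarrow> (nat \<Rightarrow> 'a) set"
  where "dual_eps A = sq_ideal A +>\<^bsub>UP A\<^esub> monom (UP A) \<one>\<^bsub>A\<^esub> 1"

text \<open>\<open>W\<^sub>m[\<epsilon>]\<close> with its structure map.\<close>

definition W_eps :: "('a, 'm) ring_scheme \<Rightarrow> 'a \<Rightarrow> nat \<Rightarrow> (nat \<Rightarrow> 'a set) set ring"
  where "W_eps W u m = dual_numbers (trunc W u m)"

definition W_eps_of :: "('a, 'm) ring_scheme \<Rightarrow> 'a \<Rightarrow> nat \<Rightarrow> 'a \<Rightarrow> (nat \<Rightarrow> 'a set) set"
  where "W_eps_of W u m w = dual_const (trunc W u m) (trunc_of W u m w)"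

text \<open>\<open>W\<^sub>m\<^sub>+\<^sub>1[\<epsilon>]/(u\<^sup>m\<epsilon>)\<close>, with the projection from \<open>W\<^sub>m\<^sub>+\<^sub>1[\<epsilon>]\<close>.\<close>

definition ueps_ideal :: "('a, 'm) ring_scheme \<Rightarrow> 'a \<Rightarrow> nat \<Rightarrow> (nat \<Rightarrow> 'a set) set set"
  where "ueps_ideal W u m =
    PIdl\<^bsub>W_eps W u (Suc m)\<^esub>
      (W_eps_of W u (Suc m) (u [^]\<^bsub>W\<^esub> m) \<otimes>\<^bsub>W_eps W u (Suc m)\<^esub> dual_eps (trunc W u (Suc m)))"

definition W_eps_quot :: "('a, 'm) ring_scheme \<Rightarrow> 'a \<Rightarrow> nat \<Rightarrow> (nat \<Rightarrow> 'a set) set set ring"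
  where "W_eps_quot W u m = W_eps W u (Suc m) Quot ueps_ideal W u m"

definition W_eps_proj ::
    "('a, 'm) ring_scheme \<Rightarrow> 'a \<Rightarrow> nat \<Rightarrow> (nat \<Rightarrow> 'a set) set \<Rightarrow> (nat \<Rightarrow> 'a set) set set"
  where "W_eps_proj W u m x = ueps_ideal W u m +>\<^bsub>W_eps W u (Suc m)\<^esub> x"

definition W_eps_quot_of ::
    "('a, 'm) ring_scheme \<Rightarrow> 'a \<Rightarrow> nat \<Rightarrow> 'a \<Rightarrow> (nat \<Rightarrow> 'a set) set set"
  where "W_eps_quot_of W u m w = W_eps_proj W u m (W_eps_of W u (Suc m) w)"

text \<open>The divided power algebra \<open>A\<langle>T\<rangle>\<close>: the coefficient function \<open>f\<close> of finite support stands for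
  \<open>\<Sum>\<^sub>n f(n) \<gamma>\<^sup>n(T)\<close>, and the multiplication is the bilinear extension of
  \<open>\<gamma>\<^sup>i(T) \<gamma>\<^sup>j(T) = (i + j choose i) \<gamma>\<^sup>i\<^sup>+\<^sup>j(T)\<close>.\<close>

definition divided_power_algebra :: "('a, 'm) ring_scheme \<Rightarrow> (nat \<Rightarrow> 'a) ring"
  where "divided_power_algebra A = \<lparr>
    carrier = up A,
    monoid.mult = (\<lambda>f g n. \<Oplus>\<^bsub>A\<^esub>i\<in>{..n}. add_pow A (n choose i) (f i \<otimes>\<^bsub>A\<^esub> g (n - i))),
    one = (\<lambda>n. if n = 0 then \<one>\<^bsub>A\<^esub> else \<zero>\<^bsub>A\<^esub>),
    ring.zero = (\<lambda>n. \<zero>\<^bsub>A\<^esub>),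
    add = (\<lambda>f g n. f n \<oplus>\<^bsub>A\<^esub> g n)\<rparr>"

definition dp_const :: "('a, 'm) ring_scheme \<Rightarrow> 'a \<Rightarrow> (nat \<Rightarrow> 'a)"
  where "dp_const A a = (\<lambda>n. if n = 0 then a else \<zero>\<^bsub>A\<^esub>)"

definition dp_gamma :: "('a, 'm) ring_scheme \<Rightarrow> nat \<Rightarrow> (nat \<Rightarrow> 'a)"
  where "dp_gamma A i = (\<lambda>n. if n = i then \<one>\<^bsub>A\<^esub> else \<zero>\<^bsub>A\<^esub>)"

definition dp_ideal :: "('a, 'm) ring_scheme \<Rightarrow> nat \<Rightarrow> (nat \<Rightarrow> 'a) set"
  where "dp_ideal A d = Idl\<^bsub>divided_power_algebra A\<^esub> {dp_gamma A n | n. d \<le> n}"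

text \<open>\<open>W\<^sub>m\<^sub>,\<^sub>d\<close> with its structure map and the projection \<open>W\<^sub>m\<^sub>,\<^sub>d\<^sub>+\<^sub>1 \<rightarrow> W\<^sub>m\<^sub>,\<^sub>d\<close>.\<close>

definition W_dp :: "('a, 'm) ring_scheme \<Rightarrow> 'a \<Rightarrow> nat \<Rightarrow> nat \<Rightarrow> (nat \<Rightarrow> 'a set) set ring"
  where "W_dp W u m d =
    divided_power_algebra (trunc W u m) Quot dp_ideal (trunc W u m) d"

definition W_dp_of :: "('a, 'm) ring_scheme \<Rightarrow> 'a \<Rightarrow> nat \<Rightarrow> nat \<Rightarrow> 'a \<Rightarrow> (nat \<Rightarrow> 'a set) set"
  where "W_dp_of W u m d w =
    dp_ideal (trunc W u m) d +>\<^bsub>divided_power_algebra (trunc W u m)\<^esub>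
      dp_const (trunc W u m) (trunc_of W u m w)"

definition W_dp_proj ::
    "('a, 'm) ring_scheme \<Rightarrow> 'a \<Rightarrow> nat \<Rightarrow> nat \<Rightarrow> (nat \<Rightarrow> 'a set) set \<Rightarrow> (nat \<Rightarrow> 'a set) set"
  where "W_dp_proj W u m d =
    induced_map (\<lambda>x. dp_ideal (trunc W u m) d +>\<^bsub>divided_power_algebra (trunc W u m)\<^esub> x)"

end

theory Submission
  imports Defs
begin

text \<open>The three kinds of test algebra are quotients of one ring. Let \<open>S\<close> be the ring of infinite sums
\<open>\<Sum>\<^sub>n f(n) \<gamma>\<^sup>n\<close> with coefficients in \<open>W\<close>. Then \<open>W\<^sub>m\<^sub>+\<^sub>1[\<epsilon>]\<close>, \<open>W\<^sub>m\<^sub>+\<^sub>1[\<epsilon>]/(u\<^sup>m\<epsilon>)\<close> and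
\<open>W\<^sub>m\<^sub>,\<^sub>d\<close> are the quotients of \<open>S\<close> by the ideals \<open>{f. \<forall>n. f(n) \<in> (u\<^bsup>k(n)\<^esup>)}\<close>, where the decreasing function
\<open>k\<close> is \<open>m+1, m+1, 0, \<dots>\<close>, respectively \<open>m+1, m, 0, \<dots>\<close>, respectively \<open>m\<close> repeated \<open>d\<close> times and
then \<open>0\<close>; the projections along which one lifts are the evident ones (locale \<open>test_algebra\<close>).

If \<open>R = W[[T]]\<close>, a homomorphism from \<open>R\<close> to a quotient of \<open>S\<close> sends \<open>T\<^sub>i\<close> to the class of some
\<open>x\<^sub>i \<in> S\<close>. As \<open>T\<^sub>i - w\<close> is invertible for every unit \<open>w\<close>, whereas the elements of \<open>S\<close> without constant
term become nilpotent in the quotient, the constant term of \<open>x\<^sub>i\<close> lies in \<open>(u)\<close>. The ring \<open>S\<close> is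
complete, so the substitution \<open>T\<^sub>i \<mapsto> x\<^sub>i\<close> defines a homomorphism \<open>R \<rightarrow> S\<close>, and this induces lifts
to all the test algebras (\<open>smooth_lifts\<close>).

Conversely, choose a surjection \<open>\<phi> : W[[T\<^sub>i | i \<in> V]] \<rightarrow> R\<close> with \<open>V\<close> as small as possible. By (i) there is
a section \<open>s\<close>, and \<open>s(\<phi>(T\<^sub>i)) \<in> (u)\<close>; after the translation \<open>T\<^sub>i \<mapsto> T\<^sub>i - s(\<phi>(T\<^sub>i))\<close> the map \<open>s \<circ> \<phi>\<close> is
the constant term. Let \<open>I\<close> be the kernel of \<open>\<phi>\<close>. One shows by induction on \<open>d\<close> that the homogeneous part
\<open>f\<^sub>d\<close> of degree \<open>d\<close> of each \<open>f \<in> I\<close> is zero; hence \<open>I = 0\<close>.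

\<^item> For \<open>d = 0\<close> this holds because \<open>s \<circ> \<phi>\<close> is the constant term.

\<^item> For \<open>d = 1\<close>, suppose that some linear coefficient is not zero. Let \<open>u\<^sup>n\<close> be the highest power of \<open>u\<close>
that divides all the linear coefficients of all \<open>f \<in> I\<close>, and let \<open>u\<^sup>n\<^sup>+\<^sup>1\<close> not divide the coefficient of
\<open>T\<^sub>i\<close> in \<open>f\<close>. If \<open>n > 0\<close>, the map \<open>T\<^sub>j \<mapsto> \<delta>\<^sub>i\<^sub>j \<epsilon>\<close> is defined on \<open>R\<close> with values in
\<open>W\<^sub>n\<^sub>+\<^sub>1[\<epsilon>]/(u\<^sup>n\<epsilon>)\<close>. By (ii) it lifts to a map \<open>T\<^sub>j \<mapsto> y\<^sub>j \<epsilon>\<close> with \<open>y\<^sub>j \<equiv> \<delta>\<^sub>i\<^sub>j\<close> modulo \<open>u\<^sup>n\<close>, and the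
image of \<open>f\<close> shows that \<open>u\<^sup>n\<^sup>+\<^sup>1\<close> divides the coefficient of \<open>T\<^sub>i\<close> after all (\<open>linear_unit\<close>). So \<open>n = 0\<close>; but then
division by \<open>f\<close> eliminates \<open>T\<^sub>i\<close>, against the choice of \<open>V\<close> (\<open>eliminate_variable\<close>).

\<^item> For \<open>d \<ge> 2\<close>, all elements of \<open>I\<close> have order \<open>\<ge> d\<close>. So for any \<open>a\<close> the map \<open>T\<^sub>i \<mapsto> a\<^sub>i \<gamma>\<^sup>1\<close> is
defined on \<open>R\<close> with values in \<open>W\<^sub>m\<^sub>,\<^sub>d\<close>. By (iii) it lifts to \<open>T\<^sub>i \<mapsto> a\<^sub>i \<gamma>\<^sup>1 + b\<^sub>i \<gamma>\<^sup>d\<close>, which sends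
\<open>f \<in> I\<close> to \<open>f\<^sub>d(a) (\<gamma>\<^sup>1)\<^sup>d = d! f\<^sub>d(a) \<gamma>\<^sup>d\<close>. Therefore \<open>d! f\<^sub>d(a)\<close> lies in \<open>(u\<^sup>m)\<close> for all \<open>m\<close> and vanishes. As
\<open>W\<close> has characteristic zero, \<open>f\<^sub>d(a) = 0\<close> for all \<open>a\<close>, and hence \<open>f\<^sub>d = 0\<close> (\<open>order_step\<close>).\<close>

section \<open>Rings of functions under a twisted convolution\<close>

definition parts :: "'i::cancel_comm_monoid_add \<Rightarrow> 'i set"
  where "parts M = {K. \<exists>L. M = K + L}"

lemma zero_parts [simp]: "0 \<in> parts M" "M \<in> parts M"
  unfolding parts_def by (auto intro: exI[of _ M] exI[of _ 0])

lemma parts_diff: "K \<in> parts M \<Longrightarrow> K + (M - K) = M"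
  unfolding parts_def by auto

lemma parts_add [simp]: "K \<in> parts (K + L)" "L \<in> parts (K + L)"
  unfolding parts_def by (auto intro: exI[of _ K] simp: add.commute)

lemma diff_parts: "K \<in> parts M \<Longrightarrow> M - K \<in> parts M"
  by (metis parts_diff parts_add(2))

lemma (in abelian_monoid) finsum_Sigma:
  assumes "finite A" "\<And>x. x \<in> A \<Longrightarrow> finite (B x)"
    and "\<And>x y. x \<in> A \<Longrightarrow> y \<in> B x \<Longrightarrow> f x y \<in> carrier G"
  shows "(\<Oplus>x\<in>A. \<Oplus>y\<in>B x. f x y) = (\<Oplus>z\<in>Sigma A B. f (fst z) (snd z))"
proof -
  have "(\<Oplus>z\<in>(\<Union>x\<in>A. Pair x ` B x). f (fst z) (snd z))
      = (\<Oplus>x\<in>A. \<Oplus>z\<in>Pair x ` B x. f (fst z) (snd z))"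
    by (rule add.finprod_UN_disjoint) (use assms in \<open>auto simp: pairwise_def disjnt_def\<close>)
  also have "\<dots> = (\<Oplus>x\<in>A. \<Oplus>y\<in>B x. f x y)"
  proof (rule finsum_cong')
    fix x assume x: "x \<in> A"
    have "(\<Oplus>z\<in>Pair x ` B x. f (fst z) (snd z)) = (\<Oplus>y\<in>B x. f (fst (x, y)) (snd (x, y)))"
      by (rule finsum_reindex) (use assms x in \<open>auto simp: inj_on_def\<close>)
    then show "(\<Oplus>z\<in>Pair x ` B x. f (fst z) (snd z)) = (\<Oplus>y\<in>B x. f x y)" by simp
  qed (use assms in auto)
  also have "(\<Union>x\<in>A. Pair x ` B x) = Sigma A B" by auto
  finally show ?thesis by simp
qed

text \<open>Power series and divided power series have a common form: functions on a monoid, where the product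
of the basis elements of degrees \<open>K\<close> and \<open>L\<close> is \<open>tw K L\<close> times the basis element of degree \<open>K + L\<close>. The
cocycle identity \<open>tw_assoc\<close> is associativity on basis elements. Every degree has only finitely many
decompositions, so that infinite sums may be multiplied.\<close>
locale convolution_ring = A?: cring A
  for A :: "('a, 'm) ring_scheme" (structure) and Supp :: "'i::cancel_comm_monoid_add set"
    and tw :: "'i \<Rightarrow> 'i \<Rightarrow> 'a" and C :: "('i \<Rightarrow> 'a) ring" +
  assumes finite_parts: "finite (parts (M::'i))"
    and Supp_add: "K + L \<in> Supp \<longleftrightarrow> K \<in> Supp \<and> L \<in> Supp"
    and Supp_zero: "0 \<in> Supp"
    and tw_closed: "tw K L \<in> carrier A"
    and tw_comm: "tw K L = tw L K"
    and tw_zero: "tw 0 L = \<one>"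
    and tw_assoc: "tw K L \<otimes> tw (K + L) N = tw L N \<otimes> tw K (L + N)"
    and carrier_C: "carrier C = {f. \<forall>M. f M \<in> carrier A \<and> (M \<notin> Supp \<longrightarrow> f M = \<zero>)}"
    and mult_C: "\<And>f g M. \<lbrakk>f \<in> carrier C; g \<in> carrier C\<rbrakk> \<Longrightarrow>
      (f \<otimes>\<^bsub>C\<^esub> g) M = (\<Oplus>K\<in>parts M. tw K (M - K) \<otimes> (f K \<otimes> g (M - K)))"
    and one_C: "\<one>\<^bsub>C\<^esub> = (\<lambda>M. if M = 0 then \<one> else \<zero>)"
    and zero_C: "\<zero>\<^bsub>C\<^esub> = (\<lambda>M. \<zero>)"
    and add_C: "\<And>f g. f \<oplus>\<^bsub>C\<^esub> g = (\<lambda>M. f M \<oplus> g M)"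
begin

lemma coeff_closed [simp]: "f \<in> carrier C \<Longrightarrow> f M \<in> carrier A"
  by (simp add: carrier_C)

lemma coeff_Supp: "f \<in> carrier C \<Longrightarrow> M \<notin> Supp \<Longrightarrow> f M = \<zero>"
  unfolding carrier_C by blast

lemma carrierI: "(\<And>M. f M \<in> carrier A) \<Longrightarrow> (\<And>M. M \<notin> Supp \<Longrightarrow> f M = \<zero>) \<Longrightarrow> f \<in> carrier C"
  unfolding carrier_C by blast

lemma Supp_diff: "K \<in> parts M \<Longrightarrow> M \<notin> Supp \<Longrightarrow> K \<in> Supp \<Longrightarrow> M - K \<notin> Supp"
  by (metis Supp_add parts_diff)

lemma mult_closed_C: assumes "f \<in> carrier C" "g \<in> carrier C" shows "f \<otimes>\<^bsub>C\<^esub> g \<in> carrier C"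
proof (rule carrierI)
  show "(f \<otimes>\<^bsub>C\<^esub> g) M \<in> carrier A" for M
    using assms by (simp add: mult_C tw_closed)
  show "(f \<otimes>\<^bsub>C\<^esub> g) M = \<zero>" if M: "M \<notin> Supp" for M
  proof -
    have "tw K (M - K) \<otimes> (f K \<otimes> g (M - K)) = \<zero>" if "K \<in> parts M" for K
      using assms coeff_Supp Supp_diff[OF that M] tw_closed
      by (cases "K \<in> Supp") (metis coeff_closed r_null l_null)+
    then show ?thesis using assms by (simp add: mult_C A.add.finprod_one_eqI)
  qed
qed

lemma mult_comm_C: assumes "f \<in> carrier C" "g \<in> carrier C" shows "f \<otimes>\<^bsub>C\<^esub> g = g \<otimes>\<^bsub>C\<^esub> f"
proof
  fix M :: 'i
  have inj: "inj_on (\<lambda>K. M - K) (parts M)"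
    by (rule inj_onI) (metis add_right_cancel parts_diff)
  have im: "(\<lambda>K. M - K) ` parts M = parts M"
  proof
    show "parts M \<subseteq> (\<lambda>K. M - K) ` parts M"
    proof
      fix K assume K: "K \<in> parts M"
      have "K = M - (M - K)" using parts_diff[OF K] by (metis add_diff_cancel_right')
      then show "K \<in> (\<lambda>K. M - K) ` parts M" using diff_parts[OF K] by blast
    qed
  qed (auto intro: diff_parts)
  have dd: "M - (M - K) = K" if "K \<in> parts M" for K
    using parts_diff[OF that] by (metis add_diff_cancel_right')
  have "(f \<otimes>\<^bsub>C\<^esub> g) M = (\<Oplus>K\<in>(\<lambda>K. M - K) ` parts M. tw K (M - K) \<otimes> (f K \<otimes> g (M - K)))"
    using assms by (simp add: mult_C im)
  also have "\<dots> = (\<Oplus>K\<in>parts M. tw (M - K) (M - (M - K)) \<otimes> (f (M - K) \<otimes> g (M - (M - K))))"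
    by (rule finsum_reindex) (use assms inj in \<open>auto simp: tw_closed\<close>)
  also have "\<dots> = (\<Oplus>K\<in>parts M. tw K (M - K) \<otimes> (g K \<otimes> f (M - K)))"
    by (rule finsum_cong') (use assms in \<open>auto simp: tw_closed dd tw_comm m_comm\<close>)
  finally show "(f \<otimes>\<^bsub>C\<^esub> g) M = (g \<otimes>\<^bsub>C\<^esub> f) M" using assms by (simp add: mult_C)
qed

lemma mult_assoc_C:
  assumes f: "f \<in> carrier C" and g: "g \<in> carrier C" and h: "h \<in> carrier C"
  shows "(f \<otimes>\<^bsub>C\<^esub> g) \<otimes>\<^bsub>C\<^esub> h = f \<otimes>\<^bsub>C\<^esub> (g \<otimes>\<^bsub>C\<^esub> h)"
proof
  fix M :: 'i
  define S1 where "S1 = Sigma (parts M) parts"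
  define S2 where "S2 = Sigma (parts M) (\<lambda>K. parts (M - K))"
  define \<phi> where "\<phi> = (\<lambda>z::'i\<times>'i. (snd z, fst z - snd z))"
  have fin: "finite S1" "finite S2" by (auto simp: S1_def S2_def intro!: finite_SigmaI finite_parts)
  have inj: "inj_on \<phi> S1"
    by (rule inj_onI) (auto simp: \<phi>_def S1_def, metis parts_diff)
  have im: "\<phi> ` S1 = S2"
  proof
    show "\<phi> ` S1 \<subseteq> S2"
    proof
      fix z assume "z \<in> \<phi> ` S1"
      then obtain P K where z: "z = (K, P - K)" and P: "P \<in> parts M" and K: "K \<in> parts P"
        by (auto simp: S1_def \<phi>_def)
      have eq: "M = K + ((P - K) + (M - P))"
        using parts_diff[OF P] parts_diff[OF K] by (metis add.assoc)
      then have "M - K = (P - K) + (M - P)" by (metis add_diff_cancel_left')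
      then show "z \<in> S2" unfolding z S2_def using eq by (metis mem_Sigma_iff parts_add(1))
    qed
    show "S2 \<subseteq> \<phi> ` S1"
    proof
      fix z assume "z \<in> S2"
      then obtain K L where z: "z = (K, L)" and K: "K \<in> parts M" and L: "L \<in> parts (M - K)"
        by (auto simp: S2_def)
      have "M = (K + L) + (M - K - L)"
        using parts_diff[OF L] parts_diff[OF K] by (metis add.assoc)
      then have "(K + L, K) \<in> S1" unfolding S1_def by (metis mem_Sigma_iff parts_add(1))
      moreover have "\<phi> (K + L, K) = z" by (simp add: \<phi>_def z)
      ultimately show "z \<in> \<phi> ` S1" by force
    qed
  qed
  \<comment> \<open>\<open>S1\<close> and \<open>S2\<close> both parametrise the decompositions \<open>M = K + L + N\<close>, by \<open>(K + L, K)\<close> and by \<open>(K, L)\<close>.\<close>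
  have "((f \<otimes>\<^bsub>C\<^esub> g) \<otimes>\<^bsub>C\<^esub> h) M
      = (\<Oplus>P\<in>parts M. \<Oplus>K\<in>parts P. tw P (M - P) \<otimes> (tw K (P - K) \<otimes> (f K \<otimes> g (P - K)) \<otimes> h (M - P)))"
    using assms mult_closed_C[OF f g]
    by (simp add: mult_C tw_closed finsum_rdistr finsum_ldistr finite_parts cong: finsum_cong)
  also have "\<dots> = (\<Oplus>z\<in>S1. tw (fst z) (M - fst z) \<otimes>
      (tw (snd z) (fst z - snd z) \<otimes> (f (snd z) \<otimes> g (fst z - snd z)) \<otimes> h (M - fst z)))"
    unfolding S1_def by (rule finsum_Sigma) (use assms in \<open>auto simp: finite_parts tw_closed\<close>)
  also have "\<dots> = (\<Oplus>z\<in>S1. tw (fst (\<phi> z)) (M - fst (\<phi> z)) \<otimes> (f (fst (\<phi> z)) \<otimes>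
      (tw (snd (\<phi> z)) (M - fst (\<phi> z) - snd (\<phi> z)) \<otimes>
        (g (snd (\<phi> z)) \<otimes> h (M - fst (\<phi> z) - snd (\<phi> z))))))"
  proof (rule finsum_cong')
    fix z assume "z \<in> S1"
    then obtain P K where z: "z = (P, K)" and P: "P \<in> parts M" and K: "K \<in> parts P"
      by (auto simp: S1_def)
    define L N where "L = P - K" and "N = M - P"
    have PK: "P = K + L" and M: "M = K + L + N"
      using parts_diff[OF P] parts_diff[OF K] by (simp_all add: L_def N_def)
    have "tw (K + L) N \<otimes> (tw K L \<otimes> (f K \<otimes> g L) \<otimes> h N) = (tw K L \<otimes> tw (K + L) N) \<otimes> (f K \<otimes> g L \<otimes> h N)"
      using assms by (simp add: tw_closed m_ac)
    also have "\<dots> = (tw L N \<otimes> tw K (L + N)) \<otimes> (f K \<otimes> g L \<otimes> h N)" by (simp only: tw_assoc)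
    also have "\<dots> = tw K (L + N) \<otimes> (f K \<otimes> (tw L N \<otimes> (g L \<otimes> h N)))"
      using assms by (simp add: tw_closed m_ac)
    finally show "tw (fst z) (M - fst z) \<otimes>
      (tw (snd z) (fst z - snd z) \<otimes> (f (snd z) \<otimes> g (fst z - snd z)) \<otimes> h (M - fst z)) =
      tw (fst (\<phi> z)) (M - fst (\<phi> z)) \<otimes> (f (fst (\<phi> z)) \<otimes>
      (tw (snd (\<phi> z)) (M - fst (\<phi> z) - snd (\<phi> z)) \<otimes>
        (g (snd (\<phi> z)) \<otimes> h (M - fst (\<phi> z) - snd (\<phi> z)))))"
      by (simp add: z \<phi>_def PK M add.assoc)
  qed (use assms in \<open>auto simp: tw_closed\<close>)
  also have "\<dots> = (\<Oplus>z\<in>\<phi> ` S1. tw (fst z) (M - fst z) \<otimes> (f (fst z) \<otimes>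
      (tw (snd z) (M - fst z - snd z) \<otimes> (g (snd z) \<otimes> h (M - fst z - snd z)))))"
    by (rule finsum_reindex[symmetric]) (use assms inj in \<open>auto simp: tw_closed\<close>)
  also have "\<dots> = (\<Oplus>K\<in>parts M. \<Oplus>L\<in>parts (M - K). tw K (M - K) \<otimes> (f K \<otimes>
      (tw L (M - K - L) \<otimes> (g L \<otimes> h (M - K - L)))))"
    unfolding im S2_def
    by (rule finsum_Sigma[symmetric]) (use assms in \<open>auto simp: finite_parts tw_closed\<close>)
  also have "\<dots> = (f \<otimes>\<^bsub>C\<^esub> (g \<otimes>\<^bsub>C\<^esub> h)) M"
    using assms mult_closed_C[OF g h]
    by (simp add: mult_C tw_closed finsum_rdistr finite_parts cong: finsum_cong)
  finally show "((f \<otimes>\<^bsub>C\<^esub> g) \<otimes>\<^bsub>C\<^esub> h) M = (f \<otimes>\<^bsub>C\<^esub> (g \<otimes>\<^bsub>C\<^esub> h)) M" .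
qed

lemma add_closed_C: "f \<in> carrier C \<Longrightarrow> g \<in> carrier C \<Longrightarrow> f \<oplus>\<^bsub>C\<^esub> g \<in> carrier C"
  by (rule carrierI) (simp_all add: add_C coeff_Supp)

lemma zero_closed_C: "\<zero>\<^bsub>C\<^esub> \<in> carrier C"
  by (rule carrierI) (simp_all add: zero_C)

lemma one_closed_C: "\<one>\<^bsub>C\<^esub> \<in> carrier C"
  using Supp_zero by (intro carrierI) (auto simp add: one_C)

lemma uminus_closed_C: "f \<in> carrier C \<Longrightarrow> (\<lambda>M. \<ominus> f M) \<in> carrier C"
  by (rule carrierI) (simp_all add: coeff_Supp)

definition mono :: "'i \<Rightarrow> 'a \<Rightarrow> 'i \<Rightarrow> 'a"
  where "mono K w = (\<lambda>M. if M = K then w else \<zero>)"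

lemma mono_closed [simp]: "w \<in> carrier A \<Longrightarrow> K \<in> Supp \<Longrightarrow> mono K w \<in> carrier C"
  by (rule carrierI) (auto simp: mono_def)

lemma mono_mult:
  assumes w: "w \<in> carrier A" and K: "K \<in> Supp" and f: "f \<in> carrier C"
  shows "(mono K w \<otimes>\<^bsub>C\<^esub> f) M = (if K \<in> parts M then tw K (M - K) \<otimes> (w \<otimes> f (M - K)) else \<zero>)"
proof -
  have "(mono K w \<otimes>\<^bsub>C\<^esub> f) M
    = (\<Oplus>L\<in>parts M. if L = K then tw K (M - K) \<otimes> (w \<otimes> f (M - K)) else \<zero>)"
    unfolding mult_C[OF mono_closed[OF w K] f]
    by (rule finsum_cong') (use assms in \<open>auto simp: mono_def tw_closed\<close>)
  also have "\<dots> = (if K \<in> parts M then tw K (M - K) \<otimes> (w \<otimes> f (M - K)) else \<zero>)"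
  proof (cases "K \<in> parts M")
    case True
    then show ?thesis
      using assms finsum_singleton[of K "parts M" "\<lambda>_. tw K (M - K) \<otimes> (w \<otimes> f (M - K))"]
      by (simp add: finite_parts tw_closed eq_commute)
  next
    case False
    then show ?thesis by (auto intro!: A.add.finprod_one_eqI)
  qed
  finally show ?thesis .
qed

lemma one_eq_mono: "\<one>\<^bsub>C\<^esub> = mono 0 \<one>"
  by (auto simp: one_C mono_def)

lemma const_mult:
  assumes "w \<in> carrier A" "f \<in> carrier C"
  shows "(mono 0 w \<otimes>\<^bsub>C\<^esub> f) = (\<lambda>M. w \<otimes> f M)"
  using assms by (auto simp: mono_mult Supp_zero tw_zero)

lemma cring_C: "cring C"
proof (rule cringI)
  show "abelian_group C"
  proof (rule abelian_groupI)
    fix f assume f: "f \<in> carrier C"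
    show "\<exists>y\<in>carrier C. y \<oplus>\<^bsub>C\<^esub> f = \<zero>\<^bsub>C\<^esub>"
      by (rule bexI[of _ "\<lambda>M. \<ominus> f M"])
        (use f in \<open>simp_all add: uminus_closed_C add_C zero_C l_neg\<close>)
  qed (simp_all add: add_closed_C zero_closed_C, simp_all add: add_C zero_C a_ac)
  show "comm_monoid C"
    by (rule comm_monoidI)
      (simp_all add: mult_closed_C one_closed_C mult_assoc_C,
       simp_all add: one_eq_mono const_mult mult_comm_C)
  fix f g h assume fgh: "f \<in> carrier C" "g \<in> carrier C" "h \<in> carrier C"
  show "(f \<oplus>\<^bsub>C\<^esub> g) \<otimes>\<^bsub>C\<^esub> h = f \<otimes>\<^bsub>C\<^esub> h \<oplus>\<^bsub>C\<^esub> g \<otimes>\<^bsub>C\<^esub> h"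
  proof
    fix M
    show "((f \<oplus>\<^bsub>C\<^esub> g) \<otimes>\<^bsub>C\<^esub> h) M = (f \<otimes>\<^bsub>C\<^esub> h \<oplus>\<^bsub>C\<^esub> g \<otimes>\<^bsub>C\<^esub> h) M"
      using fgh add_closed_C[OF fgh(1,2)]
      by (simp add: mult_C add_C tw_closed l_distr r_distr finsum_addf)
  qed
qed

sublocale C: cring C by (rule cring_C)

lemma coeff_uminus: "f \<in> carrier C \<Longrightarrow> (\<ominus>\<^bsub>C\<^esub> f) M = \<ominus> f M"
  by (metis C.r_neg C.a_inv_closed add_C coeff_closed zero_C A.minus_equality A.a_comm)

lemma coeff_minus: "f \<in> carrier C \<Longrightarrow> g \<in> carrier C \<Longrightarrow> (f \<ominus>\<^bsub>C\<^esub> g) M = f M \<ominus> g M"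
  by (simp add: a_minus_def add_C coeff_uminus)

lemma coeff_finsum:
  "\<phi> \<in> I \<rightarrow> carrier C \<Longrightarrow> (\<Oplus>\<^bsub>C\<^esub>i\<in>I. \<phi> i) M = (\<Oplus>i\<in>I. \<phi> i M)"
proof (induction I rule: infinite_finite_induct)
  case (insert i I)
  then show ?case
    by (subst C.finsum_insert; simp add: Pi_iff add_C)
qed (auto simp: zero_C)

lemma const_hom: "mono 0 \<in> ring_hom A C"
  by (rule ring_hom_memI)
     (auto simp: Supp_zero const_mult one_eq_mono, auto simp: mono_def add_C)

end

section \<open>Complete discrete valuation rings\<close>

text \<open>The properties of \<open>W\<close> and \<open>u\<close> on which everything rests: \<open>(u)\<close> contains all the nonunits, and the
\<open>u\<close>-adic topology is separated and complete.\<close>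
locale complete_dvr = W?: domain W for W :: "('a, 'm) ring_scheme" (structure) +
  fixes u :: 'a
  assumes u_closed [simp]: "u \<in> carrier W"
    and u_not_Unit: "u \<notin> Units W"
    and nonunit: "\<lbrakk>w \<in> carrier W; w \<notin> Units W\<rbrakk> \<Longrightarrow> w \<in> PIdl u"
    and separated: "\<lbrakk>w \<in> carrier W; \<And>n::nat. w \<in> PIdl (u [^] n)\<rbrakk> \<Longrightarrow> w = \<zero>"
    and complete: "adically_complete W u"
    and u_nonzero: "u \<noteq> \<zero>"
begin

definition U :: "nat \<Rightarrow> 'a set" where "U n = PIdl (u [^] n)"

lemma U_iff: "x \<in> U n \<longleftrightarrow> (\<exists>y\<in>carrier W. x = u [^] n \<otimes> y)"
  unfolding U_def cgenideal_def using m_comm by auto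

lemma U_ideal: "ideal (U n) W"
  unfolding U_def by (rule cgenideal_ideal) simp

lemma U_closed: "x \<in> U n \<Longrightarrow> x \<in> carrier W"
  by (auto simp: U_iff)

lemma U_zero [simp]: "U 0 = carrier W"
  by (auto simp: U_iff)

lemma U_mem_zero [simp]: "\<zero> \<in> U n"
  by (rule additive_subgroup.zero_closed[OF ideal.axioms(1)[OF U_ideal]])

lemma U_add: "x \<in> U n \<Longrightarrow> y \<in> U n \<Longrightarrow> x \<oplus> y \<in> U n"
  by (rule additive_subgroup.a_closed[OF ideal.axioms(1)[OF U_ideal]])

lemma U_uminus: "x \<in> U n \<Longrightarrow> \<ominus> x \<in> U n"
  by (rule additive_subgroup.a_inv_closed[OF ideal.axioms(1)[OF U_ideal]])

lemma U_minus: "x \<in> U n \<Longrightarrow> y \<in> U n \<Longrightarrow> x \<ominus> y \<in> U n"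
  by (simp add: a_minus_def U_add U_uminus)

lemma U_mult_left: "x \<in> U n \<Longrightarrow> y \<in> carrier W \<Longrightarrow> y \<otimes> x \<in> U n"
  by (rule ideal.I_l_closed[OF U_ideal])

lemma U_mult_right: "x \<in> U n \<Longrightarrow> y \<in> carrier W \<Longrightarrow> x \<otimes> y \<in> U n"
  by (rule ideal.I_r_closed[OF U_ideal])

lemma U_mult: assumes "x \<in> U m" "y \<in> U n" shows "x \<otimes> y \<in> U (m + n)"
proof -
  obtain a b where "a \<in> carrier W" "b \<in> carrier W" "x = u [^] m \<otimes> a" "y = u [^] n \<otimes> b"
    using assms by (auto simp: U_iff)
  then have "x \<otimes> y = u [^] (m + n) \<otimes> (a \<otimes> b)"
    by (simp add: nat_pow_mult[symmetric] m_ac)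
  then show ?thesis using \<open>a \<in> _\<close> \<open>b \<in> _\<close> by (auto simp: U_iff)
qed

lemma U_antimono: assumes "m \<le> n" "x \<in> U n" shows "x \<in> U m"
proof -
  obtain a where a: "a \<in> carrier W" "x = u [^] n \<otimes> a" using assms by (auto simp: U_iff)
  then have "x = u [^] m \<otimes> (u [^] (n - m) \<otimes> a)"
    using assms(1) by (simp add: m_assoc[symmetric] nat_pow_mult)
  then show ?thesis using a by (auto simp: U_iff)
qed

lemma U_finsum: "(\<And>i. i \<in> I \<Longrightarrow> f i \<in> U n) \<Longrightarrow> (\<Oplus>i\<in>I. f i) \<in> U n"
proof (induction I rule: infinite_finite_induct)
  case (insert i I)
  then show ?case by (subst finsum_insert) (auto intro: U_add U_closed)
qed auto

lemma upow_mem_U: "u [^] n \<in> U n"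
  by (auto simp: U_iff intro!: bexI[of _ \<one>])

lemma upow_nonzero: "u [^] (n::nat) \<noteq> \<zero>"
  by (induction n) (auto simp: u_nonzero integral_iff)

lemma U_separated: "x \<in> carrier W \<Longrightarrow> (\<And>n. x \<in> U n) \<Longrightarrow> x = \<zero>"
  using separated by (auto simp: U_def)

lemma U_cancel: assumes "u [^] m \<otimes> x \<in> U (m + n)" "x \<in> carrier W" shows "x \<in> U n"
proof -
  obtain a where a: "a \<in> carrier W" "u [^] m \<otimes> x = u [^] (m + n) \<otimes> a"
    using assms by (auto simp: U_iff)
  then have "u [^] m \<otimes> x = u [^] m \<otimes> (u [^] n \<otimes> a)"
    by (simp add: nat_pow_mult[symmetric] m_assoc)
  then have "x = u [^] n \<otimes> a"
    using m_lcancel[OF upow_nonzero[of m]] assms(2) a by simp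
  then show ?thesis using a by (auto simp: U_iff)
qed

lemma unit_iff: "w \<in> carrier W \<Longrightarrow> w \<in> Units W \<longleftrightarrow> w \<notin> U 1"
proof -
  assume w: "w \<in> carrier W"
  have "w \<notin> Units W" if w1: "w \<in> U 1"
  proof
    assume "w \<in> Units W"
    moreover obtain y where "y \<in> carrier W" "w = u \<otimes> y"
      using U_iff[THEN iffD1, OF w1] by auto
    ultimately show False using u_not_Unit by (metis u_closed unit_factor)
  qed
  then show ?thesis using nonunit[OF w] by (auto simp: U_def)
qed

lemma one_notin_U: "0 < n \<Longrightarrow> \<one> \<notin> U n"
  using U_antimono[of 1 n \<one>] unit_iff[of \<one>] by auto

lemma limit_exists:
  fixes z :: "nat \<Rightarrow> 'a" and k :: "nat \<Rightarrow> nat"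
  assumes z: "\<And>n. z n \<in> carrier W" and k: "\<And>m n. m \<le> n \<Longrightarrow> k m \<le> k n" "\<And>N. \<exists>n. N \<le> k n"
    and step: "\<And>n. z (Suc n) \<ominus> z n \<in> U (k n)"
  shows "\<exists>y\<in>carrier W. \<forall>n. y \<ominus> z n \<in> U (k n)"
proof -
  have step': "z (n + j) \<ominus> z n \<in> U (k n)" for n j
  proof (induction j)
    case 0 then show ?case using z by (simp add: a_minus_def r_neg)
  next
    case (Suc j)
    have "z (n + Suc j) \<ominus> z n = (z (Suc (n + j)) \<ominus> z (n + j)) \<oplus> (z (n + j) \<ominus> z n)"
    proof -
      have "z (Suc (n + j)) \<in> carrier W" "z (n + j) \<in> carrier W" "z n \<in> carrier W" using z by auto
      then show ?thesis by (simp, algebra)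
    qed
    moreover have "z (Suc (n + j)) \<ominus> z (n + j) \<in> U (k n)"
      using step[of "n + j"] k(1)[of n "n + j"] U_antimono by auto
    ultimately show ?case using U_add Suc by metis
  qed
  have step'': "z i \<ominus> z n \<in> U (k n)" if "n \<le> i" for i n
    using step'[of n "i - n"] that by simp
  have "\<exists>M. \<forall>i\<ge>M. \<forall>j\<ge>M. z i \<ominus> z j \<in> PIdl (u [^] N)" for N :: nat
  proof -
    obtain M where M: "N \<le> k M" using k(2) by blast
    have "z i \<ominus> z j \<in> U N" if "i \<ge> M" "j \<ge> M" for i j
    proof -
      have "z i \<ominus> z j = (z i \<ominus> z M) \<ominus> (z j \<ominus> z M)"
      proof -
        have "z i \<in> carrier W" "z j \<in> carrier W" "z M \<in> carrier W" using z by auto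
        then show ?thesis by algebra
      qed
      then show ?thesis
        using U_minus[OF U_antimono[OF M step''[OF that(1)]] U_antimono[OF M step''[OF that(2)]]]
        by simp
    qed
    then show ?thesis by (auto simp: U_def)
  qed
  then obtain y where y: "y \<in> carrier W" and lim: "\<And>N. \<exists>M. \<forall>i\<ge>M. z i \<ominus> y \<in> U N"
    using complete[unfolded adically_complete_def, rule_format, of z] z unfolding U_def by auto
  have "y \<ominus> z n \<in> U (k n)" for n
  proof -
    obtain M where M: "\<forall>i\<ge>M. z i \<ominus> y \<in> U (k n)" using lim by blast
    define i where "i = max M n"
    have "y \<ominus> z n = (z i \<ominus> z n) \<ominus> (z i \<ominus> y)"
    proof -
      have "z i \<in> carrier W" "z n \<in> carrier W" using z by auto
      then show ?thesis using y by algebra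
    qed
    then show ?thesis using step''[of n i] M U_minus by (metis i_def max.cobounded1 max.cobounded2)
  qed
  then show ?thesis using y by blast
qed

lemma minimal_power: assumes "x \<in> carrier W" "x \<noteq> \<zero>" shows "\<exists>n. x \<in> U n \<and> x \<notin> U (Suc n)"
proof (rule ccontr)
  assume *: "\<not> ?thesis"
  have "x \<in> U n" for n by (induction n) (use * assms in auto)
  then show False using assms U_separated by blast
qed

end

text \<open>A nonunit \<open>w \<noteq> 0\<close> of a principal ideal domain has an irreducible divisor \<open>q\<close>; the ideal \<open>(q)\<close> is maximal,
hence equal to \<open>(u)\<close>. A generator \<open>z\<close> of \<open>\<Inter>\<^sub>n (u\<^sup>n)\<close> has the form \<open>u y\<close>, and \<open>y\<close> lies in the
intersection again, so \<open>z \<in> u (z)\<close>, which forces \<open>z = 0\<close>.\<close>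
lemma complete_dvrI:
  assumes "discrete_valuation_ring W" "uniformizer W u" "adically_complete W u"
  shows "complete_dvr W u"
proof -
  interpret W: principal_domain W using assms(1) by (simp add: discrete_valuation_ring_def)
  have loc: "\<exists>!M. maximalideal M W" and nf: "\<not> field W"
    using assms(1) by (auto simp: discrete_valuation_ring_def local_cring_def)
  have u: "u \<in> carrier W" and M: "max_ideal W = PIdl\<^bsub>W\<^esub> u"
    using assms(2) by (auto simp: uniformizer_def)
  have max: "maximalideal (PIdl\<^bsub>W\<^esub> u) W"
    using theI'[OF loc] M unfolding max_ideal_def by simp
  have uniq: "I = PIdl\<^bsub>W\<^esub> u" if "maximalideal I W" for I using loc max that by blast
  have u0: "u \<noteq> \<zero>\<^bsub>W\<^esub>"
  proof
    assume "u = \<zero>\<^bsub>W\<^esub>"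
    then have "PIdl\<^bsub>W\<^esub> u = {\<zero>\<^bsub>W\<^esub>}"
      using W.cgenideal_eq_genideal[OF u] W.genideal_zero by simp
    then show False using max nf W.zeromaximalideal_eq_field by simp
  qed
  have uu: "u \<notin> Units W"
  proof
    assume "u \<in> Units W"
    then have "PIdl\<^bsub>W\<^esub> u = carrier W"
      using W.ideal_eq_carrier_iff u by blast
    then show False using maximalideal.I_notcarr[OF max] by simp
  qed
  have nonunit: "w \<in> PIdl\<^bsub>W\<^esub> u" if w: "w \<in> carrier W" "w \<notin> Units W" for w
  proof (cases "w = \<zero>\<^bsub>W\<^esub>")
    case True
    then show ?thesis using W.cgenideal_ideal[OF u]
      by (simp add: additive_subgroup.zero_closed ideal.axioms(1))
  next
    case False
    then have "w \<in> carrier W - {\<zero>\<^bsub>W\<^esub>}" using w(1) by simp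
    then obtain q where q: "q \<in> carrier W" "ring_irreducible\<^bsub>W\<^esub> q" "q divides\<^bsub>W\<^esub> w"
      by (rule W.exists_irreducible_divisor[OF _ w(2)])
    have "PIdl\<^bsub>W\<^esub> q = PIdl\<^bsub>W\<^esub> u" using uniq W.irreducible_imp_maximalideal q by blast
    moreover have "w \<in> PIdl\<^bsub>W\<^esub> q"
      using W.to_contain_is_to_divide[OF q(1) w(1)] W.cgenideal_self[OF w(1)] q(3) by blast
    ultimately show ?thesis by simp
  qed
  have sep: "w = \<zero>\<^bsub>W\<^esub>" if w: "w \<in> carrier W" "\<And>n::nat. w \<in> PIdl\<^bsub>W\<^esub> (u [^]\<^bsub>W\<^esub> n)" for w
  proof -
    define J where "J = (\<Inter>n::nat. PIdl\<^bsub>W\<^esub> (u [^]\<^bsub>W\<^esub> n))"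
    have "ideal J W" unfolding J_def
      by (rule W.i_Intersect) (auto intro: W.cgenideal_ideal u)
    then obtain z where z: "z \<in> carrier W" "J = PIdl\<^bsub>W\<^esub> z" using W.exists_gen by blast
    have zJ: "z \<in> PIdl\<^bsub>W\<^esub> (u [^]\<^bsub>W\<^esub> n)" for n :: nat
      using W.cgenideal_self[OF z(1)] z(2) unfolding J_def by auto
    obtain y where y: "y \<in> carrier W" "z = y \<otimes>\<^bsub>W\<^esub> u"
      using zJ[of 1] u unfolding cgenideal_def by auto
    have "y \<in> PIdl\<^bsub>W\<^esub> (u [^]\<^bsub>W\<^esub> n)" for n :: nat
    proof -
      obtain a where a: "a \<in> carrier W" "z = a \<otimes>\<^bsub>W\<^esub> (u [^]\<^bsub>W\<^esub> Suc n)"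
        using zJ[of "Suc n"] unfolding cgenideal_def by auto
      then have "y \<otimes>\<^bsub>W\<^esub> u = (a \<otimes>\<^bsub>W\<^esub> u [^]\<^bsub>W\<^esub> n) \<otimes>\<^bsub>W\<^esub> u" using y u by (simp add: W.m_assoc)
      then have "y = a \<otimes>\<^bsub>W\<^esub> u [^]\<^bsub>W\<^esub> n" using W.m_rcancel[OF u0 u] y a u by simp
      then show ?thesis using a unfolding cgenideal_def by auto
    qed
    then have "y \<in> J" unfolding J_def by blast
    then obtain t where t: "t \<in> carrier W" "y = t \<otimes>\<^bsub>W\<^esub> z" using z unfolding cgenideal_def by auto
    have "z = \<zero>\<^bsub>W\<^esub>"
    proof (rule ccontr)
      assume z0: "z \<noteq> \<zero>\<^bsub>W\<^esub>"
      have "\<one>\<^bsub>W\<^esub> \<otimes>\<^bsub>W\<^esub> z = (t \<otimes>\<^bsub>W\<^esub> u) \<otimes>\<^bsub>W\<^esub> z"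
      proof -
        have "\<one>\<^bsub>W\<^esub> \<otimes>\<^bsub>W\<^esub> z = (t \<otimes>\<^bsub>W\<^esub> z) \<otimes>\<^bsub>W\<^esub> u"
          using W.l_one[OF z(1)] y(2) t(2) by metis
        then show ?thesis by (simp add: W.m_ac t(1) z(1) u)
      qed
      then have "\<one>\<^bsub>W\<^esub> = t \<otimes>\<^bsub>W\<^esub> u"
        using W.m_rcancel[OF z0 z(1) W.one_closed W.m_closed[OF t(1) u]] by simp
      then have "u \<otimes>\<^bsub>W\<^esub> t \<in> Units W" using W.m_comm[OF u t(1)] W.Units_one_closed by metis
      then have "u \<in> Units W" by (rule W.unit_factor[OF _ u t(1)])
      then show False using uu by blast
    qed
    moreover have "w \<in> J" using w by (auto simp: J_def)
    ultimately show ?thesis using z unfolding cgenideal_def by auto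
  qed
  show ?thesis
    by (rule complete_dvr.intro[OF W.domain_axioms], rule complete_dvr_axioms.intro)
       (use u uu nonunit sep assms(3) u0 in auto)
qed

section \<open>The filtration and its completeness\<close>

locale filtered_convolution_ring = complete_dvr W u + convolution_ring W Supp tw C
  for W :: "('a, 'm) ring_scheme" (structure) and u
    and Supp :: "'i::cancel_comm_monoid_add set" and tw and C :: "('i \<Rightarrow> 'a) ring" +
  fixes wd :: "'i \<Rightarrow> nat"
  assumes wd_add: "wd (K + L) = wd K + wd L"
    and wd_pos: "M \<noteq> 0 \<Longrightarrow> 0 < wd M"
begin

lemma wd_zero: "wd 0 = 0"
  using wd_add[of 0 0] by simp

text \<open>The filtration for which \<open>u\<close> has weight \<open>2\<close> and the basis element of degree \<open>M\<close> has weight \<open>wd M\<close>: the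
exponent is \<open>(n - wd M)/2\<close>, rounded up. The weight \<open>2\<close> leaves room for one variable of weight \<open>1\<close> below
all the other generators of the maximal ideal, as Weierstrass division requires.\<close>
definition F :: "nat \<Rightarrow> ('i \<Rightarrow> 'a) set"
  where "F n = {f \<in> carrier C. \<forall>M. f M \<in> U ((n + 1 - wd M) div 2)}"

lemma F_closed: "f \<in> F n \<Longrightarrow> f \<in> carrier C"
  by (simp add: F_def)

lemma F_coeff: "f \<in> F n \<Longrightarrow> f M \<in> U ((n + 1 - wd M) div 2)"
  by (simp add: F_def)

lemma F_zero [simp]: "F 0 = carrier C"
  by (auto simp: F_def div_eq_0_iff)

lemma F_one_iff: "f \<in> F 1 \<longleftrightarrow> f \<in> carrier C \<and> f 0 \<in> U 1"
proof -
  have "f M \<in> U ((1 + 1 - wd M) div 2)" if "M \<noteq> 0" "f \<in> carrier C" for M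
  proof -
    have "(1 + 1 - wd M) div 2 = 0" using wd_pos[OF that(1)] by simp
    then show ?thesis using that by simp
  qed
  moreover have "(1 + 1 - wd (0::'i)) div 2 = 1" by (simp add: wd_zero)
  ultimately show ?thesis unfolding F_def by (smt (verit) mem_Collect_eq)
qed

lemma F_antimono: "m \<le> n \<Longrightarrow> f \<in> F n \<Longrightarrow> f \<in> F m"
  unfolding F_def by (auto intro: U_antimono[OF div_le_mono[OF diff_le_mono]])

lemma F_mem_zero [simp]: "\<zero>\<^bsub>C\<^esub> \<in> F n"
  by (simp add: F_def zero_closed_C) (simp add: zero_C)

lemma F_add: "f \<in> F n \<Longrightarrow> g \<in> F n \<Longrightarrow> f \<oplus>\<^bsub>C\<^esub> g \<in> F n"
  by (simp add: F_def add_closed_C) (simp add: add_C U_add)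

lemma F_uminus: "f \<in> F n \<Longrightarrow> \<ominus>\<^bsub>C\<^esub> f \<in> F n"
  by (simp add: F_def coeff_uminus U_uminus)

lemma F_minus: "f \<in> F n \<Longrightarrow> g \<in> F n \<Longrightarrow> f \<ominus>\<^bsub>C\<^esub> g \<in> F n"
  by (simp add: a_minus_def F_add F_uminus)

lemma F_finsum: "(\<And>i. i \<in> I \<Longrightarrow> \<phi> i \<in> F n) \<Longrightarrow> (\<Oplus>\<^bsub>C\<^esub>i\<in>I. \<phi> i) \<in> F n"
proof (induction I rule: infinite_finite_induct)
  case (insert i I)
  then show ?case by (subst C.finsum_insert) (auto intro: F_add F_closed)
qed auto

lemma F_mult: assumes "f \<in> F m" "g \<in> F n" shows "f \<otimes>\<^bsub>C\<^esub> g \<in> F (m + n)"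
proof -
  have "(f \<otimes>\<^bsub>C\<^esub> g) M \<in> U ((m + n + 1 - wd M) div 2)" for M
  proof -
    have "tw K (M - K) \<otimes> (f K \<otimes> g (M - K)) \<in> U ((m + n + 1 - wd M) div 2)"
      if K: "K \<in> parts M" for K
    proof (rule U_mult_left)
      have w: "wd M = wd K + wd (M - K)" using parts_diff[OF K] wd_add by metis
      show "f K \<otimes> g (M - K) \<in> U ((m + n + 1 - wd M) div 2)"
        by (rule U_antimono[OF _ U_mult[OF F_coeff[OF assms(1)] F_coeff[OF assms(2)]]])
           (use w in linarith)
    qed (rule tw_closed)
    then show ?thesis using assms by (simp add: mult_C F_closed U_finsum)
  qed
  then show ?thesis using assms by (simp add: F_def)
qed

lemma F_mult_left: "f \<in> carrier C \<Longrightarrow> g \<in> F n \<Longrightarrow> f \<otimes>\<^bsub>C\<^esub> g \<in> F n"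
  using F_mult[of f 0 g n] by simp

lemma F_separated: assumes "f \<in> carrier C" "\<And>n. f \<in> F n" shows "f = \<zero>\<^bsub>C\<^esub>"
proof
  fix M
  have "f M \<in> U n" for n
    using F_coeff[OF assms(2)[of "2 * n + wd M"], of M] by simp
  then show "f M = \<zero>\<^bsub>C\<^esub> M" using assms by (simp add: zero_C U_separated)
qed

lemma F_complete:
  assumes y: "\<And>n. y n \<in> carrier C" and step: "\<And>n. y (Suc n) \<ominus>\<^bsub>C\<^esub> y n \<in> F n"
  shows "\<exists>l\<in>carrier C. \<forall>n. l \<ominus>\<^bsub>C\<^esub> y n \<in> F n"
proof -
  have "\<exists>l\<in>carrier W. (M \<notin> Supp \<longrightarrow> l = \<zero>) \<and> (\<forall>n. l \<ominus> y n M \<in> U ((n + 1 - wd M) div 2))" for M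
  proof (cases "M \<in> Supp")
    case False
    then show ?thesis by (auto intro!: bexI[of _ \<zero>] simp: coeff_Supp[OF y False] a_minus_def)
  next
    case True
    have "\<exists>l\<in>carrier W. \<forall>n. l \<ominus> y n M \<in> U ((n + 1 - wd M) div 2)"
    proof (rule limit_exists)
      show "y n M \<in> carrier W" for n using y by simp
      show "(m + 1 - wd M) div 2 \<le> (n + 1 - wd M) div 2" if "m \<le> n" for m n
        using that by (intro div_le_mono diff_le_mono) simp
      show "\<exists>n. N \<le> (n + 1 - wd M) div 2" for N
        by (rule exI[of _ "2 * N + wd M"]) simp
      show "y (Suc n) M \<ominus> y n M \<in> U ((n + 1 - wd M) div 2)" for n
        using F_coeff[OF step[of n], of M] y by (simp add: coeff_minus)
    qed
    then show ?thesis using True by simp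
  qed
  then obtain l where l: "\<And>M. l M \<in> carrier W" "\<And>M. M \<notin> Supp \<Longrightarrow> l M = \<zero>"
    "\<And>M n. l M \<ominus> y n M \<in> U ((n + 1 - wd M) div 2)" by metis
  have "l \<in> carrier C" using l by (intro carrierI)
  moreover have "l \<ominus>\<^bsub>C\<^esub> y n \<in> F n" for n
    unfolding F_def using l(3) y \<open>l \<in> carrier C\<close> by (simp add: coeff_minus)
  ultimately show ?thesis by blast
qed

text \<open>The iterates of \<open>q \<mapsto> g - \<Phi>(q)\<close> form a Cauchy sequence. Inverses of power series and Weierstrass division
are both instances.\<close>
lemma fixed_point:
  assumes closed: "\<And>f. f \<in> carrier C \<Longrightarrow> \<Phi> f \<in> carrier C"
    and minus: "\<And>f g. \<lbrakk>f \<in> carrier C; g \<in> carrier C\<rbrakk> \<Longrightarrow> \<Phi> (f \<ominus>\<^bsub>C\<^esub> g) = \<Phi> f \<ominus>\<^bsub>C\<^esub> \<Phi> g"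
    and contract: "\<And>n f. f \<in> F n \<Longrightarrow> \<Phi> f \<in> F (Suc n)"
    and g: "g \<in> carrier C"
  shows "\<exists>q\<in>carrier C. q \<oplus>\<^bsub>C\<^esub> \<Phi> q = g"
proof -
  define q where "q = rec_nat \<zero>\<^bsub>C\<^esub> (\<lambda>_ x. g \<ominus>\<^bsub>C\<^esub> \<Phi> x)"
  have q0: "q 0 = \<zero>\<^bsub>C\<^esub>" and qS: "q (Suc n) = g \<ominus>\<^bsub>C\<^esub> \<Phi> (q n)" for n by (simp_all add: q_def)
  have qc: "q n \<in> carrier C" for n by (induction n) (auto simp: q0 qS closed g)
  have step: "q (Suc n) \<ominus>\<^bsub>C\<^esub> q n \<in> F n" for n
  proof (induction n)
    case 0 then show ?case using qc by simp
  next
    case (Suc n)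
    have "\<Phi> (q (Suc n)) \<in> carrier C" "\<Phi> (q n) \<in> carrier C" using closed qc by auto
    then have "(g \<ominus>\<^bsub>C\<^esub> \<Phi> (q (Suc n))) \<ominus>\<^bsub>C\<^esub> (g \<ominus>\<^bsub>C\<^esub> \<Phi> (q n)) = \<ominus>\<^bsub>C\<^esub> (\<Phi> (q (Suc n)) \<ominus>\<^bsub>C\<^esub> \<Phi> (q n))"
      using g by algebra
    then have "q (Suc (Suc n)) \<ominus>\<^bsub>C\<^esub> q (Suc n) = \<ominus>\<^bsub>C\<^esub> \<Phi> (q (Suc n) \<ominus>\<^bsub>C\<^esub> q n)"
      using minus[OF qc qc] qS by metis
    then show ?case using F_uminus[OF contract[OF Suc]] by simp
  qed
  obtain l where l: "l \<in> carrier C" "\<And>n. l \<ominus>\<^bsub>C\<^esub> q n \<in> F n"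
    using F_complete[OF qc step] by blast
  have "(l \<oplus>\<^bsub>C\<^esub> \<Phi> l) \<ominus>\<^bsub>C\<^esub> g = \<zero>\<^bsub>C\<^esub>"
  proof (rule F_separated)
    fix n
    have "\<Phi> l \<in> carrier C" "\<Phi> (q n) \<in> carrier C" using closed qc l by auto
    then have "(l \<oplus>\<^bsub>C\<^esub> \<Phi> l) \<ominus>\<^bsub>C\<^esub> g = (l \<ominus>\<^bsub>C\<^esub> (g \<ominus>\<^bsub>C\<^esub> \<Phi> (q n))) \<oplus>\<^bsub>C\<^esub> (\<Phi> l \<ominus>\<^bsub>C\<^esub> \<Phi> (q n))"
      using l g by algebra
    then have "(l \<oplus>\<^bsub>C\<^esub> \<Phi> l) \<ominus>\<^bsub>C\<^esub> g = (l \<ominus>\<^bsub>C\<^esub> q (Suc n)) \<oplus>\<^bsub>C\<^esub> \<Phi> (l \<ominus>\<^bsub>C\<^esub> q n)"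
      using minus[OF l(1) qc] qS by simp
    then have "(l \<oplus>\<^bsub>C\<^esub> \<Phi> l) \<ominus>\<^bsub>C\<^esub> g \<in> F (Suc n)"
      using F_add[OF l(2)[of "Suc n"] contract[OF l(2)[of n]]] by simp
    then show "(l \<oplus>\<^bsub>C\<^esub> \<Phi> l) \<ominus>\<^bsub>C\<^esub> g \<in> F n" by (rule F_antimono[rotated]) simp
  qed (use l closed g in auto)
  moreover have "l \<oplus>\<^bsub>C\<^esub> \<Phi> l \<in> carrier C" using l closed by auto
  ultimately have "l \<oplus>\<^bsub>C\<^esub> \<Phi> l = g" using g C.r_right_minus_eq by blast
  then show ?thesis using l by blast
qed

end

section \<open>Power series\<close>

text \<open>The variables may be any set \<open>V\<close> of indices, because variables will be eliminated one by one. All these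
rings share their operations, so that a smaller set of variables gives a subring.\<close>
definition ps_ring :: "('a, 'm) ring_scheme \<Rightarrow> nat set \<Rightarrow> (nat multiset \<Rightarrow> 'a) ring"
  where "ps_ring W V = (power_series_ring W 0)\<lparr>carrier :=
    {f. \<forall>M. f M \<in> carrier W \<and> (\<not> set_mset M \<subseteq> V \<longrightarrow> f M = \<zero>\<^bsub>W\<^esub>)}\<rparr>"

abbreviation ps_hom :: "('a, 'm) ring_scheme \<Rightarrow> nat set \<Rightarrow> ('b, 'n) ring_scheme \<Rightarrow> ('a \<Rightarrow> 'b)
    \<Rightarrow> ((nat multiset \<Rightarrow> 'a) \<Rightarrow> 'b) set"
  where "ps_hom W V \<equiv> alg_hom W (ps_ring W V) (power_series_const W)"

lemma power_series_ring_eq: "power_series_ring W r = ps_ring W {..<r}"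
  by (simp add: ps_ring_def power_series_ring_def)

lemma parts_multiset: "parts M = {K. K \<subseteq># M}"
  by (auto simp: parts_def mset_subset_eq_exists_conv)

lemma finite_submultisets: "finite {K. K \<subseteq># M}"
proof -
  have "{K. K \<subseteq># M} \<subseteq> (\<Union>n\<le>size M. multisets_of_size (set_mset M) n)"
    by (auto simp: multisets_of_size_def size_mset_mono dest: mset_subset_eqD)
  then show ?thesis by (rule finite_subset) auto
qed

lemma convolution_ring_ps:
  assumes "cring W"
  shows "convolution_ring W {M. set_mset M \<subseteq> V} (\<lambda>_ _. \<one>\<^bsub>W\<^esub>) (ps_ring W V)"
proof -
  interpret cring W by fact
  show ?thesis
  proof (rule convolution_ring.intro[OF is_cring convolution_ring_axioms.intro])
    fix f g M
    assume "f \<in> carrier (ps_ring W V)" "g \<in> carrier (ps_ring W V)"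
    then show "(f \<otimes>\<^bsub>ps_ring W V\<^esub> g) M =
        (\<Oplus>\<^bsub>W\<^esub>K\<in>parts M. \<one>\<^bsub>W\<^esub> \<otimes>\<^bsub>W\<^esub> (f K \<otimes>\<^bsub>W\<^esub> g (M - K)))"
      unfolding parts_multiset ps_ring_def power_series_ring_def
      by simp
  qed (simp_all add: parts_multiset finite_submultisets,
       simp_all add: ps_ring_def power_series_ring_def)
qed

locale power_series = complete_dvr W u for W :: "('a, 'm) ring_scheme" (structure) and u +
  fixes V :: "nat set"
  assumes finite_V: "finite V"
begin

sublocale P: convolution_ring W "{M. set_mset M \<subseteq> V}" "\<lambda>_ _. \<one>" "ps_ring W V"
  by (rule convolution_ring_ps) (rule W.is_cring)

abbreviation "P \<equiv> ps_ring W V"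

lemma filtered:
  assumes "\<And>K L. wd (K + L) = wd K + wd L" "\<And>M. M \<noteq> {#} \<Longrightarrow> 0 < wd M"
  shows "filtered_convolution_ring W u {M. set_mset M \<subseteq> V} (\<lambda>_ _. \<one>) P wd"
  by (intro filtered_convolution_ring.intro filtered_convolution_ring_axioms.intro
      complete_dvr_axioms P.convolution_ring_axioms) (use assms in auto)

lemma const_eq: "power_series_const W w = P.mono 0 w"
  by (simp add: power_series_const_def P.mono_def)

definition Var :: "nat \<Rightarrow> nat multiset \<Rightarrow> 'a" where "Var i = P.mono {#i#} \<one>"

lemma Var_closed [simp]: "i \<in> V \<Longrightarrow> Var i \<in> carrier P"
  by (simp add: Var_def)

lemma Var_mult: "i \<in> V \<Longrightarrow> f \<in> carrier P \<Longrightarrow>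
    (Var i \<otimes>\<^bsub>P\<^esub> f) M = (if i \<in># M then f (M - {#i#}) else \<zero>)"
  by (simp add: Var_def P.mono_mult parts_multiset)

text \<open>The quotient of \<open>f\<close> by the \<open>i\<close>-th variable, after all the terms without that variable have been dropped.\<close>
definition \<tau> :: "nat \<Rightarrow> (nat multiset \<Rightarrow> 'a) \<Rightarrow> nat multiset \<Rightarrow> 'a"
  where "\<tau> i f = (\<lambda>M. f (add_mset i M))"

definition restr :: "nat set \<Rightarrow> (nat multiset \<Rightarrow> 'a) \<Rightarrow> nat multiset \<Rightarrow> 'a"
  where "restr S f = (\<lambda>M. if set_mset M \<inter> S = {} then f M else \<zero>)"

lemma \<tau>_closed [simp]: "f \<in> carrier P \<Longrightarrow> \<tau> i f \<in> carrier P"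
  by (rule P.carrierI) (auto simp: \<tau>_def P.coeff_Supp)

lemma restr_closed [simp]: "f \<in> carrier P \<Longrightarrow> restr S f \<in> carrier P"
  by (rule P.carrierI) (auto simp: restr_def P.coeff_Supp)

lemma restr_insert:
  assumes "f \<in> carrier P" "i \<in> V"
  shows "restr S f = restr (insert i S) f \<oplus>\<^bsub>P\<^esub> Var i \<otimes>\<^bsub>P\<^esub> \<tau> i (restr S f)"
proof
  fix M
  have *: "\<tau> i g (M - {#i#}) = g M" if "i \<in># M" for g
    using that by (simp add: \<tau>_def)
  show "restr S f M = (restr (insert i S) f \<oplus>\<^bsub>P\<^esub> Var i \<otimes>\<^bsub>P\<^esub> \<tau> i (restr S f)) M"
    using assms P.coeff_closed[of f M]
    by (simp add: P.add_C Var_mult *) (auto simp: restr_def)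
qed

lemma restr_all: "f \<in> carrier P \<Longrightarrow> restr V f = P.mono 0 (f {#})"
proof
  fix M assume f: "f \<in> carrier P"
  show "restr V f M = P.mono 0 (f {#}) M"
    using P.coeff_Supp[OF f, of M] by (auto simp: restr_def P.mono_def)
       (metis (no_types, lifting) Int_absorb2 set_mset_eq_empty_iff)
qed

text \<open>Every power series is a constant plus a combination of the variables, so the values of \<open>D\<close> lie in the ideal
generated by the \<open>x\<^sub>i\<close> times values of \<open>D\<close>, and iteration pushes them arbitrarily deep into the
filtration \<open>G\<close>. Applied to \<open>D = h - h'\<close> this shows that homomorphisms are determined by the images of the
variables; applied to \<open>D f = h(f g) - h(f) h(g)\<close> it shows multiplicativity.\<close>
lemma vanishing:
  fixes B :: "('b, 'l) ring_scheme" and G :: "nat \<Rightarrow> 'b set"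
  assumes D_add: "\<And>f g. \<lbrakk>f \<in> carrier P; g \<in> carrier P\<rbrakk> \<Longrightarrow> D (f \<oplus>\<^bsub>P\<^esub> g) = D f \<oplus>\<^bsub>B\<^esub> D g"
    and D_const: "\<And>w. w \<in> carrier W \<Longrightarrow> D (P.mono 0 w) = \<zero>\<^bsub>B\<^esub>"
    and D_Var: "\<And>i f. \<lbrakk>i \<in> V; f \<in> carrier P\<rbrakk> \<Longrightarrow> D (Var i \<otimes>\<^bsub>P\<^esub> f) = x i \<otimes>\<^bsub>B\<^esub> D f"
    and G_zero: "\<And>n. \<zero>\<^bsub>B\<^esub> \<in> G n"
    and G_add: "\<And>n a b. \<lbrakk>a \<in> G n; b \<in> G n\<rbrakk> \<Longrightarrow> a \<oplus>\<^bsub>B\<^esub> b \<in> G n"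
    and G_x: "\<And>n i a. \<lbrakk>i \<in> V; a \<in> G n\<rbrakk> \<Longrightarrow> x i \<otimes>\<^bsub>B\<^esub> a \<in> G (Suc n)"
    and G_start: "\<And>f. f \<in> carrier P \<Longrightarrow> D f \<in> G 0"
    and f: "f \<in> carrier P"
  shows "D f \<in> G n"
  using f
proof (induction n arbitrary: f)
  case 0 then show ?case by (rule G_start)
next
  case (Suc n)
  \<comment> \<open>Split off the variables in \<open>S\<close> one at a time; for \<open>S = V\<close> only the constant term remains.\<close>
  have step: "D f \<in> G (Suc n)" if "finite S" "S \<subseteq> V" "D (restr S f) \<in> G (Suc n)" for S
    using that
  proof (induction S rule: finite_induct)
    case empty
    then show ?case by (simp add: restr_def)
  next
    case (insert i S)
    have "D (restr S f) = D (restr (insert i S) f) \<oplus>\<^bsub>B\<^esub> x i \<otimes>\<^bsub>B\<^esub> D (\<tau> i (restr S f))"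
    proof -
      have i: "i \<in> V" using insert.prems by simp
      show ?thesis
        by (subst restr_insert[OF Suc.prems i])
           (simp add: D_add D_Var Suc.prems i P.mult_closed_C)
    qed
    moreover have "D (\<tau> i (restr S f)) \<in> G n" using Suc by simp
    ultimately have "D (restr S f) \<in> G (Suc n)" using insert.prems G_add G_x by simp
    then show ?case using insert by auto
  qed
  show ?case
    by (rule step[OF finite_V]) (simp_all add: restr_all[OF Suc.prems] D_const G_zero Suc.prems)
qed

lemma hom_unique:
  fixes B :: "('b, 'l) ring_scheme" and G :: "nat \<Rightarrow> 'b set"
  assumes B: "cring B"
    and h: "h \<in> ps_hom W V B \<beta>"
    and h': "h' \<in> ps_hom W V B \<beta>"
    and hV: "\<And>i. i \<in> V \<Longrightarrow> h (Var i) = h' (Var i)"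
    and G_zero: "\<And>n. \<zero>\<^bsub>B\<^esub> \<in> G n"
    and G_add: "\<And>n a b. \<lbrakk>a \<in> G n; b \<in> G n\<rbrakk> \<Longrightarrow> a \<oplus>\<^bsub>B\<^esub> b \<in> G n"
    and G_x: "\<And>n i a. \<lbrakk>i \<in> V; a \<in> G n\<rbrakk> \<Longrightarrow> h (Var i) \<otimes>\<^bsub>B\<^esub> a \<in> G (Suc n)"
    and G_start: "carrier B \<subseteq> G 0"
    and G_sep: "\<And>b. \<lbrakk>b \<in> carrier B; \<And>n. b \<in> G n\<rbrakk> \<Longrightarrow> b = \<zero>\<^bsub>B\<^esub>"
    and f: "f \<in> carrier P"
  shows "h f = h' f"
proof -
  interpret B: cring B by fact
  interpret h: ring_hom_cring P B h
    using h P.cring_C B by (intro UnivPoly.ring_hom_cringI) (auto simp: alg_hom_def)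
  interpret h': ring_hom_cring P B h'
    using h' P.cring_C B by (intro UnivPoly.ring_hom_cringI) (auto simp: alg_hom_def)
  have "h f \<ominus>\<^bsub>B\<^esub> h' f \<in> G n" for n
  proof (rule vanishing[where D = "\<lambda>f. h f \<ominus>\<^bsub>B\<^esub> h' f" and G = G and x = "\<lambda>i. h (Var i)" and B = B,
      OF _ _ _ G_zero G_add G_x _ f])
    fix f g assume "f \<in> carrier P" "g \<in> carrier P"
    then show "h (f \<oplus>\<^bsub>P\<^esub> g) \<ominus>\<^bsub>B\<^esub> h' (f \<oplus>\<^bsub>P\<^esub> g) = (h f \<ominus>\<^bsub>B\<^esub> h' f) \<oplus>\<^bsub>B\<^esub> (h g \<ominus>\<^bsub>B\<^esub> h' g)"
      using h.hom_closed h'.hom_closed by (simp, algebra)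
  next
    fix i f assume i: "i \<in> V" and "f \<in> carrier P"
    then show "h (Var i \<otimes>\<^bsub>P\<^esub> f) \<ominus>\<^bsub>B\<^esub> h' (Var i \<otimes>\<^bsub>P\<^esub> f) = h (Var i) \<otimes>\<^bsub>B\<^esub> (h f \<ominus>\<^bsub>B\<^esub> h' f)"
      using h.hom_closed h'.hom_closed hV[OF i] h.hom_closed[OF Var_closed[OF i]]
      by (simp add: B.minus_eq B.r_distr B.r_minus)
  next
    fix w assume w: "w \<in> carrier W"
    have "h (P.mono 0 w) = h' (P.mono 0 w)" "h (P.mono 0 w) \<in> carrier B"
      using h h' w h.hom_closed[OF P.mono_closed[OF w P.Supp_zero]]
      by (auto simp: alg_hom_def const_eq)
    then show "h (P.mono 0 w) \<ominus>\<^bsub>B\<^esub> h' (P.mono 0 w) = \<zero>\<^bsub>B\<^esub>"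
      by (simp add: B.minus_eq B.r_neg)
  next
    fix f assume "f \<in> carrier P"
    then show "h f \<ominus>\<^bsub>B\<^esub> h' f \<in> G 0" using G_start by (auto simp: h.hom_closed h'.hom_closed)
  qed
  then have "h f \<ominus>\<^bsub>B\<^esub> h' f = \<zero>\<^bsub>B\<^esub>"
    using f by (intro G_sep) (auto simp: h.hom_closed h'.hom_closed)
  then show ?thesis using f by (simp add: B.r_right_minus_eq h.hom_closed h'.hom_closed)
qed

end

section \<open>Substitution into power series\<close>

definition mpow :: "('b, 'l) ring_scheme \<Rightarrow> nat set \<Rightarrow> (nat \<Rightarrow> 'b) \<Rightarrow> nat multiset \<Rightarrow> 'b"
  where "mpow B V x M = (\<Otimes>\<^bsub>B\<^esub>i\<in>V. x i [^]\<^bsub>B\<^esub> count M i)"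

context cring
begin

lemma mpow_closed: "(\<And>i. i \<in> V \<Longrightarrow> x i \<in> carrier R) \<Longrightarrow> mpow R V x M \<in> carrier R"
  unfolding mpow_def by (rule finprod_closed) auto

lemma mpow_empty: "mpow R V x {#} = \<one>"
  unfolding mpow_def by (rule finprod_one_eqI) auto

lemma mpow_add_mset:
  assumes V: "finite V" and i: "i \<in> V" and x: "\<And>i. i \<in> V \<Longrightarrow> x i \<in> carrier R"
  shows "mpow R V x (add_mset i M) = x i \<otimes> mpow R V x M"
proof -
  have "mpow R V x (add_mset i M) = (\<Otimes>j\<in>V. (if i = j then x j else \<one>) \<otimes> x j [^] count M j)"
    unfolding mpow_def by (rule finprod_cong') (use x in \<open>auto simp: m_comm\<close>)
  also have "\<dots> = (\<Otimes>j\<in>V. if i = j then x j else \<one>) \<otimes> mpow R V x M"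
    unfolding mpow_def by (rule finprod_multf) (use x in auto)
  also have "(\<Otimes>j\<in>V. if i = j then x j else \<one>) = x i"
    using finprod_singleton[of i V x] i V x by auto
  finally show ?thesis .
qed

end

text \<open>By \<open>F_one_iff\<close> the condition on \<open>x\<^sub>i\<close> says that its constant term lies in \<open>(u)\<close>.\<close>
locale substitution = filtered_convolution_ring W u Supp tw C wd
  for W :: "('a, 'm) ring_scheme" (structure) and u
    and Supp :: "'i::cancel_comm_monoid_add set" and tw and C :: "('i \<Rightarrow> 'a) ring" and wd +
  fixes V :: "nat set" and x :: "nat \<Rightarrow> 'i \<Rightarrow> 'a"
  assumes finite_V: "finite V"
    and x_F: "i \<in> V \<Longrightarrow> x i \<in> F 1"
begin

sublocale P: power_series W u V
  by (rule power_series.intro[OF complete_dvr_axioms power_series_axioms.intro[OF finite_V]])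

abbreviation "P \<equiv> ps_ring W V"

lemma x_closed [simp]: "i \<in> V \<Longrightarrow> x i \<in> carrier C"
  using x_F F_closed by blast

abbreviation "xpow \<equiv> mpow C V x"

lemma xpow_closed [simp]: "xpow M \<in> carrier C"
  by (rule C.mpow_closed) simp

lemma xpow_empty [simp]: "xpow {#} = \<one>\<^bsub>C\<^esub>"
  by (rule C.mpow_empty)

lemma xpow_add_mset: "i \<in> V \<Longrightarrow> xpow (add_mset i M) = x i \<otimes>\<^bsub>C\<^esub> xpow M"
  by (rule C.mpow_add_mset) (auto simp: finite_V)

lemma xpow_F: "set_mset M \<subseteq> V \<Longrightarrow> xpow M \<in> F (size M)"
proof (induction M)
  case (add i M)
  then show ?case using F_mult[OF x_F[of i], of "xpow M" "size M"] by (simp add: xpow_add_mset)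
qed (simp add: one_closed_C)

definition mons :: "nat \<Rightarrow> nat multiset set"
  where "mons N = {M. set_mset M \<subseteq> V \<and> size M < N}"

lemma finite_mons: "finite (mons N)"
proof -
  have "mons N \<subseteq> (\<Union>n<N. multisets_of_size V n)"
    by (auto simp: mons_def multisets_of_size_def)
  then show ?thesis by (rule finite_subset) (use finite_V in auto)
qed

definition ev :: "nat \<Rightarrow> (nat multiset \<Rightarrow> 'a) \<Rightarrow> 'i \<Rightarrow> 'a"
  where "ev N f = (\<Oplus>\<^bsub>C\<^esub>M\<in>mons N. mono 0 (f M) \<otimes>\<^bsub>C\<^esub> xpow M)"

lemma const_closed [simp]: "w \<in> carrier W \<Longrightarrow> mono 0 w \<in> carrier C"
  by (simp add: Supp_zero)

lemma const_add: "w \<in> carrier W \<Longrightarrow> v \<in> carrier W \<Longrightarrow> mono 0 (w \<oplus> v) = mono 0 w \<oplus>\<^bsub>C\<^esub> mono 0 v"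
  using ring_hom_add[OF const_hom] by blast

lemma const_mult': "w \<in> carrier W \<Longrightarrow> v \<in> carrier W \<Longrightarrow> mono 0 (w \<otimes> v) = mono 0 w \<otimes>\<^bsub>C\<^esub> mono 0 v"
  using ring_hom_mult[OF const_hom] by blast

lemma const_zero: "mono 0 \<zero> = \<zero>\<^bsub>C\<^esub>"
  by (auto simp: mono_def zero_C)

lemma ev_closed [simp]: "f \<in> carrier P \<Longrightarrow> ev N f \<in> carrier C"
  unfolding ev_def by (rule C.finsum_closed) auto

lemma ev_add: "f \<in> carrier P \<Longrightarrow> g \<in> carrier P \<Longrightarrow> ev N (f \<oplus>\<^bsub>P\<^esub> g) = ev N f \<oplus>\<^bsub>C\<^esub> ev N g"
  unfolding ev_def P.P.add_C
  by (subst C.finsum_addf[symmetric]) (auto simp: const_add C.l_distr intro!: C.finsum_cong')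

lemma ev_const_mult:
  assumes "w \<in> carrier W" "f \<in> carrier P"
  shows "ev N (P.P.mono 0 w \<otimes>\<^bsub>P\<^esub> f) = mono 0 w \<otimes>\<^bsub>C\<^esub> ev N f"
  unfolding ev_def P.P.const_mult[OF assms]
  using assms finite_mons
  by (subst C.finsum_rdistr) (auto simp: const_mult' C.m_assoc intro!: C.finsum_cong')

lemma ev_one: "ev (Suc N) \<one>\<^bsub>P\<^esub> = \<one>\<^bsub>C\<^esub>"
proof -
  have "ev (Suc N) \<one>\<^bsub>P\<^esub> = (\<Oplus>\<^bsub>C\<^esub>M\<in>mons (Suc N). if {#} = M then \<one>\<^bsub>C\<^esub> else \<zero>\<^bsub>C\<^esub>)"
    unfolding ev_def
    by (rule C.finsum_cong') (auto simp: P.P.one_C one_eq_mono[symmetric] const_zero one_closed_C)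
  also have "\<dots> = \<one>\<^bsub>C\<^esub>"
    using C.finsum_singleton[of "{#}" "mons (Suc N)" "\<lambda>_. \<one>\<^bsub>C\<^esub>"] finite_mons by (auto simp: mons_def)
  finally show ?thesis .
qed

lemma ev_Var_mult:
  assumes i: "i \<in> V" and f: "f \<in> carrier P"
  shows "ev (Suc N) (P.Var i \<otimes>\<^bsub>P\<^esub> f) = x i \<otimes>\<^bsub>C\<^esub> ev N f"
proof -
  have "ev (Suc N) (P.Var i \<otimes>\<^bsub>P\<^esub> f)
      = (\<Oplus>\<^bsub>C\<^esub>M\<in>add_mset i ` mons N. mono 0 (f (M - {#i#})) \<otimes>\<^bsub>C\<^esub> xpow M)"
    unfolding ev_def
  proof (rule C.add.finprod_mono_neutral_cong_right)
    show "finite (mons (Suc N))" by (rule finite_mons)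
    show "add_mset i ` mons N \<subseteq> mons (Suc N)" using i by (auto simp: mons_def)
    fix M assume "M \<in> mons (Suc N) - add_mset i ` mons N"
    then have "i \<notin># M"
      by (auto simp: mons_def image_iff)
         (metis diff_single_trivial in_diffD insert_DiffM size_add_mset subset_iff Suc_less_eq)
    then show "mono 0 ((P.Var i \<otimes>\<^bsub>P\<^esub> f) M) \<otimes>\<^bsub>C\<^esub> xpow M = \<zero>\<^bsub>C\<^esub>"
      using i f by (simp add: P.Var_mult const_zero)
  qed (use i f in \<open>auto simp: P.Var_mult P.P.mult_closed_C\<close>)
  also have "\<dots> = (\<Oplus>\<^bsub>C\<^esub>M\<in>mons N. mono 0 (f (add_mset i M - {#i#})) \<otimes>\<^bsub>C\<^esub> xpow (add_mset i M))"
    by (rule C.finsum_reindex) (use f in \<open>auto simp: inj_on_def\<close>)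
  also have "\<dots> = (\<Oplus>\<^bsub>C\<^esub>M\<in>mons N. x i \<otimes>\<^bsub>C\<^esub> (mono 0 (f M) \<otimes>\<^bsub>C\<^esub> xpow M))"
    by (rule C.finsum_cong') (use i f in \<open>auto simp: xpow_add_mset C.m_lcomm\<close>)
  also have "\<dots> = x i \<otimes>\<^bsub>C\<^esub> ev N f"
    unfolding ev_def using i f finite_mons by (subst C.finsum_rdistr) auto
  finally show ?thesis .
qed

lemma ev_step:
  assumes f: "f \<in> carrier P"
  shows "ev (Suc N) f \<ominus>\<^bsub>C\<^esub> ev N f \<in> F N"
proof -
  define R where "R = (\<Oplus>\<^bsub>C\<^esub>M\<in>mons (Suc N) - mons N. mono 0 (f M) \<otimes>\<^bsub>C\<^esub> xpow M)"
  have sub: "mons N \<subseteq> mons (Suc N)" by (auto simp: mons_def)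
  have "mons (Suc N) = mons N \<union> (mons (Suc N) - mons N)" using sub by blast
  then have "ev (Suc N) f = (\<Oplus>\<^bsub>C\<^esub>M\<in>mons N \<union> (mons (Suc N) - mons N). mono 0 (f M) \<otimes>\<^bsub>C\<^esub> xpow M)"
    unfolding ev_def by simp
  also have "\<dots> = ev N f \<oplus>\<^bsub>C\<^esub> R"
    unfolding ev_def R_def using finite_mons f
    by (intro C.finsum_Un_disjoint) auto
  finally have eq: "ev (Suc N) f = ev N f \<oplus>\<^bsub>C\<^esub> R" .
  have R: "R \<in> F N" unfolding R_def
  proof (rule F_finsum)
    fix M assume "M \<in> mons (Suc N) - mons N"
    then have "set_mset M \<subseteq> V" "size M = N" by (auto simp: mons_def)
    then show "mono 0 (f M) \<otimes>\<^bsub>C\<^esub> xpow M \<in> F N" using f xpow_F by (auto intro!: F_mult_left)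
  qed
  have "ev (Suc N) f \<ominus>\<^bsub>C\<^esub> ev N f = R"
    unfolding eq using f F_closed[OF R] ev_closed[OF f, of N] by algebra
  then show ?thesis using R by simp
qed

text \<open>The limit of the values \<open>ev N f\<close> of the truncations of \<open>f\<close>.\<close>
definition \<psi> :: "(nat multiset \<Rightarrow> 'a) \<Rightarrow> 'i \<Rightarrow> 'a"
  where "\<psi> f = (SOME y. y \<in> carrier C \<and> (\<forall>N. y \<ominus>\<^bsub>C\<^esub> ev N f \<in> F N))"

lemma \<psi>_spec:
  assumes "f \<in> carrier P" shows "\<psi> f \<in> carrier C" "\<psi> f \<ominus>\<^bsub>C\<^esub> ev N f \<in> F N"
proof -
  have "\<exists>y. y \<in> carrier C \<and> (\<forall>N. y \<ominus>\<^bsub>C\<^esub> ev N f \<in> F N)"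
    using F_complete[of "\<lambda>N. ev N f"] ev_step[OF assms] assms by auto
  from someI_ex[OF this] show "\<psi> f \<in> carrier C" "\<psi> f \<ominus>\<^bsub>C\<^esub> ev N f \<in> F N"
    unfolding \<psi>_def by blast+
qed

lemma \<psi>_unique:
  assumes f: "f \<in> carrier P" and y: "y \<in> carrier C" "\<And>N. y \<ominus>\<^bsub>C\<^esub> ev N f \<in> F N"
  shows "\<psi> f = y"
proof -
  have "\<psi> f \<ominus>\<^bsub>C\<^esub> y = \<zero>\<^bsub>C\<^esub>"
  proof (rule F_separated)
    fix N
    have "\<psi> f \<ominus>\<^bsub>C\<^esub> y = (\<psi> f \<ominus>\<^bsub>C\<^esub> ev N f) \<ominus>\<^bsub>C\<^esub> (y \<ominus>\<^bsub>C\<^esub> ev N f)"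
      using \<psi>_spec(1)[OF f] y(1) ev_closed[OF f, of N] by algebra
    then show "\<psi> f \<ominus>\<^bsub>C\<^esub> y \<in> F N" using F_minus[OF \<psi>_spec(2)[OF f] y(2)] by simp
  qed (use \<psi>_spec f y in auto)
  then show ?thesis using \<psi>_spec f y by (simp add: C.r_right_minus_eq)
qed

lemma \<psi>_add:
  assumes f: "f \<in> carrier P" and g: "g \<in> carrier P"
  shows "\<psi> (f \<oplus>\<^bsub>P\<^esub> g) = \<psi> f \<oplus>\<^bsub>C\<^esub> \<psi> g"
proof (rule \<psi>_unique)
  fix N
  have "(\<psi> f \<oplus>\<^bsub>C\<^esub> \<psi> g) \<ominus>\<^bsub>C\<^esub> (ev N f \<oplus>\<^bsub>C\<^esub> ev N g) = (\<psi> f \<ominus>\<^bsub>C\<^esub> ev N f) \<oplus>\<^bsub>C\<^esub> (\<psi> g \<ominus>\<^bsub>C\<^esub> ev N g)"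
    using \<psi>_spec(1)[OF f] \<psi>_spec(1)[OF g] ev_closed[OF f, of N] ev_closed[OF g, of N] by algebra
  then show "(\<psi> f \<oplus>\<^bsub>C\<^esub> \<psi> g) \<ominus>\<^bsub>C\<^esub> ev N (f \<oplus>\<^bsub>P\<^esub> g) \<in> F N"
    using F_add[OF \<psi>_spec(2)[OF f] \<psi>_spec(2)[OF g]] by (simp add: ev_add f g)
qed (use \<psi>_spec f g in auto)

lemma \<psi>_const_mult:
  assumes w: "w \<in> carrier W" and f: "f \<in> carrier P"
  shows "\<psi> (P.P.mono 0 w \<otimes>\<^bsub>P\<^esub> f) = mono 0 w \<otimes>\<^bsub>C\<^esub> \<psi> f"
proof (rule \<psi>_unique)
  fix N
  have "mono 0 w \<otimes>\<^bsub>C\<^esub> \<psi> f \<ominus>\<^bsub>C\<^esub> mono 0 w \<otimes>\<^bsub>C\<^esub> ev N f = mono 0 w \<otimes>\<^bsub>C\<^esub> (\<psi> f \<ominus>\<^bsub>C\<^esub> ev N f)"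
    using \<psi>_spec(1)[OF f] const_closed[OF w] ev_closed[OF f, of N] by algebra
  then show "mono 0 w \<otimes>\<^bsub>C\<^esub> \<psi> f \<ominus>\<^bsub>C\<^esub> ev N (P.P.mono 0 w \<otimes>\<^bsub>P\<^esub> f) \<in> F N"
    using F_mult_left[OF const_closed[OF w] \<psi>_spec(2)[OF f]] by (simp add: ev_const_mult w f)
qed (use \<psi>_spec f w P.P.Supp_zero in \<open>auto simp: P.P.mult_closed_C\<close>)

lemma \<psi>_one: "\<psi> \<one>\<^bsub>P\<^esub> = \<one>\<^bsub>C\<^esub>"
proof (rule \<psi>_unique)
  show "\<one>\<^bsub>C\<^esub> \<ominus>\<^bsub>C\<^esub> ev N \<one>\<^bsub>P\<^esub> \<in> F N" for N
    by (cases N) (auto simp: P.P.one_closed_C one_closed_C ev_one C.minus_eq C.r_neg)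
qed (auto simp: P.P.one_closed_C one_closed_C)

lemma \<psi>_const: assumes "w \<in> carrier W" shows "\<psi> (P.P.mono 0 w) = mono 0 w"
proof -
  have "P.P.mono 0 w \<otimes>\<^bsub>P\<^esub> \<one>\<^bsub>P\<^esub> = P.P.mono 0 w"
    using assms P.P.Supp_zero by (simp add: P.P.C.r_one)
  then show ?thesis using \<psi>_const_mult[OF assms P.P.one_closed_C] \<psi>_one assms by simp
qed

lemma \<psi>_Var_mult:
  assumes i: "i \<in> V" and f: "f \<in> carrier P"
  shows "\<psi> (P.Var i \<otimes>\<^bsub>P\<^esub> f) = x i \<otimes>\<^bsub>C\<^esub> \<psi> f"
proof (rule \<psi>_unique)
  fix N
  show "x i \<otimes>\<^bsub>C\<^esub> \<psi> f \<ominus>\<^bsub>C\<^esub> ev N (P.Var i \<otimes>\<^bsub>P\<^esub> f) \<in> F N"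
  proof (cases N)
    case 0
    then show ?thesis using i f \<psi>_spec by (simp add: P.P.mult_closed_C)
  next
    case (Suc N')
    have "x i \<otimes>\<^bsub>C\<^esub> \<psi> f \<ominus>\<^bsub>C\<^esub> x i \<otimes>\<^bsub>C\<^esub> ev N' f = x i \<otimes>\<^bsub>C\<^esub> (\<psi> f \<ominus>\<^bsub>C\<^esub> ev N' f)"
      using \<psi>_spec(1)[OF f] x_closed[OF i] ev_closed[OF f, of N'] by algebra
    then show ?thesis
      using F_mult[OF x_F[OF i] \<psi>_spec(2)[OF f, of N']] by (simp add: Suc ev_Var_mult i f)
  qed
qed (use \<psi>_spec i f in \<open>auto simp: P.P.mult_closed_C\<close>)

lemma \<psi>_Var: "i \<in> V \<Longrightarrow> \<psi> (P.Var i) = x i"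
  using \<psi>_Var_mult[OF _ P.P.one_closed_C, of i] \<psi>_one by simp

lemma \<psi>_mult:
  assumes f: "f \<in> carrier P" and g: "g \<in> carrier P"
  shows "\<psi> (f \<otimes>\<^bsub>P\<^esub> g) = \<psi> f \<otimes>\<^bsub>C\<^esub> \<psi> g"
proof -
  have "\<psi> (f \<otimes>\<^bsub>P\<^esub> g) \<ominus>\<^bsub>C\<^esub> \<psi> f \<otimes>\<^bsub>C\<^esub> \<psi> g \<in> F n" for n
  proof (rule P.vanishing[where D = "\<lambda>f. \<psi> (f \<otimes>\<^bsub>P\<^esub> g) \<ominus>\<^bsub>C\<^esub> \<psi> f \<otimes>\<^bsub>C\<^esub> \<psi> g" and G = F and x = x
      and B = C, OF _ _ _ F_mem_zero F_add _ _ f])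
    fix f h assume fh: "f \<in> carrier P" "h \<in> carrier P"
    have "\<psi> ((f \<oplus>\<^bsub>P\<^esub> h) \<otimes>\<^bsub>P\<^esub> g) = \<psi> (f \<otimes>\<^bsub>P\<^esub> g) \<oplus>\<^bsub>C\<^esub> \<psi> (h \<otimes>\<^bsub>P\<^esub> g)"
      using fh g by (simp add: P.P.C.l_distr \<psi>_add)
    moreover have "\<psi> (f \<otimes>\<^bsub>P\<^esub> g) \<in> carrier C" "\<psi> (h \<otimes>\<^bsub>P\<^esub> g) \<in> carrier C" "\<psi> f \<in> carrier C"
      "\<psi> h \<in> carrier C" "\<psi> g \<in> carrier C" using fh g \<psi>_spec(1) by auto
    ultimately show "\<psi> ((f \<oplus>\<^bsub>P\<^esub> h) \<otimes>\<^bsub>P\<^esub> g) \<ominus>\<^bsub>C\<^esub> \<psi> (f \<oplus>\<^bsub>P\<^esub> h) \<otimes>\<^bsub>C\<^esub> \<psi> g =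
        (\<psi> (f \<otimes>\<^bsub>P\<^esub> g) \<ominus>\<^bsub>C\<^esub> \<psi> f \<otimes>\<^bsub>C\<^esub> \<psi> g) \<oplus>\<^bsub>C\<^esub> (\<psi> (h \<otimes>\<^bsub>P\<^esub> g) \<ominus>\<^bsub>C\<^esub> \<psi> h \<otimes>\<^bsub>C\<^esub> \<psi> g)"
      using fh by (simp add: \<psi>_add) algebra
  next
    fix w assume "w \<in> carrier W"
    then show "\<psi> (P.P.mono 0 w \<otimes>\<^bsub>P\<^esub> g) \<ominus>\<^bsub>C\<^esub> \<psi> (P.P.mono 0 w) \<otimes>\<^bsub>C\<^esub> \<psi> g = \<zero>\<^bsub>C\<^esub>"
      using g \<psi>_spec(1) by (simp add: \<psi>_const_mult \<psi>_const C.minus_eq C.r_neg)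
  next
    fix i f assume i: "i \<in> V" and f: "f \<in> carrier P"
    have "\<psi> ((P.Var i \<otimes>\<^bsub>P\<^esub> f) \<otimes>\<^bsub>P\<^esub> g) = x i \<otimes>\<^bsub>C\<^esub> \<psi> (f \<otimes>\<^bsub>P\<^esub> g)"
      using i f g by (simp add: P.P.C.m_assoc \<psi>_Var_mult)
    moreover have "\<psi> (f \<otimes>\<^bsub>P\<^esub> g) \<in> carrier C" "\<psi> f \<in> carrier C" "\<psi> g \<in> carrier C" "x i \<in> carrier C"
      using f g i \<psi>_spec(1) by auto
    ultimately show "\<psi> ((P.Var i \<otimes>\<^bsub>P\<^esub> f) \<otimes>\<^bsub>P\<^esub> g) \<ominus>\<^bsub>C\<^esub> \<psi> (P.Var i \<otimes>\<^bsub>P\<^esub> f) \<otimes>\<^bsub>C\<^esub> \<psi> g =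
        x i \<otimes>\<^bsub>C\<^esub> (\<psi> (f \<otimes>\<^bsub>P\<^esub> g) \<ominus>\<^bsub>C\<^esub> \<psi> f \<otimes>\<^bsub>C\<^esub> \<psi> g)"
      using i f by (simp add: \<psi>_Var_mult C.minus_eq C.r_distr C.r_minus C.m_assoc)
  next
    fix n i a assume "i \<in> V" "a \<in> F n"
    then show "x i \<otimes>\<^bsub>C\<^esub> a \<in> F (Suc n)" using F_mult[OF x_F, of i a n] by simp
  next
    fix f assume "f \<in> carrier P"
    then show "\<psi> (f \<otimes>\<^bsub>P\<^esub> g) \<ominus>\<^bsub>C\<^esub> \<psi> f \<otimes>\<^bsub>C\<^esub> \<psi> g \<in> F 0" using g \<psi>_spec(1) by simp
  qed
  then have "\<psi> (f \<otimes>\<^bsub>P\<^esub> g) \<ominus>\<^bsub>C\<^esub> \<psi> f \<otimes>\<^bsub>C\<^esub> \<psi> g = \<zero>\<^bsub>C\<^esub>"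
    using f g \<psi>_spec(1) by (intro F_separated) auto
  then show ?thesis using f g \<psi>_spec(1) by (simp add: C.r_right_minus_eq)
qed

lemma \<psi>_alg_hom: "\<psi> \<in> ps_hom W V C (mono 0)"
  unfolding alg_hom_def
  by (auto intro!: ring_hom_memI simp: \<psi>_spec(1) \<psi>_mult \<psi>_add \<psi>_one P.const_eq \<psi>_const)

end

section \<open>Divided power series and their quotients\<close>

text \<open>The completion of \<open>A\<langle>T\<rangle>\<close>: no condition of finite support. Over \<open>W\<close> this ring is complete, so that power series
can be evaluated in it.\<close>
definition dp_series :: "('a, 'm) ring_scheme \<Rightarrow> (nat \<Rightarrow> 'a) ring"
  where "dp_series A = (divided_power_algebra A)\<lparr>carrier := {f. \<forall>n. f n \<in> carrier A}\<rparr>"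

definition binom :: "('a, 'm) ring_scheme \<Rightarrow> nat \<Rightarrow> nat \<Rightarrow> 'a"
  where "binom A i j = add_pow A (i + j choose i) \<one>\<^bsub>A\<^esub>"

lemma parts_nat: "parts (n::nat) = {..n}"
  by (auto simp: parts_def le_iff_add)

lemma (in semiring) add_pow_one_mult:
  "a \<in> carrier R \<Longrightarrow> add_pow R (n::nat) \<one> \<otimes> a = add_pow R n a"
  by (simp add: add_pow_ldistr)

lemma convolution_ring_dp:
  assumes "cring A"
  shows "convolution_ring A UNIV (binom A) (dp_series A)"
proof -
  interpret cring A by fact
  have mult: "add_pow A (a::nat) \<one>\<^bsub>A\<^esub> \<otimes>\<^bsub>A\<^esub> add_pow A (b::nat) \<one>\<^bsub>A\<^esub> = add_pow A (a * b) \<one>\<^bsub>A\<^esub>" for a b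
    by (simp add: add_pow_one_mult add.nat_pow_pow mult.commute)
  show ?thesis
  proof (rule convolution_ring.intro[OF is_cring convolution_ring_axioms.intro])
    fix f g n
    assume f: "f \<in> carrier (dp_series A)" and g: "g \<in> carrier (dp_series A)"
    then have c: "f i \<in> carrier A" "g i \<in> carrier A" for i by (auto simp: dp_series_def)
    have "(f \<otimes>\<^bsub>dp_series A\<^esub> g) n = (\<Oplus>\<^bsub>A\<^esub>i\<in>{..n}. add_pow A (n choose i) (f i \<otimes>\<^bsub>A\<^esub> g (n - i)))"
      by (simp add: dp_series_def divided_power_algebra_def)
    also have "\<dots> = (\<Oplus>\<^bsub>A\<^esub>i\<in>parts n. binom A i (n - i) \<otimes>\<^bsub>A\<^esub> (f i \<otimes>\<^bsub>A\<^esub> g (n - i)))"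
      unfolding parts_nat by (rule finsum_cong') (auto simp: c binom_def add_pow_one_mult)
    finally show "(f \<otimes>\<^bsub>dp_series A\<^esub> g) n =
        (\<Oplus>\<^bsub>A\<^esub>i\<in>parts n. binom A i (n - i) \<otimes>\<^bsub>A\<^esub> (f i \<otimes>\<^bsub>A\<^esub> g (n - i)))" .
  next
    fix K L :: nat
    show "binom A K L = binom A L K"
      unfolding binom_def by (metis add.commute add_diff_cancel_left' binomial_symmetric le_add1)
  next
    fix K L N :: nat
    have "(K + L choose K) * (K + L + N choose (K + L)) = (L + N choose L) * (K + (L + N) choose K)"
      using choose_mult[of K "K + L" "K + L + N"] by (simp add: mult.commute add.assoc)
    then show "binom A K L \<otimes>\<^bsub>A\<^esub> binom A (K + L) N = binom A L N \<otimes>\<^bsub>A\<^esub> binom A K (L + N)"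
      unfolding binom_def mult by simp
  qed (auto simp: parts_nat binom_def dp_series_def divided_power_algebra_def)
qed

lemma up_iff: "f \<in> up A \<longleftrightarrow> (\<forall>n. f n \<in> carrier A) \<and> (\<exists>N. \<forall>n>N. f n = \<zero>\<^bsub>A\<^esub>)"
  by (auto simp: up_def bound_def)

lemma dp_algebra_eq: "divided_power_algebra A = dp_series A \<lparr>carrier := up A\<rparr>"
  by (simp add: dp_series_def divided_power_algebra_def)

lemma cring_dp_algebra:
  assumes "cring A" shows "cring (divided_power_algebra A)"
proof -
  interpret S: convolution_ring A UNIV "binom A" "dp_series A"
    by (rule convolution_ring_dp[OF assms])
  have sub: "up A \<subseteq> carrier (dp_series A)"
    by (auto simp: up_iff intro!: S.carrierI)
  have "subring (up A) (dp_series A)"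
  proof (rule S.C.subringI)
    show "up A \<subseteq> carrier (dp_series A)" by (rule sub)
    show "\<one>\<^bsub>dp_series A\<^esub> \<in> up A" by (auto simp: S.one_C up_iff)
    show "\<ominus>\<^bsub>dp_series A\<^esub> h \<in> up A" if h: "h \<in> up A" for h
    proof -
      have "\<ominus>\<^bsub>dp_series A\<^esub> h = (\<lambda>n. \<ominus>\<^bsub>A\<^esub> h n)" using h sub S.coeff_uminus by blast
      moreover obtain N where "\<forall>n>N. h n = \<zero>\<^bsub>A\<^esub>" "\<forall>n. h n \<in> carrier A" using h by (auto simp: up_iff)
      ultimately show ?thesis by (auto simp: up_iff intro!: exI[of _ N])
    qed
    fix f g assume f: "f \<in> up A" and g: "g \<in> up A"
    obtain a where a: "\<And>n. n > a \<Longrightarrow> f n = \<zero>\<^bsub>A\<^esub>" using f by (auto simp: up_iff)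
    obtain b where b: "\<And>n. n > b \<Longrightarrow> g n = \<zero>\<^bsub>A\<^esub>" using g by (auto simp: up_iff)
    have fc: "f n \<in> carrier A" and gc: "g n \<in> carrier A" for n using f g by (auto simp: up_iff)
    show "f \<oplus>\<^bsub>dp_series A\<^esub> g \<in> up A"
      unfolding S.add_C up_iff by (auto simp: fc gc a b intro!: exI[of _ "a + b"])
    have "(f \<otimes>\<^bsub>dp_series A\<^esub> g) n = \<zero>\<^bsub>A\<^esub>" if n: "n > a + b" for n
    proof -
      have "binom A i (n - i) \<otimes>\<^bsub>A\<^esub> (f i \<otimes>\<^bsub>A\<^esub> g (n - i)) = \<zero>\<^bsub>A\<^esub>" for i
        using a[of i] b[of "n - i"] n fc gc S.tw_closed by (cases "i > a") auto
      then show ?thesis using f g sub by (subst S.mult_C) (auto intro!: S.A.add.finprod_one_eqI)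
    qed
    moreover have "(f \<otimes>\<^bsub>dp_series A\<^esub> g) n \<in> carrier A" for n
      by (rule S.coeff_closed[OF S.mult_closed_C[OF subsetD[OF sub f] subsetD[OF sub g]]])
    ultimately show "f \<otimes>\<^bsub>dp_series A\<^esub> g \<in> up A" unfolding up_iff by blast
  qed
  then show ?thesis
    using S.C.subcringI' S.C.subcring_iff[OF sub] by (simp add: dp_algebra_eq)
qed

text \<open>A point \<open>x\<close> of the formal polydisc with values in \<open>S\<close>, that is a formal curve, and the evaluation of power
series along it.\<close>
abbreviation "S_curve W u V x \<equiv> substitution W u UNIV (binom W) (dp_series W) (\<lambda>n. n) V x"
abbreviation "along_curve W u V x \<equiv> substitution.\<psi> W u (dp_series W) (\<lambda>n. n) V x"

locale dp_ring = complete_dvr W u for W :: "('a, 'm) ring_scheme" (structure) and u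
begin

sublocale S: filtered_convolution_ring W u UNIV "binom W" "dp_series W" "\<lambda>n. n"
  by (intro filtered_convolution_ring.intro filtered_convolution_ring_axioms.intro
      complete_dvr_axioms convolution_ring_dp W.is_cring) auto

abbreviation "S \<equiv> dp_series W"

lemma S_closed_iff: "f \<in> carrier S \<longleftrightarrow> (\<forall>n. f n \<in> carrier W)"
  by (auto intro: S.carrierI simp del: S.coeff_closed dest: S.coeff_closed)

lemma mult_0:
  assumes f: "f \<in> carrier S" and g: "g \<in> carrier S"
  shows "(f \<otimes>\<^bsub>S\<^esub> g) 0 = f 0 \<otimes> g 0"
proof -
  have c: "f 0 \<in> carrier W" "g 0 \<in> carrier W" by (rule S.coeff_closed[OF f] S.coeff_closed[OF g])+
  have "parts (0::nat) = {0}" by (auto simp: parts_nat)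
  then show ?thesis
    using c by (simp add: S.mult_C[OF f g] S.tw_zero del: S.coeff_closed)
qed

lemma mult_1:
  assumes f: "f \<in> carrier S" and g: "g \<in> carrier S"
  shows "(f \<otimes>\<^bsub>S\<^esub> g) 1 = f 0 \<otimes> g 1 \<oplus> f 1 \<otimes> g 0"
proof -
  have c: "f n \<in> carrier W" "g n \<in> carrier W" for n by (rule S.coeff_closed[OF f] S.coeff_closed[OF g])+
  have p: "parts (1::nat) = {0, 1}" by (auto simp: parts_nat)
  have b: "binom W 1 0 = \<one>" using S.tw_comm[of 1 0] S.tw_zero[of 1] by simp
  have "(f \<otimes>\<^bsub>S\<^esub> g) 1 = binom W 0 1 \<otimes> (f 0 \<otimes> g 1) \<oplus> binom W 1 0 \<otimes> (f 1 \<otimes> g 0)"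
    unfolding S.mult_C[OF f g] p using c S.tw_closed
    by (simp add: del: S.coeff_closed)
  then show ?thesis unfolding b S.tw_zero using c by (simp del: S.coeff_closed)
qed

end

text \<open>A quotient \<open>B\<close> of the ring \<open>S\<close> of divided power series over \<open>W\<close>, by conditions on the single coefficients.
That \<open>k\<close> vanishes from some point on makes the elements of the maximal ideal nilpotent, and \<open>k 0 > 0\<close> says
that \<open>B\<close> is not the zero ring.\<close>
locale test_algebra = dp_ring W u + B: cring B
  for W :: "('a, 'm) ring_scheme" (structure) and u and B :: "('b, 'l) ring_scheme" +
  fixes \<beta> :: "'a \<Rightarrow> 'b" and \<pi> :: "(nat \<Rightarrow> 'a) \<Rightarrow> 'b" and k :: "nat \<Rightarrow> nat"
  assumes \<pi>_hom: "\<pi> \<in> ring_hom (dp_series W) B"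
    and \<pi>_surj: "\<pi> ` carrier (dp_series W) = carrier B"
    and \<pi>_kernel: "f \<in> carrier (dp_series W) \<Longrightarrow> \<pi> f = \<zero>\<^bsub>B\<^esub> \<longleftrightarrow> (\<forall>n. f n \<in> U (k n))"
    and \<beta>_eq: "w \<in> carrier W \<Longrightarrow> \<beta> w = \<pi> (dp_const W w)"
    and k_antitone: "i \<le> j \<Longrightarrow> k j \<le> k i"
    and k_pos: "0 < k 0"
    and k_bounded: "\<exists>d. \<forall>n\<ge>d. k n = 0"
begin

sublocale \<pi>: ring_hom_cring S B \<pi>
  by (rule UnivPoly.ring_hom_cringI[OF S.cring_C B.is_cring \<pi>_hom])

lemma dp_const_eq: "dp_const W = S.mono 0"
  unfolding dp_const_def S.mono_def by (rule refl)

lemma \<pi>_eq_iff: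
  assumes "f \<in> carrier S" "g \<in> carrier S"
  shows "\<pi> f = \<pi> g \<longleftrightarrow> (\<forall>n. f n \<ominus> g n \<in> U (k n))"
proof -
  have "\<pi> f \<ominus>\<^bsub>B\<^esub> \<pi> g = \<pi> (f \<ominus>\<^bsub>S\<^esub> g)"
    using assms by (simp add: B.minus_eq S.C.minus_eq)
  then have "\<pi> f = \<pi> g \<longleftrightarrow> \<pi> (f \<ominus>\<^bsub>S\<^esub> g) = \<zero>\<^bsub>B\<^esub>"
    using assms B.r_right_minus_eq[of "\<pi> f" "\<pi> g"] by simp
  then show ?thesis
    using \<pi>_kernel[OF S.C.minus_closed[OF assms]] assms by (simp add: S.coeff_minus)
qed

lemma F_kernel: "\<exists>N. \<forall>f\<in>S.F N. \<pi> f = \<zero>\<^bsub>B\<^esub>"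
proof -
  obtain d where d: "\<And>n. n \<ge> d \<Longrightarrow> k n = 0" using k_bounded by blast
  have "\<pi> f = \<zero>\<^bsub>B\<^esub>" if f: "f \<in> S.F (2 * k 0 + d)" for f
  proof -
    have "f n \<in> U (k n)" for n
    proof (cases "n \<ge> d")
      case True
      then show ?thesis using d S.F_closed[OF f] by simp
    next
      case False
      show ?thesis
        by (rule U_antimono[OF _ S.F_coeff[OF f]]) (use False k_antitone[of 0 n] in simp)
    qed
    then show ?thesis using S.F_closed[OF f] by (simp add: \<pi>_kernel)
  qed
  then show ?thesis by blast
qed

lemma hom_unique:
  assumes V: "power_series W u V"
    and h: "h \<in> ps_hom W V B \<beta>"
    and h': "h' \<in> ps_hom W V B \<beta>"
    and x: "\<And>i. i \<in> V \<Longrightarrow> x i \<in> S.F 1"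
    and hV: "\<And>i. i \<in> V \<Longrightarrow> h (power_series.Var W i) = \<pi> (x i)"
    and hV': "\<And>i. i \<in> V \<Longrightarrow> h' (power_series.Var W i) = \<pi> (x i)"
    and f: "f \<in> carrier (ps_ring W V)"
  shows "h f = h' f"
proof -
  interpret P: power_series W u V by (rule V)
  show ?thesis
  proof (rule P.hom_unique[OF B.is_cring h h', where G = "\<lambda>n. \<pi> ` S.F n", OF _ _ _ _ _ _ f])
    show "\<zero>\<^bsub>B\<^esub> \<in> \<pi> ` S.F n" for n by (rule image_eqI[of _ _ "\<zero>\<^bsub>S\<^esub>"]) auto
    show "a \<oplus>\<^bsub>B\<^esub> b \<in> \<pi> ` S.F n" if "a \<in> \<pi> ` S.F n" "b \<in> \<pi> ` S.F n" for a b n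
      using that S.F_add S.F_closed by (auto simp: \<pi>.hom_add[symmetric] simp del: \<pi>.hom_add)
    show "h (P.Var i) \<otimes>\<^bsub>B\<^esub> a \<in> \<pi> ` S.F (Suc n)" if i: "i \<in> V" and a: "a \<in> \<pi> ` S.F n" for i a n
    proof -
      obtain y where y: "a = \<pi> y" "y \<in> S.F n" using a by blast
      have "h (P.Var i) \<otimes>\<^bsub>B\<^esub> a = \<pi> (x i \<otimes>\<^bsub>S\<^esub> y)"
        using y S.F_closed[OF x[OF i]] S.F_closed[OF y(2)] by (simp add: hV i)
      then show ?thesis using S.F_mult[OF x[OF i] y(2)] by simp
    qed
    show "carrier B \<subseteq> \<pi> ` S.F 0" using \<pi>_surj by simp
    show "b = \<zero>\<^bsub>B\<^esub>" if "b \<in> carrier B" "\<And>n. b \<in> \<pi> ` S.F n" for b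
      using F_kernel that(2) by (metis (no_types, lifting) imageE)
  qed (use hV hV' in auto)
qed

lemma comp_alg_hom:
  assumes "\<psi> \<in> alg_hom W P \<rho> S (S.mono 0)"
  shows "(\<lambda>f. \<pi> (\<psi> f)) \<in> alg_hom W P \<rho> B \<beta>"
  using assms ring_hom_trans[OF _ \<pi>_hom, of \<psi> P]
  by (auto simp: alg_hom_def comp_def \<beta>_eq dp_const_eq)

end

section \<open>The test algebras are quotients of the ring of divided power series\<close>

lemma UP_carrier: "carrier (UP A) = up A"
  and UP_one: "\<one>\<^bsub>UP A\<^esub> = (\<lambda>n. if n = 0 then \<one>\<^bsub>A\<^esub> else \<zero>\<^bsub>A\<^esub>)"
  and UP_zero: "\<zero>\<^bsub>UP A\<^esub> = (\<lambda>n. \<zero>\<^bsub>A\<^esub>)"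
  and UP_add: "\<lbrakk>f \<in> up A; g \<in> up A\<rbrakk> \<Longrightarrow> f \<oplus>\<^bsub>UP A\<^esub> g = (\<lambda>n. f n \<oplus>\<^bsub>A\<^esub> g n)"
  by (simp_all add: UP_def)

lemma UP_coeff: "f \<in> up A \<Longrightarrow> up_ring.coeff (UP A) f n = f n"
  by (simp add: UP_def)

lemma UP_mult:
  "\<lbrakk>f \<in> up A; g \<in> up A\<rbrakk> \<Longrightarrow>
    f \<otimes>\<^bsub>UP A\<^esub> g = (\<lambda>n. \<Oplus>\<^bsub>A\<^esub>i\<in>{..n}. f i \<otimes>\<^bsub>A\<^esub> g (n - i))"
  by (simp add: UP_def)

context dp_ring
begin

abbreviation "A m \<equiv> trunc W u m"
abbreviation "tr m \<equiv> trunc_of W u m"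

lemma cring_A: "cring (A m)"
  unfolding trunc_def U_def[symmetric] by (rule ideal.quotient_is_cring[OF U_ideal W.is_cring])

lemma tr_hom: "ring_hom_cring W (A m) (tr m)"
  unfolding trunc_def trunc_of_def U_def[symmetric]
  using ideal.rcos_ring_hom_cring[OF U_ideal W.is_cring] by (simp add: eta_contract_eq)

lemma tr_surj: "a \<in> carrier (A m) \<Longrightarrow> \<exists>w\<in>carrier W. a = tr m w"
  unfolding trunc_def trunc_of_def U_def[symmetric] FactRing_def A_RCOSETS_def' by auto

lemma tr_eq_iff: "w \<in> carrier W \<Longrightarrow> v \<in> carrier W \<Longrightarrow> tr m w = tr m v \<longleftrightarrow> w \<ominus> v \<in> U m"
  unfolding trunc_of_def U_def[symmetric] using W.quotient_eq_iff_same_a_r_cos[OF U_ideal] by simp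

lemma tr_zero_iff: "w \<in> carrier W \<Longrightarrow> tr m w = \<zero>\<^bsub>A m\<^esub> \<longleftrightarrow> w \<in> U m"
proof -
  assume w: "w \<in> carrier W"
  interpret t: ring_hom_cring W "A m" "tr m" by (rule tr_hom)
  have "tr m w = tr m \<zero> \<longleftrightarrow> w \<ominus> \<zero> \<in> U m" using tr_eq_iff[OF w W.zero_closed] .
  then show ?thesis using w by (simp add: W.minus_eq)
qed

definition cut :: "nat \<Rightarrow> nat \<Rightarrow> (nat \<Rightarrow> 'a) \<Rightarrow> nat \<Rightarrow> 'a set"
  where "cut m d f = (\<lambda>n. if n < d then tr m (f n) else \<zero>\<^bsub>A m\<^esub>)"

lemma cut_up: "f \<in> carrier S \<Longrightarrow> cut m d f \<in> up (A m)"
proof -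
  assume f: "f \<in> carrier S"
  interpret t: ring_hom_cring W "A m" "tr m" by (rule tr_hom)
  show ?thesis using S.coeff_closed[OF f] by (auto simp: up_iff cut_def intro!: exI[of _ d])
qed

lemma cut_sum:
  assumes f: "f \<in> carrier S" and g: "g \<in> carrier S" and n: "n < d"
  shows "(\<Oplus>\<^bsub>A m\<^esub>i\<in>{..n}. add_pow (A m) (n choose i) (cut m d f i \<otimes>\<^bsub>A m\<^esub> cut m d g (n - i)))
    = cut m d (f \<otimes>\<^bsub>S\<^esub> g) n"
proof -
  interpret t: ring_hom_cring W "A m" "tr m" by (rule tr_hom)
  have fc: "f i \<in> carrier W" and gc: "g i \<in> carrier W" for i
    by (rule S.coeff_closed[OF f]) (rule S.coeff_closed[OF g])
  have pow: "tr m (add_pow W (j::nat) w) = add_pow (A m) j (tr m w)" if "w \<in> carrier W" for j w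
    using that by (induction j) (auto simp: W.add.nat_pow_Suc t.S.add.nat_pow_Suc)
  have "cut m d (f \<otimes>\<^bsub>S\<^esub> g) n = tr m (\<Oplus>i\<in>{..n}. binom W i (n - i) \<otimes> (f i \<otimes> g (n - i)))"
    using n by (simp add: cut_def S.mult_C[OF f g] parts_nat)
  also have "\<dots> = (\<Oplus>\<^bsub>A m\<^esub>i\<in>{..n}. tr m (binom W i (n - i) \<otimes> (f i \<otimes> g (n - i))))"
    using fc gc S.tw_closed by (subst t.hom_finsum) (auto simp: comp_def)
  also have "\<dots> = (\<Oplus>\<^bsub>A m\<^esub>i\<in>{..n}. add_pow (A m) (n choose i) (cut m d f i \<otimes>\<^bsub>A m\<^esub> cut m d g (n - i)))"
  proof (rule t.S.finsum_cong')
    fix i assume i: "i \<in> {..n}"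
    have "binom W i (n - i) \<otimes> (f i \<otimes> g (n - i)) = add_pow W (n choose i) (f i \<otimes> g (n - i))"
      using i fc gc by (simp add: binom_def W.add_pow_one_mult)
    then show "tr m (binom W i (n - i) \<otimes> (f i \<otimes> g (n - i)))
        = add_pow (A m) (n choose i) (cut m d f i \<otimes>\<^bsub>A m\<^esub> cut m d g (n - i))"
      using i n less_imp_diff_less[OF n, of i] fc gc by (simp add: cut_def pow)
  qed (use fc gc n in \<open>auto simp: cut_def\<close>)
  finally show ?thesis by simp
qed

text \<open>The common part for \<open>W\<^sub>m\<^sub>,\<^sub>d\<close> and \<open>W\<^sub>m[\<epsilon>]\<close>: below degree \<open>2\<close> all binomial coefficients are \<open>1\<close>, so modulo
\<open>T\<^sup>2\<close> polynomials multiply like divided powers.\<close>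
lemma test_algebra_quotient:
  assumes Q: "cring Q" and carrier_Q: "carrier Q = up (A m)"
    and one_Q: "\<one>\<^bsub>Q\<^esub> = (\<lambda>n. if n = 0 then \<one>\<^bsub>A m\<^esub> else \<zero>\<^bsub>A m\<^esub>)"
    and zero_Q: "\<zero>\<^bsub>Q\<^esub> = (\<lambda>n. \<zero>\<^bsub>A m\<^esub>)"
    and add_Q: "\<And>f g. \<lbrakk>f \<in> up (A m); g \<in> up (A m)\<rbrakk> \<Longrightarrow> f \<oplus>\<^bsub>Q\<^esub> g = (\<lambda>n. f n \<oplus>\<^bsub>A m\<^esub> g n)"
    and mult_Q: "\<And>f g n. \<lbrakk>f \<in> up (A m); g \<in> up (A m); n < d\<rbrakk> \<Longrightarrow>
      (f \<otimes>\<^bsub>Q\<^esub> g) n = (\<Oplus>\<^bsub>A m\<^esub>i\<in>{..n}. add_pow (A m) (n choose i) (f i \<otimes>\<^bsub>A m\<^esub> g (n - i)))"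
    and I: "ideal I Q" and I_eq: "I = {f \<in> up (A m). \<forall>n<d. f n = \<zero>\<^bsub>A m\<^esub>}"
    and m: "0 < m" and d: "0 < d"
    and \<beta>: "\<And>w. w \<in> carrier W \<Longrightarrow> \<beta> w = I +>\<^bsub>Q\<^esub> (\<lambda>n. if n = 0 then tr m w else \<zero>\<^bsub>A m\<^esub>)"
  shows "test_algebra W u (Q Quot I) \<beta> (\<lambda>f. I +>\<^bsub>Q\<^esub> cut m d f) (\<lambda>n. if n < d then m else 0)"
proof -
  interpret t: ring_hom_cring W "A m" "tr m" by (rule tr_hom)
  interpret Q: cring Q by (rule Q)
  interpret q: ring_hom_cring Q "Q Quot I" "(+>\<^bsub>Q\<^esub>) I" by (rule ideal.rcos_ring_hom_cring[OF I Q])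
  have up_c: "f n \<in> carrier (A m)" if "f \<in> up (A m)" for f n using that by (auto simp: up_iff)
  have cu: "cut m d f \<in> carrier Q" if "f \<in> carrier S" for f using cut_up[OF that] carrier_Q by simp
  have neg: "(\<ominus>\<^bsub>Q\<^esub> f) n = \<ominus>\<^bsub>A m\<^esub> f n" if f: "f \<in> up (A m)" for f n
  proof -
    have f': "f \<in> carrier Q" "\<ominus>\<^bsub>Q\<^esub> f \<in> carrier Q" using f by (simp_all add: carrier_Q[symmetric])
    then have "(f \<oplus>\<^bsub>Q\<^esub> (\<ominus>\<^bsub>Q\<^esub> f)) n = \<zero>\<^bsub>A m\<^esub>" by (simp add: Q.r_neg zero_Q)
    then have "f n \<oplus>\<^bsub>A m\<^esub> (\<ominus>\<^bsub>Q\<^esub> f) n = \<zero>\<^bsub>A m\<^esub>" using f' by (simp add: add_Q carrier_Q)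
    then show ?thesis
      using f' up_c by (metis carrier_Q t.S.a_comm t.S.minus_equality)
  qed
  have coset_eq: "I +>\<^bsub>Q\<^esub> f = I +>\<^bsub>Q\<^esub> g \<longleftrightarrow> (\<forall>n<d. f n = g n)"
    if f: "f \<in> up (A m)" and g: "g \<in> up (A m)" for f g
  proof -
    have "I +>\<^bsub>Q\<^esub> f = I +>\<^bsub>Q\<^esub> g \<longleftrightarrow> f \<ominus>\<^bsub>Q\<^esub> g \<in> I"
      using Q.quotient_eq_iff_same_a_r_cos[OF I] f g by (simp add: carrier_Q)
    also have "\<dots> \<longleftrightarrow> (\<forall>n<d. (f \<ominus>\<^bsub>Q\<^esub> g) n = \<zero>\<^bsub>A m\<^esub>)"
      unfolding I_eq using f g Q.minus_closed[of f g] by (simp add: carrier_Q)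
    also have "\<dots> \<longleftrightarrow> (\<forall>n<d. f n = g n)"
    proof -
      have g': "\<ominus>\<^bsub>Q\<^esub> g \<in> up (A m)" using g Q.a_inv_closed[of g] by (simp add: carrier_Q)
      have "(f \<ominus>\<^bsub>Q\<^esub> g) n = f n \<ominus>\<^bsub>A m\<^esub> g n" for n
        unfolding Q.minus_eq add_Q[OF f g'] neg[OF g] t.S.minus_eq by (rule refl)
      then show ?thesis using up_c f g by simp
    qed
    finally show ?thesis .
  qed
  show ?thesis
  proof (intro test_algebra.intro test_algebra_axioms.intro dp_ring_axioms q.S.is_cring)
    show "(\<lambda>f. I +>\<^bsub>Q\<^esub> cut m d f) \<in> ring_hom S (Q Quot I)"
    proof (rule ring_hom_memI)
      fix f g assume f: "f \<in> carrier S" and g: "g \<in> carrier S"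
      have "I +>\<^bsub>Q\<^esub> cut m d (f \<otimes>\<^bsub>S\<^esub> g) = I +>\<^bsub>Q\<^esub> (cut m d f \<otimes>\<^bsub>Q\<^esub> cut m d g)"
        using f g cu[OF f] cu[OF g] Q.m_closed[OF cu[OF f] cu[OF g]]
        by (subst coset_eq) (auto simp: carrier_Q mult_Q cut_sum S.mult_closed_C cut_up)
      then show "I +>\<^bsub>Q\<^esub> cut m d (f \<otimes>\<^bsub>S\<^esub> g)
          = (I +>\<^bsub>Q\<^esub> cut m d f) \<otimes>\<^bsub>Q Quot I\<^esub> (I +>\<^bsub>Q\<^esub> cut m d g)"
        using f g cu by simp
      have "I +>\<^bsub>Q\<^esub> cut m d (f \<oplus>\<^bsub>S\<^esub> g) = I +>\<^bsub>Q\<^esub> (cut m d f \<oplus>\<^bsub>Q\<^esub> cut m d g)"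
        using f g cu[OF f] cu[OF g] Q.a_closed[OF cu[OF f] cu[OF g]]
          S.coeff_closed[OF f] S.coeff_closed[OF g]
        by (subst coset_eq) (auto simp: carrier_Q add_Q cut_up S.add_closed_C, auto simp: cut_def S.add_C)
      then show "I +>\<^bsub>Q\<^esub> cut m d (f \<oplus>\<^bsub>S\<^esub> g)
          = (I +>\<^bsub>Q\<^esub> cut m d f) \<oplus>\<^bsub>Q Quot I\<^esub> (I +>\<^bsub>Q\<^esub> cut m d g)"
        using f g cu by simp
    next
      fix f assume "f \<in> carrier S"
      then show "I +>\<^bsub>Q\<^esub> cut m d f \<in> carrier (Q Quot I)" using cu by simp
    next
      have "I +>\<^bsub>Q\<^esub> cut m d \<one>\<^bsub>S\<^esub> = I +>\<^bsub>Q\<^esub> \<one>\<^bsub>Q\<^esub>"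
        using cut_up[OF S.one_closed_C] Q.one_closed
        by (subst coset_eq) (auto simp: carrier_Q, auto simp: one_Q cut_def S.one_C)
      then show "I +>\<^bsub>Q\<^esub> cut m d \<one>\<^bsub>S\<^esub> = \<one>\<^bsub>Q Quot I\<^esub>" by simp
    qed
  next
    have "c \<in> (\<lambda>f. I +>\<^bsub>Q\<^esub> cut m d f) ` carrier S" if c: "c \<in> carrier (Q Quot I)" for c
    proof -
      obtain g where g: "g \<in> up (A m)" "c = I +>\<^bsub>Q\<^esub> g"
        using c carrier_Q unfolding FactRing_def A_RCOSETS_def' by auto
      have "\<forall>n. \<exists>w\<in>carrier W. g n = tr m w" using tr_surj up_c[OF g(1)] by blast
      then obtain f where f: "\<And>n. f n \<in> carrier W" "\<And>n. g n = tr m (f n)" by metis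
      have fS: "f \<in> carrier S" using f(1) S_closed_iff by blast
      have "c = I +>\<^bsub>Q\<^esub> cut m d f"
        unfolding g(2) using cut_up[OF fS] g(1) f(2) by (subst coset_eq) (auto simp: cut_def)
      then show ?thesis using fS by blast
    qed
    then show "(\<lambda>f. I +>\<^bsub>Q\<^esub> cut m d f) ` carrier S = carrier (Q Quot I)"
      using cu by auto
  next
    fix f assume f: "f \<in> carrier S"
    have "I +>\<^bsub>Q\<^esub> \<zero>\<^bsub>Q\<^esub> = \<zero>\<^bsub>Q Quot I\<^esub>" using q.hom_zero by simp
    then have "I +>\<^bsub>Q\<^esub> cut m d f = \<zero>\<^bsub>Q Quot I\<^esub> \<longleftrightarrow> I +>\<^bsub>Q\<^esub> cut m d f = I +>\<^bsub>Q\<^esub> \<zero>\<^bsub>Q\<^esub>" by simp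
    also have "\<dots> \<longleftrightarrow> (\<forall>n<d. cut m d f n = \<zero>\<^bsub>A m\<^esub>)"
      using cut_up[OF f] Q.zero_closed by (subst coset_eq) (auto simp: carrier_Q, auto simp: zero_Q)
    also have "\<dots> \<longleftrightarrow> (\<forall>n. f n \<in> U (if n < d then m else 0))"
      using S.coeff_closed[OF f] by (auto simp: cut_def tr_zero_iff)
    finally show "I +>\<^bsub>Q\<^esub> cut m d f = \<zero>\<^bsub>Q Quot I\<^esub> \<longleftrightarrow> (\<forall>n. f n \<in> U (if n < d then m else 0))" .
  next
    fix w assume w: "w \<in> carrier W"
    have "(\<lambda>n. if n = 0 then tr m w else \<zero>\<^bsub>A m\<^esub>) = cut m d (dp_const W w)"
      by (rule ext) (use d in \<open>simp add: cut_def dp_const_def\<close>)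
    then show "\<beta> w = I +>\<^bsub>Q\<^esub> cut m d (dp_const W w)" using \<beta>[OF w] by simp
  next
    show "\<exists>d'. \<forall>n\<ge>d'. (if n < d then m else 0) = 0" by (rule exI[of _ d]) simp
  qed (use m d in auto)
qed

lemma dp_ideal_eq:
  assumes "cring A'"
  shows "dp_ideal A' d = {f \<in> up A'. \<forall>n<d. f n = \<zero>\<^bsub>A'\<^esub>}" (is "_ = ?J")
    and "ideal (dp_ideal A' d) (divided_power_algebra A')"
proof -
  let ?D = "divided_power_algebra A'"
  interpret A': cring A' by fact
  interpret D: cring ?D by (rule cring_dp_algebra[OF assms])
  have carr: "carrier ?D = up A'" and zero: "\<zero>\<^bsub>?D\<^esub> = (\<lambda>n. \<zero>\<^bsub>A'\<^esub>)"
    and add: "\<And>f g. f \<oplus>\<^bsub>?D\<^esub> g = (\<lambda>n. f n \<oplus>\<^bsub>A'\<^esub> g n)"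
    and mult: "\<And>f g n. (f \<otimes>\<^bsub>?D\<^esub> g) n
      = (\<Oplus>\<^bsub>A'\<^esub>i\<in>{..n}. add_pow A' (n choose i) (f i \<otimes>\<^bsub>A'\<^esub> g (n - i)))"
    by (simp_all add: divided_power_algebra_def)
  have up_c: "f n \<in> carrier A'" if "f \<in> up A'" for f n using that by (auto simp: up_iff)
  let ?G = "{dp_gamma A' n | n. d \<le> n}"
  have gam: "dp_gamma A' n \<in> up A'" for n
    by (auto simp: dp_gamma_def up_iff intro!: exI[of _ n])
  have Gc: "?G \<subseteq> carrier ?D" using gam carr by auto
  have J: "ideal ?J ?D"
  proof (rule idealI[OF D.ring_axioms])
    show "subgroup ?J (add_monoid ?D)"
    proof (rule D.add.subgroupI)
      show "?J \<noteq> {}" using D.zero_closed by (auto simp: carr zero intro!: exI[of _ "\<lambda>n. \<zero>\<^bsub>A'\<^esub>"])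
      fix f assume f: "f \<in> ?J"
      then have f': "f \<in> carrier ?D" by (simp add: carr)
      then have n': "\<ominus>\<^bsub>?D\<^esub> f \<in> carrier ?D" by simp
      have "(f \<oplus>\<^bsub>?D\<^esub> (\<ominus>\<^bsub>?D\<^esub> f)) n = \<zero>\<^bsub>A'\<^esub>" for n using f' by (simp add: D.r_neg zero)
      then have "f n \<oplus>\<^bsub>A'\<^esub> (\<ominus>\<^bsub>?D\<^esub> f) n = \<zero>\<^bsub>A'\<^esub>" for n by (simp add: add)
      then have "(\<ominus>\<^bsub>?D\<^esub> f) n = \<zero>\<^bsub>A'\<^esub>" if "n < d" for n
        using f that up_c[of "\<ominus>\<^bsub>?D\<^esub> f" n] n' by (metis (mono_tags, lifting) A'.l_zero carr mem_Collect_eq)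
      then show "\<ominus>\<^bsub>?D\<^esub> f \<in> ?J" using n' by (simp add: carr)
      fix g assume g: "g \<in> ?J"
      then show "f \<oplus>\<^bsub>?D\<^esub> g \<in> ?J" using f D.a_closed[of f g] by (simp add: carr add)
    qed (auto simp: carr)
    fix f g assume f: "f \<in> ?J" and g: "g \<in> carrier ?D"
    have fc: "f i \<in> carrier A'" "g i \<in> carrier A'" for i using f g up_c by (auto simp: carr)
    have "(f \<otimes>\<^bsub>?D\<^esub> g) n = \<zero>\<^bsub>A'\<^esub>" if "n < d" for n
      unfolding mult using f that fc by (auto intro!: A'.add.finprod_one_eqI)
    then have fg: "f \<otimes>\<^bsub>?D\<^esub> g \<in> ?J" using f g D.m_closed[of f g] by (simp add: carr)
    then show "f \<otimes>\<^bsub>?D\<^esub> g \<in> ?J" .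
    have "g \<otimes>\<^bsub>?D\<^esub> f = f \<otimes>\<^bsub>?D\<^esub> g" using f g by (intro D.m_comm) (auto simp: carr)
    then show "g \<otimes>\<^bsub>?D\<^esub> f \<in> ?J" using fg by simp
  qed
  have id: "ideal (dp_ideal A' d) ?D" unfolding dp_ideal_def by (rule D.genideal_ideal[OF Gc])
  then show "ideal (dp_ideal A' d) (divided_power_algebra A')" .
  have "dp_ideal A' d \<subseteq> ?J"
    unfolding dp_ideal_def by (rule D.genideal_minimal[OF J]) (use gam in \<open>auto simp: dp_gamma_def\<close>)
  have "f \<in> dp_ideal A' d" if "f \<in> ?J" "\<forall>n\<ge>N. f n = \<zero>\<^bsub>A'\<^esub>" for f N
    using that
  proof (induction N arbitrary: f)
    case 0
    then have "f = \<zero>\<^bsub>?D\<^esub>" by (auto simp: zero)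
    then show ?case using additive_subgroup.zero_closed[OF ideal.axioms(1)[OF id]] by simp
  next
    case (Suc N)
    \<comment> \<open>Remove the top coefficient \<open>f(N)\<close> by subtracting \<open>f(N) \<gamma>\<^sup>N\<close>.\<close>
    define g where "g = f(N := \<zero>\<^bsub>A'\<^esub>)"
    have "g \<in> ?J" using Suc.prems by (auto simp: g_def up_iff)
    moreover have "g n = \<zero>\<^bsub>A'\<^esub>" if "n \<ge> N" for n using Suc.prems(2) that by (cases "n = N") (auto simp: g_def)
    ultimately have g: "g \<in> dp_ideal A' d" using Suc.IH by blast
    show ?case
    proof (cases "N < d")
      case True
      then have "g = f" using Suc.prems by (auto simp: g_def)
      then show ?thesis using g by simp
    next
      case False
      have fN: "f N \<in> carrier A'" using Suc.prems up_c by blast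
      have c: "dp_const A' (f N) \<in> carrier ?D"
        using fN by (auto simp: carr up_iff dp_const_def)
      have "dp_gamma A' N \<in> dp_ideal A' d"
        unfolding dp_ideal_def by (rule subsetD[OF D.genideal_self[OF Gc]]) (use False in auto)
      then have cg: "dp_const A' (f N) \<otimes>\<^bsub>?D\<^esub> dp_gamma A' N \<in> dp_ideal A' d"
        using ideal.I_l_closed[OF id] c by blast
      have "(dp_const A' (f N) \<otimes>\<^bsub>?D\<^esub> dp_gamma A' N) n = (if n = N then f N else \<zero>\<^bsub>A'\<^esub>)" for n
      proof -
        have "(dp_const A' (f N) \<otimes>\<^bsub>?D\<^esub> dp_gamma A' N) n =
            (\<Oplus>\<^bsub>A'\<^esub>i\<in>{..n}. if 0 = i then (if n = N then f N else \<zero>\<^bsub>A'\<^esub>) else \<zero>\<^bsub>A'\<^esub>)"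
          unfolding mult by (rule A'.finsum_cong') (auto simp: dp_const_def dp_gamma_def fN)
        then show ?thesis
          using A'.finsum_singleton[of 0 "{..n}" "\<lambda>_. if n = N then f N else \<zero>\<^bsub>A'\<^esub>"] fN by auto
      qed
      then have "f = g \<oplus>\<^bsub>?D\<^esub> (dp_const A' (f N) \<otimes>\<^bsub>?D\<^esub> dp_gamma A' N)"
        using Suc.prems(1) up_c fN by (auto simp: add g_def fun_eq_iff)
      then show ?thesis
        using additive_subgroup.a_closed[OF ideal.axioms(1)[OF id] g cg] by simp
    qed
  qed
  moreover have "\<exists>N. \<forall>n\<ge>N. f n = \<zero>\<^bsub>A'\<^esub>" if f: "f \<in> ?J" for f
  proof -
    obtain N where "\<forall>n>N. f n = \<zero>\<^bsub>A'\<^esub>" using f by (auto simp: up_iff)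
    then have "\<forall>n\<ge>Suc N. f n = \<zero>\<^bsub>A'\<^esub>" by auto
    then show ?thesis ..
  qed
  ultimately have "?J \<subseteq> dp_ideal A' d" by blast
  with \<open>dp_ideal A' d \<subseteq> ?J\<close> show "dp_ideal A' d = ?J" by (rule equalityI)
qed

lemma test_algebra_dp:
  assumes "0 < m" "0 < d"
  shows "test_algebra W u (W_dp W u m d) (W_dp_of W u m d)
    (\<lambda>f. dp_ideal (A m) d +>\<^bsub>divided_power_algebra (A m)\<^esub> cut m d f) (\<lambda>n. if n < d then m else 0)"
  unfolding W_dp_def
  by (rule test_algebra_quotient[OF cring_dp_algebra[OF cring_A] _ _ _ _ _
        dp_ideal_eq(2)[OF cring_A] dp_ideal_eq(1)[OF cring_A] assms])
     (simp_all add: divided_power_algebra_def W_dp_of_def dp_const_def)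

lemma sq_ideal_eq:
  assumes "cring A'"
  shows "sq_ideal A' = {f \<in> up A'. \<forall>n<2. f n = \<zero>\<^bsub>A'\<^esub>}" (is "_ = ?J")
    and "ideal (sq_ideal A') (UP A')"
proof -
  interpret A': cring A' by fact
  interpret UP_cring A' "UP A'" by unfold_locales simp
  have carr: "carrier (UP A') = up A'" by (rule UP_carrier)
  have mc: "up_ring.monom (UP A') \<one>\<^bsub>A'\<^esub> 2 \<in> carrier (UP A')" by simp
  show "ideal (sq_ideal A') (UP A')" unfolding sq_ideal_def by (rule P.cgenideal_ideal[OF mc])
  note co = UP_coeff
  have shift: "(g \<otimes>\<^bsub>UP A'\<^esub> up_ring.monom (UP A') \<one>\<^bsub>A'\<^esub> 2) n = (if n < 2 then \<zero>\<^bsub>A'\<^esub> else g (n - 2))"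
    if g: "g \<in> up A'" for g n
  proof -
    have gc: "g \<in> carrier (UP A')" using g carr by simp
    have gn: "g i \<in> carrier A'" for i using g by (auto simp: up_iff)
    have cl: "g \<otimes>\<^bsub>UP A'\<^esub> up_ring.monom (UP A') \<one>\<^bsub>A'\<^esub> 2 \<in> up A'"
      using P.m_closed[OF gc mc] carr by simp
    have "(g \<otimes>\<^bsub>UP A'\<^esub> up_ring.monom (UP A') \<one>\<^bsub>A'\<^esub> 2) n
        = (\<Oplus>\<^bsub>A'\<^esub>i\<in>{..n}. g i \<otimes>\<^bsub>A'\<^esub> (if 2 = n - i then \<one>\<^bsub>A'\<^esub> else \<zero>\<^bsub>A'\<^esub>))"
      using coeff_mult[OF gc mc, of n] co[OF cl, of n] co[OF g] by simp
    also have "\<dots> = (\<Oplus>\<^bsub>A'\<^esub>i\<in>{..n}. if n - 2 = i then (if n < 2 then \<zero>\<^bsub>A'\<^esub> else g i) else \<zero>\<^bsub>A'\<^esub>)"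
      by (rule A'.finsum_cong') (auto simp: gn)
    also have "\<dots> = (if n < 2 then \<zero>\<^bsub>A'\<^esub> else g (n - 2))"
      using A'.finsum_singleton[of "n - 2" "{..n}" "\<lambda>i. if n < 2 then \<zero>\<^bsub>A'\<^esub> else g i"] gn by auto
    finally show ?thesis .
  qed
  show "sq_ideal A' = ?J"
  proof
    show "sq_ideal A' \<subseteq> ?J"
    proof
      fix f assume "f \<in> sq_ideal A'"
      then obtain g where g: "g \<in> carrier (UP A')" "f = g \<otimes>\<^bsub>UP A'\<^esub> up_ring.monom (UP A') \<one>\<^bsub>A'\<^esub> 2"
        unfolding sq_ideal_def cgenideal_def by auto
      then show "f \<in> ?J" using shift[of g] P.m_closed[OF g(1) mc] carr by auto
    qed
    show "?J \<subseteq> sq_ideal A'"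
    proof
      fix f assume f: "f \<in> ?J"
      define g where "g = (\<lambda>n. f (n + 2))"
      obtain N where N: "\<forall>n>N. f n = \<zero>\<^bsub>A'\<^esub>" using f by (auto simp: up_iff)
      have g: "g \<in> up A'" using f N by (auto simp: up_iff g_def intro!: exI[of _ N])
      have "f = g \<otimes>\<^bsub>UP A'\<^esub> up_ring.monom (UP A') \<one>\<^bsub>A'\<^esub> 2"
      proof
        fix n
        have "g (n - 2) = f n" if "\<not> n < 2" using that unfolding g_def by (simp only: le_add_diff_inverse2 not_less)
        then show "f n = (g \<otimes>\<^bsub>UP A'\<^esub> up_ring.monom (UP A') \<one>\<^bsub>A'\<^esub> 2) n"
          unfolding shift[OF g] using f by simp
      qed
      then show "f \<in> sq_ideal A'" using g carr unfolding sq_ideal_def cgenideal_def by auto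
    qed
  qed
qed

abbreviation eps_map :: "nat \<Rightarrow> (nat \<Rightarrow> 'a) \<Rightarrow> (nat \<Rightarrow> 'a set) set"
  where "eps_map m f \<equiv> sq_ideal (A m) +>\<^bsub>UP (A m)\<^esub> cut m 2 f"

lemma test_algebra_eps:
  assumes "0 < m"
  shows "test_algebra W u (W_eps W u m) (W_eps_of W u m) (eps_map m) (\<lambda>n. if n < 2 then m else 0)"
proof -
  interpret A': cring "A m" by (rule cring_A)
  interpret UP_cring "A m" "UP (A m)" by unfold_locales simp
  interpret t: ring_hom_cring W "A m" "tr m" by (rule tr_hom)
  show ?thesis
    unfolding W_eps_def dual_numbers_def
  proof (rule test_algebra_quotient[OF UP_cring _ _ _ _ _ sq_ideal_eq(2)[OF cring_A]
      sq_ideal_eq(1)[OF cring_A] assms])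
    fix f g n assume f: "f \<in> up (A m)" and g: "g \<in> up (A m)" and n: "n < (2::nat)"
    have fc: "f i \<in> carrier (A m)" "g i \<in> carrier (A m)" for i using f g by (auto simp: up_iff)
    have "(n choose i) = 1" if "i \<le> n" for i using that n by (cases n) (auto simp: le_Suc_eq)
    then have "add_pow (A m) (n choose i) (f i \<otimes>\<^bsub>A m\<^esub> g (n - i)) = f i \<otimes>\<^bsub>A m\<^esub> g (n - i)"
      if "i \<in> {..n}" for i using that fc by simp
    moreover have "(\<lambda>i. f i \<otimes>\<^bsub>A m\<^esub> g (n - i)) \<in> {..n} \<rightarrow> carrier (A m)"
      by (intro funcsetI A'.m_closed fc)
    ultimately have "(\<Oplus>\<^bsub>A m\<^esub>i\<in>{..n}. add_pow (A m) (n choose i) (f i \<otimes>\<^bsub>A m\<^esub> g (n - i)))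
        = (\<Oplus>\<^bsub>A m\<^esub>i\<in>{..n}. f i \<otimes>\<^bsub>A m\<^esub> g (n - i))"
      by (intro A'.finsum_cong'[OF refl])
    then show "(f \<otimes>\<^bsub>UP (A m)\<^esub> g) n
        = (\<Oplus>\<^bsub>A m\<^esub>i\<in>{..n}. add_pow (A m) (n choose i) (f i \<otimes>\<^bsub>A m\<^esub> g (n - i)))"
      unfolding UP_mult[OF f g] by (rule sym)
  next
    fix w assume "w \<in> carrier W"
    then show "W_eps_of W u m w = sq_ideal (A m) +>\<^bsub>UP (A m)\<^esub> (\<lambda>n. if n = 0 then tr m w else \<zero>\<^bsub>A m\<^esub>)"
      by (simp add: W_eps_of_def dual_const_def UP_def)
  qed (simp_all add: UP_carrier UP_one UP_zero UP_add)
qed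

text \<open>The element \<open>u\<^sup>m\<epsilon>\<close> is the image of \<open>u\<^sup>m\<gamma>\<^sup>1\<close>, and a multiple \<open>g u\<^sup>m\<gamma>\<^sup>1\<close> has the coefficients \<open>0\<close> and
\<open>g(0) u\<^sup>m\<close> in degrees \<open>0\<close> and \<open>1\<close>. So dividing by \<open>u\<^sup>m\<epsilon>\<close> weakens the condition on the coefficient
of degree \<open>1\<close> from \<open>(u\<^sup>m\<^sup>+\<^sup>1)\<close> to \<open>(u\<^sup>m)\<close>, and changes nothing else.\<close>
lemma test_algebra_eps_quot:
  "test_algebra W u (W_eps_quot W u m) (W_eps_quot_of W u m)
    (\<lambda>f. W_eps_proj W u m (eps_map (Suc m) f)) (\<lambda>n. if n = 0 then Suc m else if n = 1 then m else 0)"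
proof -
  interpret E: test_algebra W u "W_eps W u (Suc m)" "W_eps_of W u (Suc m)" "eps_map (Suc m)"
    "\<lambda>n. if n < 2 then Suc m else 0" by (rule test_algebra_eps) simp
  let ?B = "W_eps W u (Suc m)" and ?I = "ueps_ideal W u m" and ?\<pi> = "eps_map (Suc m)"
  interpret A': cring "A (Suc m)" by (rule cring_A)
  interpret t: ring_hom_cring W "A (Suc m)" "tr (Suc m)" by (rule tr_hom)
  have z: "S.mono 1 (u [^] m) \<in> carrier S" by simp
  have eps: "dual_eps (A (Suc m)) = ?\<pi> (S.mono 1 \<one>)"
  proof -
    have "cut (Suc m) 2 (S.mono 1 \<one>) = up_ring.monom (UP (A (Suc m))) \<one>\<^bsub>A (Suc m)\<^esub> 1"
      by (rule ext) (simp add: cut_def S.mono_def UP_def)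
    then show ?thesis by (simp add: dual_eps_def)
  qed
  have gen: "W_eps_of W u (Suc m) (u [^] m) \<otimes>\<^bsub>?B\<^esub> dual_eps (A (Suc m)) = ?\<pi> (S.mono 1 (u [^] m))"
  proof -
    have "S.mono 0 (u [^] m) \<otimes>\<^bsub>S\<^esub> S.mono 1 \<one> = S.mono 1 (u [^] m)"
      by (subst S.const_mult) (simp_all, auto simp: S.mono_def)
    then have "?\<pi> (S.mono 1 (u [^] m)) = ?\<pi> (S.mono 0 (u [^] m)) \<otimes>\<^bsub>?B\<^esub> ?\<pi> (S.mono 1 \<one>)"
      using E.\<pi>.hom_mult[of "S.mono 0 (u [^] m)" "S.mono 1 \<one>"] by simp
    then show ?thesis using E.\<beta>_eq[of "u [^] m"] E.dp_const_eq eps by simp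
  qed
  have I_eq: "?I = {?\<pi> (g \<otimes>\<^bsub>S\<^esub> S.mono 1 (u [^] m)) | g. g \<in> carrier S}"
  proof -
    have "?I = {x \<otimes>\<^bsub>?B\<^esub> ?\<pi> (S.mono 1 (u [^] m)) | x. x \<in> ?\<pi> ` carrier S}"
      unfolding ueps_ideal_def gen cgenideal_def E.\<pi>_surj by (rule refl)
    also have "\<dots> = {?\<pi> g \<otimes>\<^bsub>?B\<^esub> ?\<pi> (S.mono 1 (u [^] m)) | g. g \<in> carrier S}" by blast
    also have "\<dots> = {?\<pi> (g \<otimes>\<^bsub>S\<^esub> S.mono 1 (u [^] m)) | g. g \<in> carrier S}"
      using E.\<pi>.hom_mult[OF _ z] by force
    finally show ?thesis .
  qed
  have I: "ideal ?I ?B"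
    unfolding ueps_ideal_def gen using z by (intro E.B.cgenideal_ideal) auto
  interpret q: ring_hom_cring ?B "?B Quot ?I" "(+>\<^bsub>?B\<^esub>) ?I"
    by (rule ideal.rcos_ring_hom_cring[OF I E.B.is_cring])
  have mem: "?\<pi> f \<in> ?I \<longleftrightarrow> f 0 \<in> U (Suc m) \<and> f 1 \<in> U m" if f: "f \<in> carrier S" for f
  proof -
    have g1: "g \<otimes>\<^bsub>S\<^esub> S.mono 1 (u [^] m) \<in> carrier S" if "g \<in> carrier S" for g
      using that z by (rule S.mult_closed_C)
    have c0: "(g \<otimes>\<^bsub>S\<^esub> S.mono 1 (u [^] m)) 0 = \<zero>" if g: "g \<in> carrier S" for g
      unfolding mult_0[OF g z] using S.coeff_closed[OF g, of 0] by (simp add: S.mono_def)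
    have c1: "(g \<otimes>\<^bsub>S\<^esub> S.mono 1 (u [^] m)) 1 = g 0 \<otimes> u [^] m" if g: "g \<in> carrier S" for g
      unfolding mult_1[OF g z] using S.coeff_closed[OF g] by (simp add: S.mono_def)
    have "?\<pi> f \<in> ?I \<longleftrightarrow> (\<exists>g\<in>carrier S. ?\<pi> f = ?\<pi> (g \<otimes>\<^bsub>S\<^esub> S.mono 1 (u [^] m)))"
      unfolding I_eq by blast
    also have "\<dots> \<longleftrightarrow> (\<exists>g\<in>carrier S. f 0 \<in> U (Suc m) \<and> f 1 \<ominus> g 0 \<otimes> u [^] m \<in> U (Suc m))"
    proof (rule bex_cong[OF refl])
      fix g assume g: "g \<in> carrier S"
      have "(\<forall>n. f n \<ominus> (g \<otimes>\<^bsub>S\<^esub> S.mono 1 (u [^] m)) n \<in> U (if n < 2 then Suc m else 0)) \<longleftrightarrow>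
        (f 0 \<ominus> (g \<otimes>\<^bsub>S\<^esub> S.mono 1 (u [^] m)) 0 \<in> U (Suc m) \<and>
         f 1 \<ominus> (g \<otimes>\<^bsub>S\<^esub> S.mono 1 (u [^] m)) 1 \<in> U (Suc m))" (is "(\<forall>n. ?P n) \<longleftrightarrow> ?Q")
      proof
        assume "\<forall>n. ?P n"
        from this[rule_format, of 0] this[rule_format, of 1] show ?Q by simp
      next
        assume q: ?Q
        show "\<forall>n. ?P n"
        proof
          fix n :: nat
          have "n = 0 \<or> n = 1 \<or> \<not> n < 2" by auto
          then show "?P n"
            using q S.coeff_closed[OF f] S.coeff_closed[OF g1[OF g]] by (elim disjE) auto
        qed
      qed
      then show "?\<pi> f = ?\<pi> (g \<otimes>\<^bsub>S\<^esub> S.mono 1 (u [^] m)) \<longleftrightarrow>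
          f 0 \<in> U (Suc m) \<and> f 1 \<ominus> g 0 \<otimes> u [^] m \<in> U (Suc m)"
        unfolding E.\<pi>_eq_iff[OF f g1[OF g]] c0[OF g] c1[OF g]
        using S.coeff_closed[OF f, of 0] by (simp add: W.minus_eq)
    qed
    also have "\<dots> \<longleftrightarrow> f 0 \<in> U (Suc m) \<and> f 1 \<in> U m"
    proof
      assume "\<exists>g\<in>carrier S. f 0 \<in> U (Suc m) \<and> f 1 \<ominus> g 0 \<otimes> u [^] m \<in> U (Suc m)"
      then obtain g where g: "g \<in> carrier S" "f 0 \<in> U (Suc m)" "f 1 \<ominus> g 0 \<otimes> u [^] m \<in> U (Suc m)" by blast
      have c: "f 1 \<in> carrier W" "g 0 \<in> carrier W" using S.coeff_closed f g(1) by blast+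
      have "f 1 = (f 1 \<ominus> g 0 \<otimes> u [^] m) \<oplus> g 0 \<otimes> u [^] m"
        using c W.nat_pow_closed[OF u_closed, of m] by algebra
      moreover have "g 0 \<otimes> u [^] m \<in> U m" using c upow_mem_U U_mult_left by blast
      ultimately show "f 0 \<in> U (Suc m) \<and> f 1 \<in> U m"
        using g U_add U_antimono[of m "Suc m"] by (metis le_Suc_eq order_refl)
    next
      assume *: "f 0 \<in> U (Suc m) \<and> f 1 \<in> U m"
      then obtain y where y: "y \<in> carrier W" "f 1 = u [^] m \<otimes> y" by (auto simp: U_iff)
      then have "f 1 \<ominus> S.mono 0 y 0 \<otimes> u [^] m = \<zero>"
        by (simp add: S.mono_def W.minus_eq W.m_comm W.r_neg)
      then have "f 1 \<ominus> S.mono 0 y 0 \<otimes> u [^] m \<in> U (Suc m)" by (metis U_mem_zero)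
      moreover have "S.mono 0 y \<in> carrier S" using y by simp
      ultimately show "\<exists>g\<in>carrier S. f 0 \<in> U (Suc m) \<and> f 1 \<ominus> g 0 \<otimes> u [^] m \<in> U (Suc m)"
        using * by blast
    qed
    finally show ?thesis .
  qed
  show ?thesis
    unfolding W_eps_quot_def
  proof (intro test_algebra.intro test_algebra_axioms.intro dp_ring_axioms q.S.is_cring)
    show "(\<lambda>f. W_eps_proj W u m (?\<pi> f)) \<in> ring_hom S (?B Quot ?I)"
      unfolding W_eps_proj_def using ring_hom_trans[OF E.\<pi>_hom q.homh] by (simp add: comp_def)
    have "(\<lambda>f. W_eps_proj W u m (?\<pi> f)) ` carrier S = (+>\<^bsub>?B\<^esub>) ?I ` carrier ?B"
      unfolding W_eps_proj_def E.\<pi>_surj[symmetric] image_image by (rule refl)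
    also have "\<dots> = carrier (?B Quot ?I)" unfolding FactRing_def A_RCOSETS_def' by auto
    finally show "(\<lambda>f. W_eps_proj W u m (?\<pi> f)) ` carrier S = carrier (?B Quot ?I)" .
  next
    fix f assume f: "f \<in> carrier S"
    have "W_eps_proj W u m (?\<pi> f) = \<zero>\<^bsub>?B Quot ?I\<^esub> \<longleftrightarrow> ?\<pi> f \<in> ?I"
      unfolding W_eps_proj_def
      by (metis (no_types, lifting) E.B.a_rcos_zero E.\<pi>.hom_closed FactRing_def I f ideal.rcos_const_imp_mem ring.simps(1))
    also have "\<dots> \<longleftrightarrow> (\<forall>n. f n \<in> U (if n = 0 then Suc m else if n = 1 then m else 0))"
      unfolding mem[OF f] using S.coeff_closed[OF f] by auto
    finally show "W_eps_proj W u m (?\<pi> f) = \<zero>\<^bsub>?B Quot ?I\<^esub> \<longleftrightarrow>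
      (\<forall>n. f n \<in> U (if n = 0 then Suc m else if n = 1 then m else 0))" .
  next
    fix w assume "w \<in> carrier W"
    then show "W_eps_quot_of W u m w = W_eps_proj W u m (?\<pi> (dp_const W w))"
      by (simp add: W_eps_quot_of_def E.\<beta>_eq)
  qed (auto intro!: exI[of _ 2])
qed

lemma dp_proj:
  assumes "0 < m" "0 < d" "f \<in> carrier S"
  shows "W_dp_proj W u m d (dp_ideal (A m) (Suc d) +>\<^bsub>divided_power_algebra (A m)\<^esub> cut m (Suc d) f)
    = dp_ideal (A m) d +>\<^bsub>divided_power_algebra (A m)\<^esub> cut m d f"
proof -
  let ?D = "divided_power_algebra (A m)"
  interpret D: cring ?D by (rule cring_dp_algebra[OF cring_A])
  have carr: "carrier ?D = up (A m)" by (simp add: divided_power_algebra_def)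
  have I: "ideal (dp_ideal (A m) n) ?D" for n by (rule dp_ideal_eq(2)[OF cring_A])
  have sub: "dp_ideal (A m) (Suc d) \<subseteq> dp_ideal (A m) d"
    unfolding dp_ideal_eq(1)[OF cring_A] by auto
  have c: "cut m n f \<in> carrier ?D" for n using cut_up[OF assms(3)] carr by simp
  interpret A': cring "A m" by (rule cring_A)
  have add: "\<And>f g. f \<oplus>\<^bsub>?D\<^esub> g = (\<lambda>n. f n \<oplus>\<^bsub>A m\<^esub> g n)" by (simp add: divided_power_algebra_def)
  have diff: "cut m (Suc d) f \<ominus>\<^bsub>?D\<^esub> cut m d f \<in> dp_ideal (A m) d"
  proof -
    define g where "g = cut m (Suc d) f \<ominus>\<^bsub>?D\<^esub> cut m d f"
    have g: "g \<in> carrier ?D" using c by (simp add: g_def)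
    have eq: "g \<oplus>\<^bsub>?D\<^esub> cut m d f = cut m (Suc d) f"
      unfolding g_def using c[of d] c[of "Suc d"] by algebra
    have "g n = \<zero>\<^bsub>A m\<^esub>" if n: "n < d" for n
    proof -
      have "g n \<oplus>\<^bsub>A m\<^esub> cut m d f n = cut m d f n"
        using fun_cong[OF eq, of n] n by (simp add: add cut_def)
      moreover have "g n \<in> carrier (A m)" "cut m d f n \<in> carrier (A m)"
        using g c[of d] by (auto simp: carr up_iff)
      moreover from this have "g n = (g n \<oplus>\<^bsub>A m\<^esub> cut m d f n) \<ominus>\<^bsub>A m\<^esub> cut m d f n" by algebra
      ultimately show ?thesis by (simp add: A'.minus_eq A'.r_neg)
    qed
    then show ?thesis using g unfolding dp_ideal_eq(1)[OF cring_A] g_def by (simp add: carr)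
  qed
  have "dp_ideal (A m) d +>\<^bsub>?D\<^esub> x = dp_ideal (A m) d +>\<^bsub>?D\<^esub> cut m d f"
    if x: "x \<in> dp_ideal (A m) (Suc d) +>\<^bsub>?D\<^esub> cut m (Suc d) f" for x
  proof -
    obtain i where i: "i \<in> dp_ideal (A m) (Suc d)" "x = i \<oplus>\<^bsub>?D\<^esub> cut m (Suc d) f"
      using x by (auto simp: a_r_coset_def')
    have ic: "i \<in> carrier ?D" using ideal.Icarr[OF I i(1)] .
    have "x \<ominus>\<^bsub>?D\<^esub> cut m d f = i \<oplus>\<^bsub>?D\<^esub> (cut m (Suc d) f \<ominus>\<^bsub>?D\<^esub> cut m d f)"
      unfolding i(2) using ic c[of d] c[of "Suc d"] by algebra
    then have "x \<ominus>\<^bsub>?D\<^esub> cut m d f \<in> dp_ideal (A m) d"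
      using additive_subgroup.a_closed[OF ideal.axioms(1)[OF I] subsetD[OF sub i(1)] diff] by simp
    then show ?thesis
      using D.quotient_eq_iff_same_a_r_cos[OF I, of x "cut m d f" d] c ic i(2) by simp
  qed
  moreover have "cut m (Suc d) f \<in> dp_ideal (A m) (Suc d) +>\<^bsub>?D\<^esub> cut m (Suc d) f"
    using abelian_subgroup.a_rcos_self[OF abelian_subgroupI3[OF ideal.axioms(1)[OF I] D.abelian_group_axioms] c] .
  ultimately have "(\<lambda>x. dp_ideal (A m) d +>\<^bsub>?D\<^esub> x) ` (dp_ideal (A m) (Suc d) +>\<^bsub>?D\<^esub> cut m (Suc d) f)
      = {dp_ideal (A m) d +>\<^bsub>?D\<^esub> cut m d f}" by blast
  then show ?thesis by (simp add: W_dp_proj_def induced_map_def)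
qed

end

section \<open>Smooth algebras have the lifting properties\<close>

lemma alg_hom_comp:
  assumes "f \<in> alg_hom W A \<alpha> B \<beta>" "g \<in> alg_hom W B \<beta> C \<gamma>"
  shows "(\<lambda>x. g (f x)) \<in> alg_hom W A \<alpha> C \<gamma>"
  using assms ring_hom_trans[of f A B g C] by (auto simp: alg_hom_def comp_def)

lemma alg_hom_closed: "f \<in> alg_hom W A \<alpha> B \<beta> \<Longrightarrow> a \<in> carrier A \<Longrightarrow> f a \<in> carrier B"
  by (auto simp: alg_hom_def ring_hom_def)

lemma alg_hom_cring:
  assumes "f \<in> alg_hom W A \<alpha> B \<beta>" "cring A" "cring B"
  shows "ring_hom_cring A B f"
  using assms by (intro UnivPoly.ring_hom_cringI) (auto simp: alg_hom_def)

lemma hom_Units: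
  assumes h: "h \<in> ring_hom A B" and A: "cring A" and B: "cring B" and x: "x \<in> Units A"
  shows "h x \<in> Units B"
proof -
  interpret A: cring A by fact
  interpret B: cring B by fact
  have y: "inv\<^bsub>A\<^esub> x \<in> carrier A" "x \<otimes>\<^bsub>A\<^esub> inv\<^bsub>A\<^esub> x = \<one>\<^bsub>A\<^esub>" "x \<in> carrier A" using x by auto
  have "h x \<otimes>\<^bsub>B\<^esub> h (inv\<^bsub>A\<^esub> x) = \<one>\<^bsub>B\<^esub>"
    using ring_hom_mult[OF h y(3,1)] y(2) ring_hom_one[OF h] by simp
  then show ?thesis
    using B.unit_factor[of "h x"] ring_hom_closed[OF h] y B.Units_one_closed by metis
qed

lemma alg_hom_inverse:
  assumes h: "h \<in> alg_hom W A \<alpha> B \<beta>" and bij: "bij_betw h (carrier A) (carrier B)"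
    and A: "cring A" and B: "cring B" and \<alpha>: "\<alpha> \<in> carrier W \<rightarrow> carrier A"
  shows "inv_into (carrier A) h \<in> alg_hom W B \<beta> A \<alpha>"
    and "a \<in> carrier A \<Longrightarrow> inv_into (carrier A) h (h a) = a"
    and "b \<in> carrier B \<Longrightarrow> h (inv_into (carrier A) h b) = b"
    and "bij_betw (inv_into (carrier A) h) (carrier B) (carrier A)"
proof -
  interpret A: cring A by fact
  interpret B: cring B by fact
  interpret h: ring_hom_cring A B h by (rule alg_hom_cring[OF h A B])
  let ?g = "inv_into (carrier A) h"
  show l: "?g (h a) = a" if "a \<in> carrier A" for a
    using bij that by (auto simp: bij_betw_def)
  show r: "h (?g b) = b" if "b \<in> carrier B" for b
    using bij that by (auto simp: bij_betw_def f_inv_into_f)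
  show bg: "bij_betw ?g (carrier B) (carrier A)" using bij by (rule bij_betw_inv_into)
  have c: "?g b \<in> carrier A" if "b \<in> carrier B" for b using bg that by (auto simp: bij_betw_def)
  have "?g \<in> ring_hom B A"
  proof (rule ring_hom_memI)
    fix x y assume xy: "x \<in> carrier B" "y \<in> carrier B"
    have "?g (h (?g x) \<otimes>\<^bsub>B\<^esub> h (?g y)) = ?g x \<otimes>\<^bsub>A\<^esub> ?g y"
      using xy c l[of "?g x \<otimes>\<^bsub>A\<^esub> ?g y"] by simp
    then show "?g (x \<otimes>\<^bsub>B\<^esub> y) = ?g x \<otimes>\<^bsub>A\<^esub> ?g y" using xy by (simp add: r)
    have "?g (h (?g x) \<oplus>\<^bsub>B\<^esub> h (?g y)) = ?g x \<oplus>\<^bsub>A\<^esub> ?g y"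
      using xy c l[of "?g x \<oplus>\<^bsub>A\<^esub> ?g y"] by simp
    then show "?g (x \<oplus>\<^bsub>B\<^esub> y) = ?g x \<oplus>\<^bsub>A\<^esub> ?g y" using xy by (simp add: r)
  qed (use c l[of "\<one>\<^bsub>A\<^esub>"] in auto)
  moreover have "?g (\<beta> w) = \<alpha> w" if "w \<in> carrier W" for w
    using l[OF funcset_mem[OF \<alpha> that]] h that by (simp add: alg_hom_def)
  ultimately show "?g \<in> alg_hom W B \<beta> A \<alpha>" by (simp add: alg_hom_def)
qed

text \<open>After scaling, \<open>f = 1 + h\<close> with \<open>h\<close> in the first step of the filtration, and \<open>q + h q = 1\<close> has a solution by
\<open>fixed_point\<close>.\<close>
lemma (in filtered_convolution_ring) unit_criterion:
  assumes f: "f \<in> carrier C" and f0: "f 0 \<in> Units W"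
  shows "f \<in> Units C"
proof -
  define v where "v = inv f 0"
  have v: "v \<in> carrier W" "v \<otimes> f 0 = \<one>" using f0 by (auto simp: v_def)
  have vc: "mono 0 v \<in> carrier C" using v Supp_zero by simp
  define h where "h = mono 0 v \<otimes>\<^bsub>C\<^esub> f \<ominus>\<^bsub>C\<^esub> \<one>\<^bsub>C\<^esub>"
  have hc: "h \<in> carrier C" using vc f by (simp add: h_def)
  have "h 0 = \<zero>"
  proof -
    have "h 0 = v \<otimes> f 0 \<ominus> \<one>"
      by (simp only: h_def coeff_minus[OF mult_closed_C[OF vc f] one_closed_C])
         (simp add: const_mult[OF v(1) f] one_C)
    then show ?thesis using v by (simp add: W.minus_eq W.r_neg)
  qed
  then have h: "h \<in> F 1" using hc by (simp only: F_one_iff U_mem_zero simp_thms)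
  have "\<exists>q\<in>carrier C. q \<oplus>\<^bsub>C\<^esub> h \<otimes>\<^bsub>C\<^esub> q = \<one>\<^bsub>C\<^esub>"
  proof (rule fixed_point[where \<Phi> = "\<lambda>q. h \<otimes>\<^bsub>C\<^esub> q"])
    show "h \<otimes>\<^bsub>C\<^esub> (f \<ominus>\<^bsub>C\<^esub> g) = h \<otimes>\<^bsub>C\<^esub> f \<ominus>\<^bsub>C\<^esub> h \<otimes>\<^bsub>C\<^esub> g" if "f \<in> carrier C" "g \<in> carrier C" for f g
      using that hc by algebra
    show "h \<otimes>\<^bsub>C\<^esub> f \<in> F (Suc n)" if "f \<in> F n" for n f
      using F_mult[OF h that] by simp
  qed (use hc in auto)
  then obtain q where q: "q \<in> carrier C" "q \<oplus>\<^bsub>C\<^esub> h \<otimes>\<^bsub>C\<^esub> q = \<one>\<^bsub>C\<^esub>" by blast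
  have "f \<otimes>\<^bsub>C\<^esub> (mono 0 v \<otimes>\<^bsub>C\<^esub> q) = q \<oplus>\<^bsub>C\<^esub> h \<otimes>\<^bsub>C\<^esub> q"
    unfolding h_def using f vc q(1) by algebra
  then have "f \<otimes>\<^bsub>C\<^esub> (mono 0 v \<otimes>\<^bsub>C\<^esub> q) = \<one>\<^bsub>C\<^esub>" using q by simp
  moreover have "mono 0 v \<otimes>\<^bsub>C\<^esub> q \<in> carrier C" using vc q by simp
  ultimately show ?thesis using f C.Units_one_closed C.unit_factor by metis
qed

context power_series
begin

lemma filtered_size: "filtered_convolution_ring W u {M. set_mset M \<subseteq> V} (\<lambda>_ _. \<one>) P size"
  by (rule filtered) (auto simp: nonempty_has_size)

sublocale P: filtered_convolution_ring W u "{M. set_mset M \<subseteq> V}" "\<lambda>_ _. \<one>" P size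
  by (rule filtered_size)

lemma Var_minus_unit:
  assumes i: "i \<in> V" and w: "w \<in> Units W"
  shows "Var i \<ominus>\<^bsub>P\<^esub> P.mono 0 w \<in> Units P"
proof (rule P.unit_criterion)
  have wc: "w \<in> carrier W" using w by auto
  then have c: "P.mono 0 w \<in> carrier P" using P.Supp_zero by simp
  show "Var i \<ominus>\<^bsub>P\<^esub> P.mono 0 w \<in> carrier P" using c i by simp
  have "(Var i \<ominus>\<^bsub>P\<^esub> P.mono 0 w) 0 = \<ominus> w"
    using P.coeff_minus[OF Var_closed[OF i] c, of 0] wc by (simp add: Var_def P.mono_def W.minus_eq)
  then show "(Var i \<ominus>\<^bsub>P\<^esub> P.mono 0 w) 0 \<in> Units W"
    using w wc unit_iff[of w] unit_iff[of "\<ominus> w"] U_uminus[of "\<ominus> w" 1] by auto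
qed

lemma const_coeff_hom: "(\<lambda>f. f {#}) \<in> ps_hom W V W (\<lambda>w. w)"
proof -
  have "parts ({#} :: nat multiset) = {{#}}" by (auto simp: parts_multiset)
  then have "(f \<otimes>\<^bsub>P\<^esub> g) {#} = f {#} \<otimes> g {#}" if "f \<in> carrier P" "g \<in> carrier P" for f g
    using that by (simp add: P.mult_C)
  then show ?thesis
    unfolding alg_hom_def
    by (auto intro!: ring_hom_memI simp: P.add_C P.one_C power_series_const_def)
qed

end

context test_algebra
begin

text \<open>If the constant term \<open>w\<close> of \<open>x\<close> were a unit, then \<open>T\<^sub>i - w\<close> would be a unit too; but its image is the class
of an element without constant term, hence nilpotent.\<close>
lemma augmentation:
  assumes V: "power_series W u V"
    and h: "h \<in> ps_hom W V B \<beta>"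
    and i: "i \<in> V" and x: "x \<in> carrier S" and hx: "h (power_series.Var W i) = \<pi> x"
  shows "x \<in> S.F 1"
proof -
  interpret P: power_series W u V by (rule V)
  interpret h: ring_hom_cring "ps_ring W V" B h by (rule alg_hom_cring[OF h P.P.cring_C B.is_cring])
  have x0: "x 0 \<in> carrier W" by (rule S.coeff_closed[OF x])
  have "x 0 \<in> U 1"
  proof (rule ccontr)
    assume "x 0 \<notin> U 1"
    then have unit: "x 0 \<in> Units W" using unit_iff[OF x0] by simp
    define y where "y = x \<ominus>\<^bsub>S\<^esub> S.mono 0 (x 0)"
    have c: "S.mono 0 (x 0) \<in> carrier S" using x0 by simp
    have yc: "y \<in> carrier S" using x c by (simp add: y_def)
    have "y 0 = \<zero>"
      unfolding y_def S.coeff_minus[OF x c] using x0 by (simp add: S.mono_def W.minus_eq W.r_neg)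
    then have y: "y \<in> S.F 1" using yc by (simp only: S.F_one_iff U_mem_zero simp_thms)
    have pw: "y [^]\<^bsub>S\<^esub> n \<in> S.F n" for n :: nat
    proof (induction n)
      case (Suc n)
      then show ?case using S.F_mult[OF Suc y] by simp
    qed simp
    obtain N where N: "\<And>f. f \<in> S.F N \<Longrightarrow> \<pi> f = \<zero>\<^bsub>B\<^esub>" using F_kernel by blast
    have Pc: "P.P.mono 0 (x 0) \<in> carrier (ps_ring W V)" using x0 P.P.Supp_zero by simp
    have "h (P.Var i \<ominus>\<^bsub>ps_ring W V\<^esub> P.P.mono 0 (x 0)) = h (P.Var i) \<ominus>\<^bsub>B\<^esub> h (P.P.mono 0 (x 0))"
      using i Pc by (simp add: P.P.C.minus_eq B.minus_eq)
    also have "h (P.P.mono 0 (x 0)) = \<pi> (S.mono 0 (x 0))"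
      using h x0 by (simp add: alg_hom_def P.const_eq[symmetric] \<beta>_eq dp_const_eq)
    also have "h (P.Var i) \<ominus>\<^bsub>B\<^esub> \<pi> (S.mono 0 (x 0)) = \<pi> y"
      unfolding hx y_def using x c by (simp add: S.C.minus_eq B.minus_eq)
    finally have "\<pi> y = h (P.Var i \<ominus>\<^bsub>ps_ring W V\<^esub> P.P.mono 0 (x 0))" by simp
    then have "\<pi> y \<in> Units B"
      using hom_Units[OF h.homh P.P.C.is_cring B.is_cring P.Var_minus_unit[OF i unit]] by simp
    then have "\<pi> y [^]\<^bsub>B\<^esub> N \<in> Units B" by (rule B.Units_pow_closed)
    moreover have "\<pi> y [^]\<^bsub>B\<^esub> N = \<zero>\<^bsub>B\<^esub>" using N[OF pw[of N]] yc by (simp add: \<pi>.hom_pow)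
    ultimately have "\<one>\<^bsub>B\<^esub> = \<zero>\<^bsub>B\<^esub>" by (metis B.Units_r_inv_ex B.l_null)
    then have "\<pi> \<one>\<^bsub>S\<^esub> = \<zero>\<^bsub>B\<^esub>" by simp
    then have "\<one>\<^bsub>S\<^esub> 0 \<in> U (k 0)" using \<pi>_kernel[OF S.one_closed_C] by blast
    then show False using one_notin_U[OF k_pos] by (simp add: S.one_C)
  qed
  then show ?thesis using x by (simp only: S.F_one_iff simp_thms)
qed

text \<open>The preimages \<open>x\<^sub>i\<close> in \<open>S\<close> of the images of the variables can be chosen at will. Lifting \<open>h\<close> is thereby reduced to
choosing elements of \<open>S\<close>.\<close>
lemma factor_through_S:
  assumes V: "power_series W u V"
    and h: "h \<in> ps_hom W V B \<beta>"
    and x: "\<And>i. i \<in> V \<Longrightarrow> x i \<in> carrier S" "\<And>i. i \<in> V \<Longrightarrow> \<pi> (x i) = h (power_series.Var W i)"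
  shows "S_curve W u V x"
    and "f \<in> carrier (ps_ring W V) \<Longrightarrow>
      \<pi> (along_curve W u V x f) = h f"
proof -
  interpret P: power_series W u V by (rule V)
  have xF: "x i \<in> S.F 1" if "i \<in> V" for i
    using augmentation[OF V h that x(1)[OF that]] x(2)[OF that] by simp
  show sub: "S_curve W u V x"
    by (intro substitution.intro substitution_axioms.intro S.filtered_convolution_ring_axioms
        P.finite_V xF)
  interpret \<psi>: substitution W u UNIV "binom W" S "\<lambda>n. n" V x by (rule sub)
  show "\<pi> (\<psi>.\<psi> f) = h f" if "f \<in> carrier (ps_ring W V)"
  proof (rule hom_unique[OF V comp_alg_hom[OF \<psi>.\<psi>_alg_hom] h xF _ _ that])
    show "h (P.Var i) = \<pi> (x i)" if "i \<in> V" for i using x(2)[OF that] by simp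
    show "\<pi> (\<psi>.\<psi> (P.Var i)) = \<pi> (x i)" if "i \<in> V" for i using \<psi>.\<psi>_Var[OF that] by simp
  qed
qed

end

text \<open>Both test algebras are quotients of \<open>S\<close>: the homomorphism \<open>R \<rightarrow> S\<close> behind \<open>f\<close> yields the lift.\<close>
lemma smooth_lifts:
  assumes B: "test_algebra W u B \<beta> \<pi> k" and B': "test_algebra W u B' \<beta>' \<pi>' k'"
    and pr: "\<And>s. s \<in> carrier (dp_series W) \<Longrightarrow> pr (\<pi>' s) = \<pi> s"
    and R: "cring R" and \<rho>: "\<rho> \<in> ring_hom W R" and smooth: "smooth_algebra W R \<rho>"
    and f: "f \<in> alg_hom W R \<rho> B \<beta>"
  shows "\<exists>g\<in>alg_hom W R \<rho> B' \<beta>'. \<forall>x\<in>carrier R. pr (g x) = f x"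
proof -
  interpret B: test_algebra W u B \<beta> \<pi> k by (rule B)
  interpret B': test_algebra W u B' \<beta>' \<pi>' k' by (rule B')
  obtain r h where h: "h \<in> alg_hom W R \<rho> (ps_ring W {..<r}) (power_series_const W)"
    and bij: "bij_betw h (carrier R) (carrier (ps_ring W {..<r}))"
    using smooth by (auto simp: smooth_algebra_def power_series_ring_eq)
  have V: "power_series W u {..<r}"
    by (intro power_series.intro power_series_axioms.intro B.complete_dvr_axioms) simp
  interpret P: power_series W u "{..<r}" by (rule V)
  let ?h' = "inv_into (carrier R) h"
  have \<rho>c: "\<rho> \<in> carrier W \<rightarrow> carrier R" using \<rho> by (auto simp: ring_hom_def)
  note inv = alg_hom_inverse[OF h bij R P.P.cring_C \<rho>c]
  have fh: "(\<lambda>p. f (?h' p)) \<in> ps_hom W {..<r} B \<beta>"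
    by (rule alg_hom_comp[OF inv(1) f])
  have "\<forall>i\<in>{..<r}. \<exists>s\<in>carrier B.S. \<pi> s = f (?h' (P.Var i))"
    using alg_hom_closed[OF fh P.Var_closed] B.\<pi>_surj by (metis (no_types, lifting) imageE)
  then obtain x where x: "\<And>i. i \<in> {..<r} \<Longrightarrow> x i \<in> carrier B.S"
    "\<And>i. i \<in> {..<r} \<Longrightarrow> \<pi> (x i) = f (?h' (P.Var i))" by metis
  interpret \<psi>: substitution W u UNIV "binom W" B.S "\<lambda>n. n" "{..<r}" x
    by (rule B.factor_through_S(1)[OF V fh x])
  have lift: "\<pi> (\<psi>.\<psi> p) = f (?h' p)" if "p \<in> carrier P.P" for p
    by (rule B.factor_through_S(2)[OF V fh x that])
  show ?thesis
  proof (rule bexI[of _ "\<lambda>a. \<pi>' (\<psi>.\<psi> (h a))"], rule ballI)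
    show "(\<lambda>a. \<pi>' (\<psi>.\<psi> (h a))) \<in> alg_hom W R \<rho> B' \<beta>'"
      by (rule alg_hom_comp[OF h B'.comp_alg_hom[OF \<psi>.\<psi>_alg_hom]])
    fix a assume a: "a \<in> carrier R"
    have ha: "h a \<in> carrier P.P" by (rule alg_hom_closed[OF h a])
    show "pr (\<pi>' (\<psi>.\<psi> (h a))) = f a"
      using pr[OF \<psi>.\<psi>_spec(1)[OF ha]] lift[OF ha] inv(2)[OF a] by simp
  qed
qed

section \<open>Homogeneous forms and their values\<close>

lemma finite_mset_size: "finite V \<Longrightarrow> finite {M. set_mset M \<subseteq> V \<and> size M = d}"
  using finite_multisets_of_size[of V d] by (simp add: multisets_of_size_def)

lemma base_digits_unique:
  fixes B r :: nat
  assumes "\<And>i. i < r \<Longrightarrow> c i < B" "\<And>i. i < r \<Longrightarrow> c' i < B"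
    and "(\<Sum>i<r. c i * B ^ i) = (\<Sum>i<r. c' i * B ^ i)" and "i < r"
  shows "c i = c' i"
  using assms
proof (induction r arbitrary: c c' i)
  case (Suc r)
  have split: "(\<Sum>i<Suc r. b i * B ^ i) = b 0 + B * (\<Sum>i<r. b (Suc i) * B ^ i)" for b :: "nat \<Rightarrow> nat"
    by (simp only: sum.lessThan_Suc_shift) (simp add: sum_distrib_left mult_ac)
  have eq: "c 0 + B * (\<Sum>i<r. c (Suc i) * B ^ i) = c' 0 + B * (\<Sum>i<r. c' (Suc i) * B ^ i)"
    using Suc.prems(3) unfolding split .
  have lt: "c 0 < B" "c' 0 < B" using Suc.prems(1,2) by auto
  have z: "c 0 = c' 0" using arg_cong[OF eq, of "\<lambda>n. n mod B"] lt by simp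
  then have "(\<Sum>i<r. c (Suc i) * B ^ i) = (\<Sum>i<r. c' (Suc i) * B ^ i)" using eq lt by auto
  then have "c (Suc j) = c' (Suc j)" if "j < r" for j
    using Suc.IH[of "\<lambda>i. c (Suc i)" "\<lambda>i. c' (Suc i)" j] Suc.prems(1,2) that by auto
  then show ?case using z Suc.prems(4) by (cases i) auto
qed simp

context complete_dvr
begin

lemma mpow_upow:
  assumes "finite V"
  shows "mpow W V (\<lambda>i. u [^] (k i :: nat)) M = u [^] (\<Sum>i\<in>V. k i * count M i)"
  unfolding mpow_def using assms
proof (induction V rule: finite_induct)
  case (insert i V)
  then show ?case by (simp add: nat_pow_pow nat_pow_mult)
qed simp

text \<open>A form of Kronecker substitution. Put \<open>a\<^sub>i = u\<^bsup>(n+1) B^i\<^esup>\<close> with \<open>B\<close> larger than all the exponents. Then the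
monomial of degree \<open>M\<close> takes the value \<open>u\<^bsup>(n+1) e(M)\<^esup>\<close>, where \<open>e(M)\<close> is the number with the digits
\<open>M(i)\<close> in base \<open>B\<close>, and \<open>M\<close> is determined by \<open>e(M)\<close>. If \<open>K\<close> has the least \<open>e(K)\<close> among the terms with \<open>w K \<noteq> 0\<close>
and \<open>n\<close> is the valuation of \<open>w K\<close>, all the other terms are divisible by a higher power of \<open>u\<close> than that
of degree \<open>K\<close>, so the sum cannot vanish.\<close>
lemma form_vanishing_on_points:
  assumes V: "finite V" and MM: "finite MM" "\<And>M. M \<in> MM \<Longrightarrow> set_mset M \<subseteq> V"
    and w: "\<And>M. M \<in> MM \<Longrightarrow> w M \<in> carrier W"
    and zero: "\<And>a. (\<And>i. a i \<in> carrier W) \<Longrightarrow> (\<Oplus>M\<in>MM. w M \<otimes> mpow W V a M) = \<zero>"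
    and M: "M \<in> MM"
  shows "w M = \<zero>"
proof (rule ccontr)
  assume nz: "w M \<noteq> \<zero>"
  obtain r where r: "V \<subseteq> {..<r}"
    using V finite_nat_iff_bounded by blast
  define B where "B = Suc (\<Sum>M\<in>MM. size M)"
  have B: "count M i < B" if "M \<in> MM" for M i
    using member_le_sum[OF that, of size] MM(1) count_le_size[of M i] by (simp add: B_def)
  define e where "e M = (\<Sum>i\<in>V. B ^ i * count M i)" for M
  have e_r: "e M = (\<Sum>i<r. count M i * B ^ i)" if "M \<in> MM" for M
    unfolding e_def
  proof (rule sum.mono_neutral_cong_left)
    show "\<forall>i\<in>{..<r} - V. count M i * B ^ i = 0"
      using MM(2)[OF that] by (auto simp: not_in_iff[symmetric])
  qed (use r in auto)
  have inj: "K = L" if "K \<in> MM" "L \<in> MM" "e K = e L" for K L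
  proof (rule multiset_eqI)
    fix i
    show "count K i = count L i"
    proof (cases "i < r")
      case True
      then show ?thesis
        using base_digits_unique[of r "count K" B "count L" i] B e_r that by metis
    next
      case False
      then have "i \<notin># K" "i \<notin># L" using MM(2) that r by auto
      then show ?thesis by (simp add: not_in_iff)
    qed
  qed
  define Z where "Z = {M \<in> MM. w M \<noteq> \<zero>}"
  have Z: "finite Z" "Z \<noteq> {}" using MM(1) M nz by (auto simp: Z_def)
  define K where "K = arg_min_on e Z"
  have K: "K \<in> Z" and min: "\<And>L. L \<in> Z \<Longrightarrow> e K \<le> e L"
    unfolding K_def using arg_min_if_finite[OF Z, of e] by (auto simp: not_less)
  have KM: "K \<in> MM" "w K \<noteq> \<zero>" using K by (auto simp: Z_def)
  obtain n where n: "w K \<in> U n" "w K \<notin> U (Suc n)" using minimal_power[OF w KM(2)] KM by blast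
  define a where "a i = u [^] (Suc n * B ^ i)" for i
  have a: "a i \<in> carrier W" for i by (simp add: a_def)
  have pow: "mpow W V a L = u [^] (Suc n * e L)" for L
    unfolding a_def using mpow_upow[OF V, of "\<lambda>i. Suc n * B ^ i" L]
    by (simp only: e_def sum_distrib_left mult.assoc)
  define R where "R = (\<Oplus>L\<in>MM - {K}. w L \<otimes> mpow W V a L)"
  have R: "R \<in> U (Suc n * e K + Suc n)"
    unfolding R_def
  proof (rule U_finsum)
    fix L assume L: "L \<in> MM - {K}"
    show "w L \<otimes> mpow W V a L \<in> U (Suc n * e K + Suc n)"
    proof (cases "w L = \<zero>")
      case True
      then show ?thesis by (simp add: pow)
    next
      case False
      then have "L \<in> Z" using L by (simp add: Z_def)
      moreover have "e K \<noteq> e L" using inj[OF KM(1), of L] L by auto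
      ultimately have "e K < e L" using min[of L] by simp
      then have "Suc n * e K + Suc n \<le> Suc n * e L"
        by (metis Suc_leI mult_Suc_right mult_le_mono2 add.commute)
      then have "mpow W V a L \<in> U (Suc n * e K + Suc n)"
        unfolding pow using U_antimono upow_mem_U by blast
      then show ?thesis using U_mult_left w L by simp
    qed
  qed
  have "(\<Oplus>L\<in>MM. w L \<otimes> mpow W V a L) = w K \<otimes> mpow W V a K \<oplus> R"
  proof -
    have "MM = insert K (MM - {K})" using KM by blast
    then have "(\<Oplus>L\<in>MM. w L \<otimes> mpow W V a L) = (\<Oplus>L\<in>insert K (MM - {K}). w L \<otimes> mpow W V a L)" by simp
    also have "\<dots> = w K \<otimes> mpow W V a K \<oplus> R"
      unfolding R_def by (rule finsum_insert) (use MM w KM pow in auto)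
    finally show ?thesis .
  qed
  then have z: "w K \<otimes> u [^] (Suc n * e K) \<oplus> R = \<zero>" using zero[of a] a by (simp add: pow)
  have "w K \<otimes> u [^] (Suc n * e K) = \<ominus> R"
    using z U_closed[OF R] w[OF KM(1)] by (metis W.minus_equality W.minus_minus W.m_closed W.nat_pow_closed u_closed a_comm)
  then have "u [^] (Suc n * e K) \<otimes> w K \<in> U (Suc n * e K + Suc n)"
    using U_uminus[OF R] w[OF KM(1)] by (simp add: m_comm)
  then have "w K \<in> U (Suc n)" using U_cancel w KM by blast
  then show False using n by simp
qed

end

context dp_ring
begin

lemma fact_pow_mult:
  assumes "a \<in> carrier W" "b \<in> carrier W"
  shows "add_pow W (Suc n) \<one> \<otimes> (a \<otimes> add_pow W (fact n :: nat) b) = add_pow W (fact (Suc n) :: nat) (a \<otimes> b)"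
proof -
  have "add_pow W (Suc n) \<one> \<otimes> (a \<otimes> add_pow W (fact n :: nat) b)
    = add_pow W (Suc n) (add_pow W (fact n :: nat) (a \<otimes> b))"
    using assms W.add_pow_one_mult[of "a \<otimes> add_pow W (fact n :: nat) b" "Suc n"]
    by (simp only: W.add_pow_rdistr W.m_closed W.add.nat_pow_closed)
  also have "\<dots> = add_pow W (fact n * Suc n :: nat) (a \<otimes> b)"
    using assms by (intro W.add.nat_pow_pow) simp
  also have "fact n * Suc n = (fact (Suc n) :: nat)" by simp
  finally show ?thesis .
qed

context
  fixes V x
  assumes sub: "S_curve W u V x"
    and x0: "\<And>i. i \<in> V \<Longrightarrow> x i 0 = \<zero>"
begin

interpretation \<psi>: substitution W u UNIV "binom W" "dp_series W" "\<lambda>n. n" V x by (rule sub)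

text \<open>In \<open>S\<close> the lowest term of a product of \<open>d\<close> elements without constant term is \<open>(\<gamma>\<^sup>1)\<^sup>d = d! \<gamma>\<^sup>d\<close> times the
product of their coefficients of degree \<open>1\<close>: each new factor contributes \<open>\<gamma>\<^sup>1\<gamma>\<^sup>s = (s + 1) \<gamma>\<^sup>s\<^sup>+\<^sup>1\<close>.\<close>
lemma xpow_coeff:
  assumes "set_mset M \<subseteq> V"
  shows "(n < size M \<longrightarrow> \<psi>.xpow M n = \<zero>) \<and>
    \<psi>.xpow M (size M) = add_pow W (fact (size M) :: nat) (mpow W V (\<lambda>i. x i 1) M)"
  using assms
proof (induction M arbitrary: n)
  case empty
  then show ?case by (simp add: W.mpow_empty S.one_C)
next
  case (add i M)
  have i: "i \<in> V" and M: "set_mset M \<subseteq> V" using add.prems by auto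
  have xc: "x j l \<in> carrier W" if "j \<in> V" for j l by (rule S.coeff_closed[OF \<psi>.x_closed[OF that]])
  have mc: "\<psi>.xpow M l \<in> carrier W" for l by (rule S.coeff_closed[OF \<psi>.xpow_closed])
  have low: "\<psi>.xpow M l = \<zero>" if "l < size M" for l using add.IH[OF M, of l] that by blast
  have top: "\<psi>.xpow M (size M) = add_pow W (fact (size M) :: nat) (mpow W V (\<lambda>i. x i 1) M)"
    using add.IH[OF M] by blast
  have coeff: "\<psi>.xpow (add_mset i M) l =
      (\<Oplus>j\<in>{..l}. binom W j (l - j) \<otimes> (x i j \<otimes> \<psi>.xpow M (l - j)))" for l
    unfolding \<psi>.xpow_add_mset[OF i] S.mult_C[OF \<psi>.x_closed[OF i] \<psi>.xpow_closed] parts_nat by (rule refl)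
  have "\<psi>.xpow (add_mset i M) n = \<zero>" if n: "n < size (add_mset i M)" for n
    unfolding coeff
  proof (rule W.add.finprod_one_eqI)
    fix j assume "j \<in> {..n}"
    show "binom W j (n - j) \<otimes> (x i j \<otimes> \<psi>.xpow M (n - j)) = \<zero>"
    proof (cases "j = 0")
      case True
      then show ?thesis using x0[OF i] mc S.tw_closed by simp
    next
      case False
      then have "n - j < size M \<or> n - j = n" using n \<open>j \<in> {..n}\<close> by auto
      then have "n - j < size M" using n \<open>j \<in> {..n}\<close> False by auto
      then show ?thesis using low xc[OF i] S.tw_closed by simp
    qed
  qed
  moreover have "\<psi>.xpow (add_mset i M) (size (add_mset i M)) =
      add_pow W (fact (size (add_mset i M)) :: nat) (mpow W V (\<lambda>i. x i 1) (add_mset i M))"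
  proof -
    let ?s = "size M"
    have "\<psi>.xpow (add_mset i M) (Suc ?s) =
      (\<Oplus>j\<in>{..Suc ?s}. if 1 = j then binom W 1 ?s \<otimes> (x i 1 \<otimes> \<psi>.xpow M ?s) else \<zero>)"
      unfolding coeff
    proof (rule W.finsum_cong'[OF refl])
      fix j assume j: "j \<in> {..Suc ?s}"
      consider "j = 0" | "j = 1" | "j > 1" by linarith
      then show "binom W j (Suc ?s - j) \<otimes> (x i j \<otimes> \<psi>.xpow M (Suc ?s - j)) =
        (if 1 = j then binom W 1 ?s \<otimes> (x i 1 \<otimes> \<psi>.xpow M ?s) else \<zero>)"
      proof cases
        case 1
        then show ?thesis using x0[OF i] mc S.tw_closed by simp
      next
        case 2
        then show ?thesis by simp
      next
        case 3
        then have "Suc ?s - j < ?s" using j by auto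
        then show ?thesis using low xc[OF i] S.tw_closed 3 by simp
      qed
    qed (use xc[OF i] mc S.tw_closed in auto)
    also have "\<dots> = binom W 1 ?s \<otimes> (x i 1 \<otimes> \<psi>.xpow M ?s)"
      using W.finsum_singleton[of 1 "{..Suc ?s}" "\<lambda>_. binom W 1 ?s \<otimes> (x i 1 \<otimes> \<psi>.xpow M ?s)"]
        xc[OF i] mc S.tw_closed by simp
    also have "binom W 1 ?s = add_pow W (Suc ?s) \<one>" by (simp add: binom_def)
    also have "add_pow W (Suc ?s) \<one> \<otimes> (x i 1 \<otimes> \<psi>.xpow M ?s)
      = add_pow W (fact (Suc ?s) :: nat) (x i 1 \<otimes> mpow W V (\<lambda>i. x i 1) M)"
      unfolding top by (rule fact_pow_mult) (use xc i W.mpow_closed in auto)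
    also have "x i 1 \<otimes> mpow W V (\<lambda>i. x i 1) M = mpow W V (\<lambda>i. x i 1) (add_mset i M)"
      using W.mpow_add_mset[of V i "\<lambda>i. x i 1" M] \<psi>.finite_V i xc by simp
    finally show ?thesis by simp
  qed
  ultimately show ?case by blast
qed

text \<open>The curve \<open>x\<close> sends a power series of order \<open>\<ge> d\<close> to \<open>d! f\<^sub>d(x(1)) \<gamma>\<^sup>d\<close> plus higher terms, where \<open>f\<^sub>d\<close> is
the homogeneous part of degree \<open>d\<close> and \<open>x(1)\<close> is the direction of the curve.\<close>
lemma leading_coeff:
  assumes f: "f \<in> carrier (ps_ring W V)" and ord: "\<And>M. size M < d \<Longrightarrow> f M = \<zero>"
  shows "n < d \<Longrightarrow> \<psi>.\<psi> f n = \<zero>"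
    and "\<psi>.\<psi> f d = (\<Oplus>M\<in>{M. set_mset M \<subseteq> V \<and> size M = d}.
      f M \<otimes> add_pow W (fact d :: nat) (mpow W V (\<lambda>i. x i 1) M))"
proof -
  define T where "T n = (\<Oplus>M\<in>{M. set_mset M \<subseteq> V \<and> size M = d}.
      if n = d then f M \<otimes> \<psi>.xpow M d else \<zero>)" for n
  have fc: "f M \<in> carrier W" for M by (rule \<psi>.P.P.coeff_closed[OF f])
  have mc: "\<psi>.xpow M l \<in> carrier W" for M l by (rule S.coeff_closed[OF \<psi>.xpow_closed])
  have fin: "finite {M. set_mset M \<subseteq> V \<and> size M = d}" by (rule finite_mset_size[OF \<psi>.finite_V])
  have Tc: "T n \<in> carrier W" for n unfolding T_def by (rule W.finsum_closed) (use fc mc in auto)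
  \<comment> \<open>Below degree \<open>d + 1\<close> all the truncations have the same value; the limit then has it as well.\<close>
  have ev: "\<psi>.ev N f n = T n" if N: "N > d" and n: "n \<le> d" for N n
  proof -
    have "\<psi>.ev N f n = (\<Oplus>M\<in>\<psi>.mons N. (S.mono 0 (f M) \<otimes>\<^bsub>S\<^esub> \<psi>.xpow M) n)"
      unfolding \<psi>.ev_def by (rule S.coeff_finsum) (use fc in auto)
    also have "\<dots> = T n"
      unfolding T_def
    proof (rule W.add.finprod_mono_neutral_cong_right)
      show "finite (\<psi>.mons N)" by (rule \<psi>.finite_mons)
      show "{M. set_mset M \<subseteq> V \<and> size M = d} \<subseteq> \<psi>.mons N" using N by (auto simp: \<psi>.mons_def)
      show "(S.mono 0 (f M) \<otimes>\<^bsub>S\<^esub> \<psi>.xpow M) n = \<zero>"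
        if "M \<in> \<psi>.mons N - {M. set_mset M \<subseteq> V \<and> size M = d}" for M
      proof -
        have M: "set_mset M \<subseteq> V" "size M \<noteq> d" using that by (auto simp: \<psi>.mons_def)
        have "f M = \<zero> \<or> \<psi>.xpow M n = \<zero>"
          using ord[of M] xpow_coeff[OF M(1), of n] n M(2) by linarith
        then show ?thesis using S.const_mult[OF fc \<psi>.xpow_closed, of M M] fc mc by auto
      qed
      show "(S.mono 0 (f M) \<otimes>\<^bsub>S\<^esub> \<psi>.xpow M) n = (if n = d then f M \<otimes> \<psi>.xpow M d else \<zero>)"
        if "M \<in> {M. set_mset M \<subseteq> V \<and> size M = d}" for M
        using that xpow_coeff[of M n] n fc[of M] S.const_mult[OF fc \<psi>.xpow_closed, of M M] by auto
      show "(\<lambda>M. (S.mono 0 (f M) \<otimes>\<^bsub>S\<^esub> \<psi>.xpow M) n) \<in> \<psi>.mons N \<rightarrow> carrier W"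
        using S.const_mult[OF fc \<psi>.xpow_closed] fc mc by auto
    qed
    finally show ?thesis .
  qed
  have eq: "\<psi>.\<psi> f n = T n" if n: "n \<le> d" for n
  proof -
    have pc: "\<psi>.\<psi> f n \<in> carrier W" by (rule S.coeff_closed[OF \<psi>.\<psi>_spec(1)[OF f]])
    have "\<psi>.\<psi> f n \<ominus> T n = \<zero>"
    proof (rule U_separated)
      fix k
      define N where "N = 2 * k + n + Suc d"
      have "(\<psi>.\<psi> f \<ominus>\<^bsub>S\<^esub> \<psi>.ev N f) n \<in> U ((N + 1 - n) div 2)"
        by (rule S.F_coeff[OF \<psi>.\<psi>_spec(2)[OF f]])
      then have "\<psi>.\<psi> f n \<ominus> T n \<in> U ((N + 1 - n) div 2)"
        using ev[of N n] n S.coeff_minus[OF \<psi>.\<psi>_spec(1)[OF f] \<psi>.ev_closed[OF f]] by (simp add: N_def)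
      then show "\<psi>.\<psi> f n \<ominus> T n \<in> U k" by (rule U_antimono[rotated]) (simp add: N_def)
    qed (use pc Tc in auto)
    then show ?thesis using pc Tc by simp
  qed
  show "\<psi>.\<psi> f n = \<zero>" if "n < d" using eq[of n] that by (simp add: T_def)
  have "T d = (\<Oplus>M\<in>{M. set_mset M \<subseteq> V \<and> size M = d}.
      f M \<otimes> add_pow W (fact d :: nat) (mpow W V (\<lambda>i. x i 1) M))"
    unfolding T_def
  proof (rule W.finsum_cong'[OF refl])
    have "x i 1 \<in> carrier W" if "i \<in> V" for i by (rule S.coeff_closed[OF \<psi>.x_closed[OF that]])
    then show "(\<lambda>M. f M \<otimes> add_pow W (fact d :: nat) (mpow W V (\<lambda>i. x i 1) M))
      \<in> {M. set_mset M \<subseteq> V \<and> size M = d} \<rightarrow> carrier W"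
      using fc W.mpow_closed[of V "\<lambda>i. x i 1"] by auto
  qed (use xpow_coeff in auto)
  then show "\<psi>.\<psi> f d = (\<Oplus>M\<in>{M. set_mset M \<subseteq> V \<and> size M = d}.
      f M \<otimes> add_pow W (fact d :: nat) (mpow W V (\<lambda>i. x i 1) M))" using eq[of d] by simp
qed

end

end

section \<open>Lifting curves, changing coordinates and dividing\<close>

lemma ps_carrier_iff: "f \<in> carrier (ps_ring W V) \<longleftrightarrow>
    (\<forall>M. f M \<in> carrier W \<and> (\<not> set_mset M \<subseteq> V \<longrightarrow> f M = \<zero>\<^bsub>W\<^esub>))"
  by (simp add: ps_ring_def)

lemma alg_hom_factor:
  assumes P: "cring P" and R: "cring R" and B: "cring B"
    and \<phi>: "\<phi> \<in> alg_hom W P \<gamma> R \<rho>" and surj: "\<phi> ` carrier P = carrier R"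
    and h: "h \<in> alg_hom W P \<gamma> B \<beta>" and \<gamma>: "\<gamma> \<in> carrier W \<rightarrow> carrier P"
    and ker: "\<And>p. \<lbrakk>p \<in> carrier P; \<phi> p = \<zero>\<^bsub>R\<^esub>\<rbrakk> \<Longrightarrow> h p = \<zero>\<^bsub>B\<^esub>"
  shows "\<exists>f\<in>alg_hom W R \<rho> B \<beta>. \<forall>p\<in>carrier P. f (\<phi> p) = h p"
proof -
  interpret P: cring P by fact
  interpret R: cring R by fact
  interpret B: cring B by fact
  interpret \<phi>: ring_hom_cring P R \<phi> by (rule alg_hom_cring[OF \<phi> P R])
  interpret h: ring_hom_cring P B h by (rule alg_hom_cring[OF h P B])
  define f where "f = (\<lambda>x. h (inv_into (carrier P) \<phi> x))"
  have f: "f (\<phi> p) = h p" if p: "p \<in> carrier P" for p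
  proof -
    define q where "q = inv_into (carrier P) \<phi> (\<phi> p)"
    have q: "q \<in> carrier P" "\<phi> q = \<phi> p"
      unfolding q_def using p by (auto intro: inv_into_into f_inv_into_f)
    have "\<phi> (q \<ominus>\<^bsub>P\<^esub> p) = \<zero>\<^bsub>R\<^esub>" using p q by (simp add: P.minus_eq R.r_neg)
    then have "h (q \<ominus>\<^bsub>P\<^esub> p) = \<zero>\<^bsub>B\<^esub>" using ker p q by simp
    then have "h q \<ominus>\<^bsub>B\<^esub> h p = \<zero>\<^bsub>B\<^esub>" using p q by (simp add: P.minus_eq B.minus_eq)
    then show ?thesis using p q by (simp add: f_def q_def[symmetric])
  qed
  have ex: "\<exists>p\<in>carrier P. \<phi> p = x" if "x \<in> carrier R" for x using surj that by (metis imageE)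
  have "f \<in> ring_hom R B"
  proof (rule ring_hom_memI)
    fix x assume "x \<in> carrier R"
    then obtain p where "p \<in> carrier P" "\<phi> p = x" using ex by blast
    then show "f x \<in> carrier B" using f by auto
    fix y assume "y \<in> carrier R"
    then obtain q where "q \<in> carrier P" "\<phi> q = y" using ex by blast
    then show "f (x \<otimes>\<^bsub>R\<^esub> y) = f x \<otimes>\<^bsub>B\<^esub> f y" "f (x \<oplus>\<^bsub>R\<^esub> y) = f x \<oplus>\<^bsub>B\<^esub> f y"
      using f[of p] f[of q] f[of "p \<otimes>\<^bsub>P\<^esub> q"] f[of "p \<oplus>\<^bsub>P\<^esub> q"] \<open>p \<in> carrier P\<close> \<open>\<phi> p = x\<close> by auto
  next
    show "f \<one>\<^bsub>R\<^esub> = \<one>\<^bsub>B\<^esub>" using f[of "\<one>\<^bsub>P\<^esub>"] by simp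
  qed
  moreover have "f (\<rho> w) = \<beta> w" if "w \<in> carrier W" for w
    using f[OF funcset_mem[OF \<gamma> that]] \<phi> h that by (simp add: alg_hom_def)
  ultimately show ?thesis using f by (auto simp: alg_hom_def)
qed

text \<open>This turns the lifting property of \<open>R\<close> into a statement about curves \<open>x\<^sub>i \<in> S\<close>: if \<open>T\<^sub>i \<mapsto> x\<^sub>i\<close> kills the kernel
of \<open>\<phi>\<close> modulo the conditions \<open>k\<close>, the curve can be changed, within the conditions \<open>k\<close> and only in those degrees in
which \<open>k\<close> and \<open>k'\<close> differ, so that it kills the kernel modulo the conditions \<open>k'\<close>.\<close>
lemma lift_along_test_algebras:
  assumes B: "test_algebra W u B \<beta> \<pi> k" and B': "test_algebra W u B' \<beta>' \<pi>' k'"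
    and pr: "\<And>s. s \<in> carrier (dp_series W) \<Longrightarrow> pr (\<pi>' s) = \<pi> s"
    and R: "cring R" and V: "power_series W u V"
    and lift: "\<And>f. f \<in> alg_hom W R \<rho> B \<beta> \<Longrightarrow> \<exists>g\<in>alg_hom W R \<rho> B' \<beta>'. \<forall>x\<in>carrier R. pr (g x) = f x"
    and \<phi>: "\<phi> \<in> ps_hom W V R \<rho>"
    and surj: "\<phi> ` carrier (ps_ring W V) = carrier R"
    and x: "S_curve W u V x"
    and kill: "\<And>f n. \<lbrakk>f \<in> carrier (ps_ring W V); \<phi> f = \<zero>\<^bsub>R\<^esub>\<rbrakk> \<Longrightarrow>
      along_curve W u V x f n \<in> complete_dvr.U W u (k n)"
  shows "\<exists>y. S_curve W u V y \<and>
    (\<forall>i\<in>V. \<forall>n. k n = k' n \<longrightarrow> y i n = x i n) \<and>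
    (\<forall>i\<in>V. \<forall>n. y i n \<ominus>\<^bsub>W\<^esub> x i n \<in> complete_dvr.U W u (k n)) \<and>
    (\<forall>f\<in>carrier (ps_ring W V). \<phi> f = \<zero>\<^bsub>R\<^esub> \<longrightarrow>
      (\<forall>n. along_curve W u V y f n \<in> complete_dvr.U W u (k' n)))"
proof -
  interpret B: test_algebra W u B \<beta> \<pi> k by (rule B)
  interpret B': test_algebra W u B' \<beta>' \<pi>' k' by (rule B')
  interpret P: power_series W u V by (rule V)
  interpret x: substitution W u UNIV "binom W" B.S "\<lambda>n. n" V x by (rule x)
  interpret R: cring R by (rule R)
  interpret \<phi>: ring_hom_cring P.P R \<phi> by (rule alg_hom_cring[OF \<phi> P.P.cring_C R])
  have const: "power_series_const W \<in> carrier W \<rightarrow> carrier P.P"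
    using P.P.Supp_zero by (auto simp: P.const_eq)
  have "\<exists>f\<in>alg_hom W R \<rho> B \<beta>. \<forall>p\<in>carrier P.P. f (\<phi> p) = \<pi> (x.\<psi> p)"
    by (rule alg_hom_factor[OF P.P.cring_C R B.B.is_cring \<phi> surj B.comp_alg_hom[OF x.\<psi>_alg_hom] const])
       (simp add: B.\<pi>_kernel x.\<psi>_spec(1) kill)
  then obtain f where f: "f \<in> alg_hom W R \<rho> B \<beta>" "\<And>p. p \<in> carrier P.P \<Longrightarrow> f (\<phi> p) = \<pi> (x.\<psi> p)"
    by blast
  obtain g where g: "g \<in> alg_hom W R \<rho> B' \<beta>'" "\<And>a. a \<in> carrier R \<Longrightarrow> pr (g a) = f a"
    using lift[OF f(1)] by blast
  have gc: "g a \<in> carrier B'" if "a \<in> carrier R" for a by (rule alg_hom_closed[OF g(1) that])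
  have "\<forall>i\<in>V. \<exists>z\<in>carrier B.S. \<pi>' z = g (\<phi> (P.Var i))"
    using gc[OF \<phi>.hom_closed[OF P.Var_closed]] B'.\<pi>_surj by (metis (no_types, lifting) imageE)
  then obtain z where z: "\<And>i. i \<in> V \<Longrightarrow> z i \<in> carrier B.S"
    "\<And>i. i \<in> V \<Longrightarrow> \<pi>' (z i) = g (\<phi> (P.Var i))" by metis
  have zx: "z i n \<ominus>\<^bsub>W\<^esub> x i n \<in> B.U (k n)" if i: "i \<in> V" for i n
  proof -
    have "\<pi> (z i) = pr (g (\<phi> (P.Var i)))" using pr[OF z(1)[OF i]] z(2)[OF i] by simp
    also have "\<dots> = \<pi> (x i)"
      using g(2)[OF \<phi>.hom_closed[OF P.Var_closed[OF i]]] f(2)[OF P.Var_closed[OF i]] x.\<psi>_Var[OF i] by simp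
    finally show ?thesis using B.\<pi>_eq_iff[OF z(1)[OF i] x.x_closed[OF i]] by blast
  qed
  \<comment> \<open>Where \<open>k\<close> and \<open>k'\<close> agree, replacing \<open>z\<close> by \<open>x\<close> does not change the class in \<open>B'\<close>.\<close>
  define y where "y i n = (if k n = k' n then x i n else z i n)" for i n
  have zc: "z i n \<in> carrier W" if "i \<in> V" for i n by (rule B.S.coeff_closed[OF z(1)[OF that]])
  have xc: "x i n \<in> carrier W" if "i \<in> V" for i n by (rule B.S.coeff_closed[OF x.x_closed[OF that]])
  have yc: "y i \<in> carrier B.S" if i: "i \<in> V" for i
    unfolding B.S_closed_iff y_def using zc[OF i] xc[OF i] by simp
  have "\<pi>' (y i) = g (\<phi> (P.Var i))" if i: "i \<in> V" for i
  proof -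
    have "z i n \<ominus>\<^bsub>W\<^esub> y i n \<in> B.U (k' n)" for n
    proof (cases "k n = k' n")
      case True
      then show ?thesis using zx[OF i, of n] by (simp add: y_def)
    next
      case False
      then show ?thesis using zc[OF i, of n] by (simp add: y_def B.W.minus_eq B.W.r_neg)
    qed
    then have "\<pi>' (z i) = \<pi>' (y i)" using B'.\<pi>_eq_iff[OF z(1)[OF i] yc[OF i]] by blast
    then show ?thesis using z(2)[OF i] by simp
  qed
  note lifted = B'.factor_through_S[OF V alg_hom_comp[OF \<phi> g(1)] yc this]
  interpret y: substitution W u UNIV "binom W" B.S "\<lambda>n. n" V y by (rule lifted(1))
  have "y.\<psi> p n \<in> B.U (k' n)" if p: "p \<in> carrier P.P" "\<phi> p = \<zero>\<^bsub>R\<^esub>" for p n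
  proof -
    have "\<pi>' (y.\<psi> p) = g \<zero>\<^bsub>R\<^esub>" using lifted(2)[OF _ _ p(1)] p(2) by simp
    also have "\<dots> = \<zero>\<^bsub>B'\<^esub>"
      using ring_hom_zero[of g R B'] g(1) R.ring_axioms B'.B.ring_axioms by (simp add: alg_hom_def)
    finally show ?thesis using B'.\<pi>_kernel[OF y.\<psi>_spec(1)[OF p(1)]] by blast
  qed
  moreover have "y i n \<ominus>\<^bsub>W\<^esub> x i n \<in> B.U (k n)" if "i \<in> V" for i n
    using zx[OF that, of n] xc[OF that, of n] by (simp add: y_def B.W.minus_eq B.W.r_neg)
  ultimately show ?thesis
    using y.substitution_axioms by (intro exI[of _ y]) (auto simp: y_def)
qed

context power_series
begin

lemma hom_id:
  assumes h: "h \<in> ps_hom W V P (power_series_const W)"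
    and hV: "\<And>i. i \<in> V \<Longrightarrow> h (Var i) = Var i" and f: "f \<in> carrier P"
  shows "h f = f"
proof (rule hom_unique[OF P.cring_C h _ _ _ _ _ _ _ f, where G = P.F])
  show "(\<lambda>f. f) \<in> ps_hom W V P (power_series_const W)"
    by (auto simp: alg_hom_def intro!: ring_hom_memI)
  show "h (Var i) \<otimes>\<^bsub>P\<^esub> a \<in> P.F (Suc n)" if i: "i \<in> V" and a: "a \<in> P.F n" for n i a
  proof -
    have "Var i 0 = \<zero>" by (simp add: Var_def P.mono_def)
    then have "Var i \<in> P.F 1" using Var_closed[OF i] by (simp only: P.F_one_iff U_mem_zero simp_thms)
    from P.F_mult[OF this a] show ?thesis by (simp add: hV[OF i])
  qed
  show "b = \<zero>\<^bsub>P\<^esub>" if "b \<in> carrier P" "\<And>n. b \<in> P.F n" for b using P.F_separated that by blast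
qed (use hV in \<open>auto intro: P.F_add\<close>)

lemma power_series_substitution:
  assumes "finite V'" "\<And>i. i \<in> V' \<Longrightarrow> x i \<in> carrier P" "\<And>i. i \<in> V' \<Longrightarrow> x i 0 \<in> U 1"
  shows "\<exists>h\<in>ps_hom W V' P (power_series_const W).
    \<forall>i\<in>V'. h (Var i) = x i"
proof -
  interpret h: substitution W u "{M. set_mset M \<subseteq> V}" "\<lambda>_ _. \<one>" P size V' x
    by (intro substitution.intro substitution_axioms.intro P.filtered_convolution_ring_axioms)
       (use assms in \<open>simp_all only: P.F_one_iff simp_thms\<close>)
  have "P.mono 0 = power_series_const W" by (auto simp: const_eq fun_eq_iff)
  then show ?thesis using h.\<psi>_alg_hom h.\<psi>_Var by auto
qed

text \<open>The map is surjective because the opposite translation is a right inverse, by \<open>hom_id\<close>.\<close>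
lemma translate:
  assumes c: "\<And>i. i \<in> V \<Longrightarrow> c i \<in> U 1"
  shows "\<exists>h\<in>ps_hom W V P (power_series_const W).
    (\<forall>i\<in>V. h (Var i) = Var i \<ominus>\<^bsub>P\<^esub> power_series_const W (c i)) \<and> h ` carrier P = carrier P"
proof -
  have cc: "power_series_const W (c i) \<in> carrier P" if "i \<in> V" for i
    using U_closed[OF c[OF that]] P.Supp_zero by (simp add: const_eq)
  have V0: "Var i {#} = \<zero>" for i by (simp add: Var_def P.mono_def)
  have "\<exists>h\<in>ps_hom W V P (power_series_const W).
    \<forall>i\<in>V. h (Var i) = Var i \<ominus>\<^bsub>P\<^esub> power_series_const W (c i)"
    by (rule power_series_substitution[OF finite_V])
       (use cc c U_closed[OF c] in \<open>auto simp: P.coeff_minus V0 power_series_const_def W.minus_eq intro: U_uminus\<close>)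
  then obtain h where h: "h \<in> ps_hom W V P (power_series_const W)"
    "\<And>i. i \<in> V \<Longrightarrow> h (Var i) = Var i \<ominus>\<^bsub>P\<^esub> power_series_const W (c i)" by blast
  have "\<exists>h\<in>ps_hom W V P (power_series_const W).
    \<forall>i\<in>V. h (Var i) = Var i \<oplus>\<^bsub>P\<^esub> power_series_const W (c i)"
  proof (rule power_series_substitution[OF finite_V])
    show "Var i \<oplus>\<^bsub>P\<^esub> power_series_const W (c i) \<in> carrier P" if "i \<in> V" for i
      using cc[OF that] that by simp
    show "(Var i \<oplus>\<^bsub>P\<^esub> power_series_const W (c i)) 0 \<in> U 1" if "i \<in> V" for i
      using c[OF that] U_closed[OF c[OF that]] by (simp add: P.add_C V0 power_series_const_def)
  qed
  then obtain h' where h': "h' \<in> ps_hom W V P (power_series_const W)"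
    "\<And>i. i \<in> V \<Longrightarrow> h' (Var i) = Var i \<oplus>\<^bsub>P\<^esub> power_series_const W (c i)" by blast
  interpret h: ring_hom_cring P P h by (rule alg_hom_cring[OF h(1) P.cring_C P.cring_C])
  have "h (h' f) = f" if f: "f \<in> carrier P" for f
  proof (rule hom_id[OF alg_hom_comp[OF h'(1) h(1)] _ f])
    fix i assume i: "i \<in> V"
    have "h (power_series_const W (c i)) = power_series_const W (c i)"
      using h(1) U_closed[OF c[OF i]] by (simp add: alg_hom_def)
    then have "h (h' (Var i)) = (Var i \<ominus>\<^bsub>P\<^esub> power_series_const W (c i)) \<oplus>\<^bsub>P\<^esub> power_series_const W (c i)"
      using h'(2)[OF i] h(2)[OF i] i cc by simp
    then show "h (h' (Var i)) = Var i" using Var_closed[OF i] cc[OF i] by (simp add: P.C.minus_eq P.C.a_assoc P.C.l_neg)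
  qed
  then have "h ` carrier P = carrier P"
    using alg_hom_closed[OF h'(1)] alg_hom_closed[OF h(1)] by (auto simp: image_iff) metis
  then show ?thesis using h by blast
qed

lemma rename:
  assumes \<kappa>: "bij_betw \<kappa> V' V" and V': "finite V'"
  shows "\<exists>h\<in>ps_hom W V' P (power_series_const W).
    bij_betw h (carrier (ps_ring W V')) (carrier P)"
proof -
  interpret P': power_series W u V'
    by (intro power_series.intro power_series_axioms.intro complete_dvr_axioms V')
  have V0: "Var i 0 \<in> U 1" for i by (simp add: Var_def P.mono_def)
  have \<kappa>V: "\<kappa> i \<in> V" if "i \<in> V'" for i using \<kappa> that by (auto simp: bij_betw_def)
  define \<kappa>' where "\<kappa>' = inv_into V' \<kappa>"
  have \<kappa>': "\<kappa>' i \<in> V'" "\<kappa> (\<kappa>' i) = i" if "i \<in> V" for i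
    using \<kappa> that by (auto simp: \<kappa>'_def bij_betw_def inv_into_into f_inv_into_f)
  have \<kappa>'\<kappa>: "\<kappa>' (\<kappa> i) = i" if "i \<in> V'" for i
    using \<kappa> that by (auto simp: \<kappa>'_def bij_betw_def)
  obtain h where h: "h \<in> ps_hom W V' P (power_series_const W)"
    "\<And>i. i \<in> V' \<Longrightarrow> h (Var i) = Var (\<kappa> i)"
    using power_series_substitution[OF V', of "\<lambda>i. Var (\<kappa> i)"] \<kappa>V V0 by auto
  obtain h' where h': "h' \<in> ps_hom W V P'.P (power_series_const W)"
    "\<And>i. i \<in> V \<Longrightarrow> h' (Var i) = Var (\<kappa>' i)"
    using P'.power_series_substitution[OF finite_V, of "\<lambda>i. Var (\<kappa>' i)"] \<kappa>' V0 P'.Var_closed by auto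
  have "h (h' f) = f" if "f \<in> carrier P" for f
    by (rule hom_id[OF alg_hom_comp[OF h'(1) h(1)] _ that]) (simp add: h h' \<kappa>')
  moreover have "h' (h f) = f" if "f \<in> carrier P'.P" for f
    by (rule P'.hom_id[OF alg_hom_comp[OF h(1) h'(1)] _ that]) (simp add: h h' \<kappa>V \<kappa>'\<kappa>)
  ultimately have "bij_betw h (carrier P'.P) (carrier P)"
    using alg_hom_closed[OF h(1)] alg_hom_closed[OF h'(1)]
    by (intro bij_betw_byWitness[where f' = h']) auto
  then show ?thesis using h(1) by blast
qed

text \<open>Weierstrass division by a series \<open>f\<close> with a unit as its coefficient at the \<open>i\<close>-th variable \<open>T\<close>. Scale this
coefficient to \<open>1\<close> and write \<open>f = T + h\<close>. One seeks \<open>q\<close> such that \<open>g - q f\<close> does not involve \<open>T\<close>, that is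
\<open>q + \<tau>(q h) = \<tau>(g)\<close>. Give \<open>T\<close> the weight \<open>1\<close> and the other variables the weight \<open>2\<close>: then \<open>h\<close> has weight \<open>\<ge> 2\<close>
and \<open>\<tau>\<close> lowers the weight by \<open>1\<close>, so \<open>q \<mapsto> \<tau>(q h)\<close> is a contraction.\<close>
lemma division:
  assumes f: "f \<in> carrier P" and i: "i \<in> V" and f0: "f {#} = \<zero>" and f1: "f {#i#} \<in> Units W"
    and g: "g \<in> carrier P"
  shows "\<exists>q\<in>carrier P. \<exists>r\<in>carrier (ps_ring W (V - {i})). r \<in> carrier P \<and> g = r \<oplus>\<^bsub>P\<^esub> f \<otimes>\<^bsub>P\<^esub> q"
proof -
  define wd where "wd M = 2 * size M - count M i" for M :: "nat multiset"
  have cs: "count M i \<le> size M" for M :: "nat multiset" by (rule count_le_size)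
  interpret D: filtered_convolution_ring W u "{M. set_mset M \<subseteq> V}" "\<lambda>_ _. \<one>" P wd
  proof (rule filtered)
    show "wd (K + L) = wd K + wd L" for K L using cs[of K] cs[of L] by (simp add: wd_def)
    show "0 < wd M" if "M \<noteq> {#}" for M
      using cs[of M] that by (simp add: wd_def nonempty_has_size)
  qed
  define v where "v = inv (f {#i#})"
  have v: "v \<in> carrier W" "v \<otimes> f {#i#} = \<one>" using f1 by (auto simp: v_def)
  have vc: "P.mono 0 v \<in> carrier P" using v P.Supp_zero by simp
  define f' where "f' = P.mono 0 v \<otimes>\<^bsub>P\<^esub> f"
  have f'c: "f' \<in> carrier P" and f': "f' M = v \<otimes> f M" for M
    using P.mult_closed_C[OF vc f] P.const_mult[OF v(1) f] by (simp_all add: f'_def)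
  define h where "h = f' \<ominus>\<^bsub>P\<^esub> Var i"
  have hc: "h \<in> carrier P" using f'c i by (simp add: h_def)
  have hM: "h M = v \<otimes> f M \<ominus> Var i M" for M
    unfolding h_def by (simp add: P.coeff_minus f'c Var_closed[OF i] f')
  have h: "h \<in> D.F 2"
    unfolding D.F_def
  proof (intro CollectI conjI allI hc)
    fix M
    consider "M = {#}" | "M = {#i#}" | "2 \<le> wd M"
    proof -
      have "M = {#} \<or> M = {#i#}" if "wd M < 2"
      proof -
        have s: "size M \<le> 1" using that cs[of M] by (simp add: wd_def)
        show ?thesis
        proof (cases "size M = 0")
          case False
          then have "size M = 1" using s by linarith
          then obtain j where "M = {#j#}" using size_1_singleton_mset by blast
          then show ?thesis using that by (auto simp: wd_def split: if_splits)
        qed simp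
      qed
      then show ?thesis using that by linarith
    qed
    then show "h M \<in> U ((2 + 1 - wd M) div 2)"
    proof cases
      case 1
      then have "h M = \<zero>" using v f0 by (simp add: hM Var_def P.mono_def W.minus_eq)
      then show ?thesis by simp
    next
      case 2
      then have "h M = \<zero>" using v by (simp add: hM Var_def P.mono_def W.minus_eq W.r_neg)
      then show ?thesis by simp
    next
      case 3
      then have "(2 + 1 - wd M) div 2 = 0" by simp
      then show ?thesis using P.coeff_closed[OF hc] by simp
    qed
  qed
  have \<tau>_minus: "\<tau> i (a \<ominus>\<^bsub>P\<^esub> b) = \<tau> i a \<ominus>\<^bsub>P\<^esub> \<tau> i b" if "a \<in> carrier P" "b \<in> carrier P" for a b
  proof
    fix M
    show "\<tau> i (a \<ominus>\<^bsub>P\<^esub> b) M = (\<tau> i a \<ominus>\<^bsub>P\<^esub> \<tau> i b) M"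
      unfolding P.coeff_minus[OF \<tau>_closed[OF that(1)] \<tau>_closed[OF that(2)]]
      by (simp add: \<tau>_def P.coeff_minus[OF that])
  qed
  have "\<exists>q\<in>carrier P. q \<oplus>\<^bsub>P\<^esub> \<tau> i (q \<otimes>\<^bsub>P\<^esub> h) = \<tau> i g"
  proof (rule D.fixed_point[where \<Phi> = "\<lambda>q. \<tau> i (q \<otimes>\<^bsub>P\<^esub> h)"])
    show "\<tau> i ((a \<ominus>\<^bsub>P\<^esub> b) \<otimes>\<^bsub>P\<^esub> h) = \<tau> i (a \<otimes>\<^bsub>P\<^esub> h) \<ominus>\<^bsub>P\<^esub> \<tau> i (b \<otimes>\<^bsub>P\<^esub> h)"
      if "a \<in> carrier P" "b \<in> carrier P" for a b
    proof -
      have "(a \<ominus>\<^bsub>P\<^esub> b) \<otimes>\<^bsub>P\<^esub> h = a \<otimes>\<^bsub>P\<^esub> h \<ominus>\<^bsub>P\<^esub> b \<otimes>\<^bsub>P\<^esub> h" using that hc by algebra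
      then show ?thesis using that hc by (simp add: \<tau>_minus)
    qed
    show "\<tau> i (q \<otimes>\<^bsub>P\<^esub> h) \<in> D.F (Suc n)" if q: "q \<in> D.F n" for n q
    proof -
      have qh: "q \<otimes>\<^bsub>P\<^esub> h \<in> D.F (n + 2)" by (rule D.F_mult[OF q h])
      have "\<tau> i (q \<otimes>\<^bsub>P\<^esub> h) M \<in> U ((Suc n + 1 - wd M) div 2)" for M
      proof -
        have "wd (add_mset i M) = Suc (wd M)" using cs[of M] by (simp add: wd_def)
        then show ?thesis using D.F_coeff[OF qh, of "add_mset i M"] by (simp add: \<tau>_def)
      qed
      then show ?thesis using \<tau>_closed[OF D.F_closed[OF qh]] by (simp add: D.F_def)
    qed
  qed (use hc g in auto)
  then obtain q where q: "q \<in> carrier P" "q \<oplus>\<^bsub>P\<^esub> \<tau> i (q \<otimes>\<^bsub>P\<^esub> h) = \<tau> i g" by blast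
  define r where "r = g \<ominus>\<^bsub>P\<^esub> q \<otimes>\<^bsub>P\<^esub> f'"
  have rc: "r \<in> carrier P" using g q f'c by (simp add: r_def)
  have r0: "r (add_mset i M) = \<zero>" for M
  proof -
    have qhc: "q \<otimes>\<^bsub>P\<^esub> h \<in> carrier P" using q hc by simp
    have qf: "q \<otimes>\<^bsub>P\<^esub> f' = Var i \<otimes>\<^bsub>P\<^esub> q \<oplus>\<^bsub>P\<^esub> q \<otimes>\<^bsub>P\<^esub> h"
      unfolding h_def using q(1) f'c Var_closed[OF i] by algebra
    have "(q \<otimes>\<^bsub>P\<^esub> f') (add_mset i M) = q M \<oplus> (q \<otimes>\<^bsub>P\<^esub> h) (add_mset i M)"
      unfolding qf P.add_C using Var_mult[OF i q(1), of "add_mset i M"] by simp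
    also have "\<dots> = (q \<oplus>\<^bsub>P\<^esub> \<tau> i (q \<otimes>\<^bsub>P\<^esub> h)) M" by (simp add: P.add_C \<tau>_def)
    also have "\<dots> = g (add_mset i M)" unfolding q(2) by (simp add: \<tau>_def)
    finally have "(q \<otimes>\<^bsub>P\<^esub> f') (add_mset i M) = g (add_mset i M)" .
    then show ?thesis
      unfolding r_def P.coeff_minus[OF g P.mult_closed_C[OF q(1) f'c]]
      using P.coeff_closed[OF g] by (simp add: W.minus_eq W.r_neg)
  qed
  have "r \<in> carrier (ps_ring W (V - {i}))"
  proof -
    have "r M = \<zero>" if M: "\<not> set_mset M \<subseteq> V - {i}" for M
    proof (cases "i \<in># M")
      case True
      then show ?thesis using r0[of "M - {#i#}"] by simp
    next
      case False
      then have "\<not> set_mset M \<subseteq> V" using M by auto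
      then show ?thesis using P.coeff_Supp[OF rc] by simp
    qed
    then show ?thesis unfolding ps_carrier_iff using P.coeff_closed[OF rc] by blast
  qed
  moreover have "g = r \<oplus>\<^bsub>P\<^esub> f \<otimes>\<^bsub>P\<^esub> (P.mono 0 v \<otimes>\<^bsub>P\<^esub> q)"
    unfolding r_def f'_def using g q(1) f vc by algebra
  moreover have "P.mono 0 v \<otimes>\<^bsub>P\<^esub> q \<in> carrier P" using vc q by simp
  ultimately show ?thesis using rc by blast
qed

end

section \<open>The lifting properties imply smoothness\<close>

lemma ps_ring_same:
  "monoid.mult (ps_ring W V') = monoid.mult (ps_ring W V)"
  "ring.add (ps_ring W V') = ring.add (ps_ring W V)"
  "monoid.one (ps_ring W V') = monoid.one (ps_ring W V)"
  by (simp_all add: ps_ring_def)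

locale lifting_conditions = dp_ring W u + R: cring R
  for W :: "('a, 'm) ring_scheme" (structure) and u and R :: "('b, 'n) ring_scheme" +
  fixes \<rho> :: "'a \<Rightarrow> 'b" and s :: "'b \<Rightarrow> 'a"
  assumes char_zero: "add_pow W (n::nat) \<one> = \<zero> \<Longrightarrow> n = 0"
    and s_hom: "s \<in> alg_hom W R \<rho> W (\<lambda>w. w)"
    and lift_eps: "\<And>m f. f \<in> alg_hom W R \<rho> (W_eps_quot W u m) (W_eps_quot_of W u m) \<Longrightarrow>
       \<exists>g \<in> alg_hom W R \<rho> (W_eps W u (Suc m)) (W_eps_of W u (Suc m)).
         \<forall>x\<in>carrier R. W_eps_proj W u m (g x) = f x"
    and lift_dp: "\<And>m d f. \<lbrakk>0 < m; 0 < d; f \<in> alg_hom W R \<rho> (W_dp W u m d) (W_dp_of W u m d)\<rbrakk> \<Longrightarrow>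
       \<exists>g \<in> alg_hom W R \<rho> (W_dp W u m (Suc d)) (W_dp_of W u m (Suc d)).
         \<forall>x\<in>carrier R. W_dp_proj W u m d (g x) = f x"

text \<open>A presentation for which the section of \<open>R\<close> is the evaluation at the origin; every surjection can be translated
into this form (\<open>exists_presentation\<close>).\<close>
locale presentation = lifting_conditions W u R \<rho> s + P: power_series W u V
  for W :: "('a, 'm) ring_scheme" (structure) and u and R :: "('b, 'n) ring_scheme"
    and \<rho> s and V +
  fixes \<phi>
  assumes \<phi>: "\<phi> \<in> ps_hom W V R \<rho>"
    and \<phi>_surj: "\<phi> ` carrier (ps_ring W V) = carrier R"
    and s_Var: "i \<in> V \<Longrightarrow> s (\<phi> (P.Var i)) = \<zero>"
begin

sublocale \<phi>: ring_hom_cring P.P R \<phi>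
  by (rule alg_hom_cring[OF \<phi> P.P.cring_C R.is_cring])

lemma section_eq: assumes "f \<in> carrier P.P" shows "s (\<phi> f) = f {#}"
proof (rule P.hom_unique[OF W.is_cring alg_hom_comp[OF \<phi> s_hom] P.const_coeff_hom _ _ _ _ _ _ assms,
    where G = "\<lambda>n. if n = 0 then carrier W else {\<zero>}"])
  fix i assume i: "i \<in> V"
  have "P.Var i {#} = \<zero>" by (simp add: P.Var_def P.P.mono_def)
  then show "s (\<phi> (P.Var i)) = P.Var i {#}" by (simp add: s_Var i)
  show "s (\<phi> (P.Var i)) \<otimes> a \<in> (if Suc n = 0 then carrier W else {\<zero>})"
    if "a \<in> (if n = 0 then carrier W else {\<zero>})" for n a
    using that by (auto simp: s_Var i split: if_splits)
next
  fix b assume "\<And>n::nat. b \<in> (if n = 0 then carrier W else {\<zero>})"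
  from this[of 1] show "b = \<zero>" by simp
qed (auto split: if_splits)

definition I where "I = {f \<in> carrier P.P. \<phi> f = \<zero>\<^bsub>R\<^esub>}"

lemma I_const: assumes "f \<in> I" shows "f {#} = \<zero>"
proof -
  have "s \<zero>\<^bsub>R\<^esub> = \<zero>"
    using ring_hom_zero[of s R W] s_hom R.ring_axioms W.ring_axioms by (simp add: alg_hom_def)
  then show ?thesis using assms section_eq[of f] by (simp add: I_def)
qed

lemma V: "power_series W u V" by (rule P.power_series_axioms)

lemma mono_substitution:
  assumes "\<And>i. a i \<in> carrier W"
  shows "S_curve W u V (\<lambda>i. S.mono 1 (a i))"
proof (intro substitution.intro substitution_axioms.intro S.filtered_convolution_ring_axioms P.finite_V)
  fix i
  have "S.mono 1 (a i) 0 = \<zero>" by (simp add: S.mono_def)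
  moreover have "S.mono 1 (a i) \<in> carrier S" using assms by simp
  ultimately show "S.mono 1 (a i) \<in> S.F 1" by (simp only: S.F_one_iff U_mem_zero simp_thms)
qed

text \<open>Along \<open>T\<^sub>i \<mapsto> a\<^sub>i \<gamma>\<^sup>1\<close> the kernel vanishes modulo \<open>\<gamma>\<^sup>d\<close>. The lift to \<open>W\<^sub>m\<^sub>,\<^sub>d\<^sub>+\<^sub>1\<close> changes the curve only in
degree \<open>d \<ge> 2\<close>, hence not its direction \<open>a\<close>, so the coefficient \<open>d! f\<^sub>d(a)\<close> of \<open>\<gamma>\<^sup>d\<close> is zero modulo \<open>u\<^sup>m\<close>.\<close>
lemma order_step:
  assumes d: "2 \<le> d" and ord: "\<And>f M. \<lbrakk>f \<in> I; size M < d\<rbrakk> \<Longrightarrow> f M = \<zero>"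
    and f: "f \<in> I" and M: "size M = d"
  shows "f M = \<zero>"
proof (cases "set_mset M \<subseteq> V")
  case False
  then show ?thesis using f P.P.coeff_Supp by (simp add: I_def)
next
  case True
  let ?T = "{M. set_mset M \<subseteq> V \<and> size M = d}"
  have fc: "f K \<in> carrier W" for K using f P.P.coeff_closed by (simp add: I_def)
  have fP: "f \<in> carrier P.P" using f by (simp add: I_def)
  have "(\<Oplus>K\<in>?T. f K \<otimes> mpow W V a K) = \<zero>" if a: "\<And>i. a i \<in> carrier W" for a
  proof -
    have pc: "mpow W V a K \<in> carrier W" for K by (rule W.mpow_closed) (rule a)
    let ?x = "\<lambda>i. S.mono 1 (a i)"
    have x: "S_curve W u V ?x" by (rule mono_substitution[OF a])
    interpret x: substitution W u UNIV "binom W" S "\<lambda>n. n" V ?x by (rule x)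
    have x0: "?x i 0 = \<zero>" for i by (simp add: S.mono_def)
    define z where "z = (\<Oplus>K\<in>?T. f K \<otimes> add_pow W (fact d :: nat) (mpow W V a K))"
    have zU: "z \<in> U m" if m: "0 < m" for m
    proof -
      have d0: "0 < d" "0 < Suc d" using d by auto
      let ?k = "\<lambda>n. if n < d then m else 0" and ?k' = "\<lambda>n. if n < Suc d then m else 0"
      have "\<exists>y. S_curve W u V y \<and>
        (\<forall>i\<in>V. \<forall>n. ?k n = ?k' n \<longrightarrow> y i n = ?x i n) \<and>
        (\<forall>i\<in>V. \<forall>n. y i n \<ominus> ?x i n \<in> U (?k n)) \<and>
        (\<forall>f\<in>carrier P.P. \<phi> f = \<zero>\<^bsub>R\<^esub> \<longrightarrow> (\<forall>n. along_curve W u V y f n \<in> U (?k' n)))"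
      proof (rule lift_along_test_algebras[OF test_algebra_dp[OF m d0(1)] test_algebra_dp[OF m d0(2)] _
            R.is_cring V _ \<phi> \<phi>_surj x])
        show "W_dp_proj W u m d (dp_ideal (A m) (Suc d) +>\<^bsub>divided_power_algebra (A m)\<^esub> cut m (Suc d) s)
          = dp_ideal (A m) d +>\<^bsub>divided_power_algebra (A m)\<^esub> cut m d s" if "s \<in> carrier S" for s
          by (rule dp_proj[OF m d0(1) that])
        show "\<exists>g\<in>alg_hom W R \<rho> (W_dp W u m (Suc d)) (W_dp_of W u m (Suc d)).
            \<forall>x\<in>carrier R. W_dp_proj W u m d (g x) = f x"
          if "f \<in> alg_hom W R \<rho> (W_dp W u m d) (W_dp_of W u m d)" for f
          by (rule lift_dp[OF m d0(1) that])
        show "x.\<psi> f n \<in> U (?k n)" if "f \<in> carrier P.P" "\<phi> f = \<zero>\<^bsub>R\<^esub>" for f n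
        proof (cases "n < d")
          case True
          have "f \<in> I" using that by (simp add: I_def)
          then have "x.\<psi> f n = \<zero>" using leading_coeff(1)[OF x x0 that(1) ord[OF \<open>f \<in> I\<close>] True] by blast
          then show ?thesis by simp
        next
          case False
          then show ?thesis using S.coeff_closed[OF x.\<psi>_spec(1)[OF that(1)]] by simp
        qed
      qed
      then obtain y where y: "S_curve W u V y"
        and yx: "\<And>i n. \<lbrakk>i \<in> V; ?k n = ?k' n\<rbrakk> \<Longrightarrow> y i n = ?x i n"
        and yk: "\<And>f n. \<lbrakk>f \<in> carrier P.P; \<phi> f = \<zero>\<^bsub>R\<^esub>\<rbrakk> \<Longrightarrow>
          along_curve W u V y f n \<in> U (?k' n)" by blast
      interpret y: substitution W u UNIV "binom W" S "\<lambda>n. n" V y by (rule y)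
      have y0: "y i 0 = \<zero>" if "i \<in> V" for i using yx[OF that, of 0] d x0[of i] by simp
      have y1: "y i 1 = a i" if "i \<in> V" for i using yx[OF that, of 1] d by (simp add: S.mono_def)
      have "y.\<psi> f d = (\<Oplus>K\<in>?T. f K \<otimes> add_pow W (fact d :: nat) (mpow W V (\<lambda>i. y i 1) K))"
        by (rule leading_coeff(2)[OF y y0 fP ord[OF f]])
      also have "\<dots> = z"
      proof -
        have "mpow W V (\<lambda>i. y i 1) K = mpow W V a K" for K
          unfolding mpow_def by (rule W.finprod_cong') (use a in \<open>auto simp: y1[simplified]\<close>)
        then show ?thesis by (simp add: z_def)
      qed
      finally show ?thesis using yk[OF fP, of d] f by (simp add: I_def)
    qed
    have "f K \<otimes> add_pow W (fact d :: nat) (mpow W V a K)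
      = add_pow W (fact d :: nat) \<one> \<otimes> (f K \<otimes> mpow W V a K)" for K
      using fc pc by (simp add: W.add_pow_rdistr W.add_pow_one_mult)
    then have z_eq: "z = add_pow W (fact d :: nat) \<one> \<otimes> (\<Oplus>K\<in>?T. f K \<otimes> mpow W V a K)"
      unfolding z_def using fc pc finite_mset_size[OF P.finite_V, of d]
      by (simp add: W.finsum_rdistr)
    have sc: "(\<Oplus>K\<in>?T. f K \<otimes> mpow W V a K) \<in> carrier W"
      by (rule W.finsum_closed) (use fc pc in auto)
    have "z \<in> U m" for m using zU[of m] z_eq sc by (cases "m = 0") auto
    then have "z = \<zero>" using z_eq sc by (intro U_separated) auto
    moreover have "add_pow W (fact d :: nat) \<one> \<noteq> \<zero>" using char_zero[of "fact d"] by auto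
    ultimately show ?thesis using z_eq sc W.integral[of "add_pow W (fact d :: nat) \<one>"] by auto
  qed
  from form_vanishing_on_points[OF P.finite_V finite_mset_size[OF P.finite_V, of d] _ fc this] True M
  show ?thesis by auto
qed

lemma linear_sum:
  assumes f: "f \<in> carrier P.P" and a: "\<And>i. i \<in> V \<Longrightarrow> a i \<in> carrier W"
  shows "(\<Oplus>K\<in>{M. set_mset M \<subseteq> V \<and> size M = 1}. f K \<otimes> add_pow W (fact 1 :: nat) (mpow W V a K))
    = (\<Oplus>i\<in>V. f {#i#} \<otimes> a i)"
proof -
  have fc: "f K \<in> carrier W" for K by (rule P.P.coeff_closed[OF f])
  have pc: "mpow W V a K \<in> carrier W" for K by (rule W.mpow_closed) (rule a)
  have single: "mpow W V a {#i#} = a i" if "i \<in> V" for i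
    using W.mpow_add_mset[OF P.finite_V that a, where M = "{#}"] a[OF that] by (simp add: W.mpow_empty)
  have im: "{M. set_mset M \<subseteq> V \<and> size M = 1} = (\<lambda>i. {#i#}) ` V"
    using size_1_singleton_mset by fastforce
  have "(\<Oplus>K\<in>(\<lambda>i. {#i#}) ` V. f K \<otimes> add_pow W (fact 1 :: nat) (mpow W V a K))
    = (\<Oplus>i\<in>V. f {#i#} \<otimes> add_pow W (fact 1 :: nat) (mpow W V a {#i#}))"
    by (rule W.finsum_reindex) (use fc pc in \<open>auto simp: inj_on_def\<close>)
  also have "\<dots> = (\<Oplus>i\<in>V. f {#i#} \<otimes> a i)"
    by (rule W.finsum_cong') (use fc a single in auto)
  finally show ?thesis by (simp only: im)
qed

text \<open>Condition (ii) excludes that \<open>u\<close> divides all the linear coefficients of \<open>I\<close> unless all of them are zero: a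
direction along which \<open>I\<close> vanishes modulo \<open>u\<^sup>n\<close> can be corrected, by a multiple of \<open>u\<^sup>n\<close>, so that \<open>I\<close> vanishes
along it modulo \<open>u\<^sup>n\<^sup>+\<^sup>1\<close>.\<close>
lemma linear_unit:
  assumes f: "f \<in> I" and i: "i \<in> V" and nz: "f {#i#} \<noteq> \<zero>"
  shows "\<exists>f\<in>I. \<exists>i\<in>V. f {#i#} \<in> Units W"
proof -
  have fcI: "f K \<in> carrier W" if "f \<in> I" for f K using that P.P.coeff_closed by (simp add: I_def)
  define Q where "Q n \<longleftrightarrow> (\<exists>f\<in>I. \<exists>i\<in>V. f {#i#} \<notin> U (Suc n))" for n
  define n where "n = (LEAST n. Q n)"
  obtain l where "f {#i#} \<notin> U (Suc l)" using minimal_power[OF fcI[OF f] nz] by blast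
  then have "Q l" using f i by (auto simp: Q_def)
  then have "Q n" unfolding n_def by (rule LeastI)
  then obtain f i where f: "f \<in> I" and i: "i \<in> V" and fi: "f {#i#} \<notin> U (Suc n)" by (auto simp: Q_def)
  have all: "g {#j#} \<in> U n" if "g \<in> I" "j \<in> V" for g j
  proof (cases n)
    case 0
    then show ?thesis using fcI that by simp
  next
    case (Suc n')
    then have "\<not> Q n'" unfolding n_def using not_less_Least by (metis lessI)
    then show ?thesis using that Suc by (auto simp: Q_def)
  qed
  have "n = 0"
  proof (rule ccontr)
    assume n: "n \<noteq> 0"
    \<comment> \<open>The \<open>i\<close>-th coordinate direction: along it \<open>I\<close> vanishes modulo \<open>u\<^sup>n\<epsilon>\<close>.\<close>
    define a where "a j = (if j = i then \<one> else \<zero>)" for j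
    have a: "a j \<in> carrier W" for j by (simp add: a_def)
    let ?x = "\<lambda>j. S.mono 1 (a j)"
    have x: "S_curve W u V ?x" by (rule mono_substitution[OF a])
    interpret x: substitution W u UNIV "binom W" S "\<lambda>n. n" V ?x by (rule x)
    have x0: "?x j 0 = \<zero>" for j by (simp add: S.mono_def)
    have ord: "g M = \<zero>" if "g \<in> I" "size M < 1" for g M using I_const[OF that(1)] that(2) by simp
    let ?k = "\<lambda>l. if l = 0 then Suc n else if l = 1 then n else 0" and ?k' = "\<lambda>l. if l < 2 then Suc n else 0"
    have "\<exists>y. S_curve W u V y \<and>
        (\<forall>i\<in>V. \<forall>n. ?k n = ?k' n \<longrightarrow> y i n = ?x i n) \<and>
        (\<forall>i\<in>V. \<forall>n. y i n \<ominus> ?x i n \<in> U (?k n)) \<and>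
        (\<forall>f\<in>carrier P.P. \<phi> f = \<zero>\<^bsub>R\<^esub> \<longrightarrow> (\<forall>n. along_curve W u V y f n \<in> U (?k' n)))"
    proof (rule lift_along_test_algebras[OF test_algebra_eps_quot test_algebra_eps _ R.is_cring V lift_eps \<phi> \<phi>_surj x])
      show "0 < Suc n" by simp
      fix g and l :: nat assume g: "g \<in> carrier P.P" "\<phi> g = \<zero>\<^bsub>R\<^esub>"
      then have gI: "g \<in> I" by (simp add: I_def)
      have "l = 0 \<or> l = 1 \<or> (1::nat) < l" by linarith
      then consider "l = 0" | "l = 1" | "l > 1" by blast
      then show "x.\<psi> g l \<in> U (?k l)"
      proof cases
        case 1
        have "x.\<psi> g 0 = \<zero>" by (rule leading_coeff(1)[where d = 1, OF x x0 g(1) ord[OF gI]]) auto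
        then show ?thesis using 1 by simp
      next
        case 2
        have "x.\<psi> g 1 = (\<Oplus>K\<in>{M. set_mset M \<subseteq> V \<and> size M = 1}.
            g K \<otimes> add_pow W (fact 1 :: nat) (mpow W V (\<lambda>i. ?x i 1) K))"
          by (rule leading_coeff(2)[OF x x0 g(1) ord[OF gI]])
        also have "\<dots> = (\<Oplus>j\<in>V. g {#j#} \<otimes> ?x j 1)"
          by (rule linear_sum[OF g(1)]) (simp add: S.mono_def a)
        also have "\<dots> \<in> U n"
          by (rule U_finsum, rule U_mult_right) (use all[OF gI] a in \<open>auto simp: S.mono_def\<close>)
        finally show ?thesis using 2 by simp
      next
        case 3
        then show ?thesis using S.coeff_closed[OF x.\<psi>_spec(1)[OF g(1)]] by simp
      qed
    qed (rule refl)
    then obtain y where y: "S_curve W u V y"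
      and yx: "\<And>i l. \<lbrakk>i \<in> V; ?k l = ?k' l\<rbrakk> \<Longrightarrow> y i l = ?x i l"
      and yU: "\<And>i l. i \<in> V \<Longrightarrow> y i l \<ominus> ?x i l \<in> U (?k l)"
      and yk: "\<And>f l. \<lbrakk>f \<in> carrier P.P; \<phi> f = \<zero>\<^bsub>R\<^esub>\<rbrakk> \<Longrightarrow>
          along_curve W u V y f l \<in> U (?k' l)" by blast
    interpret y: substitution W u UNIV "binom W" S "\<lambda>n. n" V y by (rule y)
    have y0: "y j 0 = \<zero>" if "j \<in> V" for j using yx[OF that, of 0] x0[of j] by simp
    have yc: "y j 1 \<in> carrier W" if "j \<in> V" for j by (rule S.coeff_closed[OF y.x_closed[OF that]])
    have y1: "y j 1 \<ominus> a j \<in> U n" if "j \<in> V" for j using yU[OF that, of 1] by (simp add: S.mono_def)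
    have fP: "f \<in> carrier P.P" using f by (simp add: I_def)
    have "y.\<psi> f 1 = (\<Oplus>K\<in>{M. set_mset M \<subseteq> V \<and> size M = 1}.
            f K \<otimes> add_pow W (fact 1 :: nat) (mpow W V (\<lambda>i. y i 1) K))"
      by (rule leading_coeff(2)[OF y y0 fP ord[OF f]])
    also have "\<dots> = (\<Oplus>j\<in>V. f {#j#} \<otimes> y j 1)" by (rule linear_sum[OF fP yc])
    finally have "(\<Oplus>j\<in>V. f {#j#} \<otimes> y j 1) \<in> U (Suc n)" using yk[OF fP, of 1] f by (simp add: I_def)
    moreover have "(\<Oplus>j\<in>V. f {#j#} \<otimes> y j 1) = (\<Oplus>j\<in>V. f {#j#} \<otimes> (y j 1 \<ominus> a j)) \<oplus> (\<Oplus>j\<in>V. f {#j#} \<otimes> a j)"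
    proof -
      have "(\<Oplus>j\<in>V. f {#j#} \<otimes> y j 1) = (\<Oplus>j\<in>V. f {#j#} \<otimes> (y j 1 \<ominus> a j) \<oplus> f {#j#} \<otimes> a j)"
      proof (rule W.finsum_cong'[OF refl])
        fix j assume "j \<in> V"
        then have "y j 1 \<in> carrier W" "f {#j#} \<in> carrier W" using yc fcI[OF f] by auto
        then show "f {#j#} \<otimes> y j 1 = f {#j#} \<otimes> (y j 1 \<ominus> a j) \<oplus> f {#j#} \<otimes> a j"
          using a[of j] by algebra
      qed (use yc fcI[OF f] a in auto)
      then show ?thesis using yc fcI[OF f] a by (simp add: W.finsum_addf)
    qed
    moreover have "(\<Oplus>j\<in>V. f {#j#} \<otimes> a j) = f {#i#}"
    proof -
      have "(\<Oplus>j\<in>V. f {#j#} \<otimes> a j) = (\<Oplus>j\<in>V. if i = j then f {#j#} else \<zero>)"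
        by (rule W.finsum_cong') (use fcI[OF f] in \<open>auto simp: a_def\<close>)
      also have "\<dots> = f {#i#}"
        using W.finsum_singleton[OF i P.finite_V, of "\<lambda>j. f {#j#}"] fcI[OF f] by simp
      finally show ?thesis .
    qed
    \<comment> \<open>Both factors are divisible by \<open>u\<^sup>n\<close>, and \<open>2 n \<ge> n + 1\<close> because \<open>n > 0\<close>.\<close>
    moreover have small: "(\<Oplus>j\<in>V. f {#j#} \<otimes> (y j 1 \<ominus> a j)) \<in> U (Suc n)"
    proof (rule U_finsum)
      fix j assume j: "j \<in> V"
      show "f {#j#} \<otimes> (y j 1 \<ominus> a j) \<in> U (Suc n)"
        by (rule U_antimono[OF _ U_mult[OF all[OF f j] y1[OF j]]]) (use n in simp)
    qed
    ultimately have "(\<Oplus>j\<in>V. f {#j#} \<otimes> (y j 1 \<ominus> a j)) \<oplus> f {#i#} \<in> U (Suc n)" by simp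
    from U_minus[OF this small]
    have "((\<Oplus>j\<in>V. f {#j#} \<otimes> (y j 1 \<ominus> a j)) \<oplus> f {#i#}) \<ominus> (\<Oplus>j\<in>V. f {#j#} \<otimes> (y j 1 \<ominus> a j)) \<in> U (Suc n)" .
    also have "((\<Oplus>j\<in>V. f {#j#} \<otimes> (y j 1 \<ominus> a j)) \<oplus> f {#i#}) \<ominus> (\<Oplus>j\<in>V. f {#j#} \<otimes> (y j 1 \<ominus> a j)) = f {#i#}"
    proof -
      have "(b \<oplus> c) \<ominus> b = c" if "b \<in> carrier W" "c \<in> carrier W" for b c
        using that by algebra
      then show ?thesis using U_closed[OF small] fcI[OF f] by blast
    qed
    finally show False using fi by simp
  qed
  then show ?thesis using f i fi unit_iff[OF fcI[OF f]] by auto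
qed

text \<open>By division every power series is congruent modulo \<open>f\<close>, hence modulo \<open>I\<close>, to one without the \<open>i\<close>-th variable.\<close>
lemma eliminate_variable:
  assumes f: "f \<in> I" and i: "i \<in> V" and unit: "f {#i#} \<in> Units W"
  shows "\<exists>\<phi>'\<in>ps_hom W (V - {i}) R \<rho>.
    \<phi>' ` carrier (ps_ring W (V - {i})) = carrier R"
proof (rule bexI[of _ \<phi>])
  have fP: "f \<in> carrier P.P" and f0: "\<phi> f = \<zero>\<^bsub>R\<^esub>" using f by (auto simp: I_def)
  have sub: "carrier (ps_ring W (V - {i})) \<subseteq> carrier P.P"
  proof
    fix f assume f: "f \<in> carrier (ps_ring W (V - {i}))"
    show "f \<in> carrier P.P"
      unfolding ps_carrier_iff
    proof (intro allI conjI impI)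
      fix M
      note fM = ps_carrier_iff[THEN iffD1, OF f, THEN spec, of M]
      show "f M \<in> carrier W" using fM by (rule conjunct1)
      show "f M = \<zero>" if "\<not> set_mset M \<subseteq> V"
      proof -
        have "\<not> set_mset M \<subseteq> V - {i}" using that by auto
        then show ?thesis by (rule fM[THEN conjunct2, THEN mp])
      qed
    qed
  qed
  have same: "monoid.mult (ps_ring W (V - {i})) = monoid.mult P.P"
    "ring.add (ps_ring W (V - {i})) = ring.add P.P"
    "monoid.one (ps_ring W (V - {i})) = monoid.one P.P"
    by (rule ps_ring_same)+
  show "\<phi> \<in> ps_hom W (V - {i}) R \<rho>"
  proof -
    have "\<phi> \<in> ring_hom (ps_ring W (V - {i})) R"
    proof (rule ring_hom_memI)
      fix a b assume "a \<in> carrier (ps_ring W (V - {i}))" "b \<in> carrier (ps_ring W (V - {i}))"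
      then have ab: "a \<in> carrier P.P" "b \<in> carrier P.P" using sub by blast+
      show "\<phi> a \<in> carrier R" by (rule \<phi>.hom_closed[OF ab(1)])
      show "\<phi> (a \<otimes>\<^bsub>ps_ring W (V - {i})\<^esub> b) = \<phi> a \<otimes>\<^bsub>R\<^esub> \<phi> b"
        unfolding same by (rule \<phi>.hom_mult[OF ab])
      show "\<phi> (a \<oplus>\<^bsub>ps_ring W (V - {i})\<^esub> b) = \<phi> a \<oplus>\<^bsub>R\<^esub> \<phi> b"
        unfolding same by (rule \<phi>.hom_add[OF ab])
    next
      show "\<phi> \<one>\<^bsub>ps_ring W (V - {i})\<^esub> = \<one>\<^bsub>R\<^esub>" unfolding same by (rule \<phi>.hom_one)
    qed
    then show ?thesis using \<phi> by (simp add: alg_hom_def)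
  qed
  show "\<phi> ` carrier (ps_ring W (V - {i})) = carrier R"
  proof
    show "\<phi> ` carrier (ps_ring W (V - {i})) \<subseteq> carrier R" using sub \<phi>.hom_closed by auto
    show "carrier R \<subseteq> \<phi> ` carrier (ps_ring W (V - {i}))"
    proof
      fix a assume "a \<in> carrier R"
      then obtain g where g: "g \<in> carrier P.P" "\<phi> g = a" using \<phi>_surj by (metis imageE)
      obtain q r where qr: "q \<in> carrier P.P" "r \<in> carrier (ps_ring W (V - {i}))" "r \<in> carrier P.P"
        "g = r \<oplus>\<^bsub>P.P\<^esub> f \<otimes>\<^bsub>P.P\<^esub> q"
        using P.division[OF fP i I_const[OF f] unit g(1)] by blast
      have "a = \<phi> r" using g(2) qr fP f0 by simp
      then show "a \<in> \<phi> ` carrier (ps_ring W (V - {i}))" using qr(2) by blast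
    qed
  qed
qed

lemma injective:
  assumes minimal: "\<And>i. i \<in> V \<Longrightarrow> \<not> (\<exists>\<phi>'\<in>ps_hom W (V - {i}) R \<rho>.
    \<phi>' ` carrier (ps_ring W (V - {i})) = carrier R)"
  shows "inj_on \<phi> (carrier P.P)"
proof -
  have ord: "f M = \<zero>" if "f \<in> I" "size M < d" for d f M
    using that
  proof (induction d arbitrary: f M)
    case (Suc d)
    show ?case
    proof (cases "size M < d")
      case True
      then show ?thesis using Suc by blast
    next
      case False
      then have M: "size M = d" using Suc.prems by simp
      consider "d = 0" | "d = 1" | "2 \<le> d" by linarith
      then show ?thesis
      proof cases
        case 1
        then show ?thesis using I_const Suc.prems M by simp
      next
        case 2
        then obtain i where i: "M = {#i#}" using M size_1_singleton_mset by blast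
        show ?thesis
        proof (cases "i \<in> V")
          case True
          then show ?thesis
            using linear_unit[OF Suc.prems(1) True] eliminate_variable minimal i by blast
        next
          case False
          then show ?thesis using P.P.coeff_Supp[of f M] Suc.prems i by (simp add: I_def)
        qed
      next
        case 3
        show ?thesis by (rule order_step[OF 3 _ Suc.prems(1) M]) (rule Suc.IH)
      qed
    qed
  qed simp
  have z: "f = \<zero>\<^bsub>P.P\<^esub>" if "f \<in> carrier P.P" "\<phi> f = \<zero>\<^bsub>R\<^esub>" for f
    unfolding P.P.zero_C using ord[of f _ "Suc (size _)"] that by (auto simp: I_def fun_eq_iff)
  show ?thesis
  proof (rule inj_onI)
    fix f g assume fg: "f \<in> carrier P.P" "g \<in> carrier P.P" "\<phi> f = \<phi> g"
    have "\<phi> (f \<ominus>\<^bsub>P.P\<^esub> g) = \<zero>\<^bsub>R\<^esub>" using fg by (simp add: P.P.C.minus_eq R.r_neg)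
    then have "f \<ominus>\<^bsub>P.P\<^esub> g = \<zero>\<^bsub>P.P\<^esub>" using z fg by simp
    then show "f = g" using fg by simp
  qed
qed

end

context lifting_conditions
begin

text \<open>The coordinate \<open>c\<^sub>i = s(\<phi>(T\<^sub>i))\<close> is in \<open>(u)\<close>: otherwise \<open>T\<^sub>i - c\<^sub>i\<close> would be a unit of the power series ring with
image \<open>0\<close> in \<open>W\<close>.\<close>
lemma exists_presentation:
  assumes V: "finite V" and \<phi>: "\<phi> \<in> ps_hom W V R \<rho>"
    and surj: "\<phi> ` carrier (ps_ring W V) = carrier R"
  shows "\<exists>\<phi>. presentation W u R \<rho> s V \<phi>"
proof -
  interpret P: power_series W u V
    by (intro power_series.intro power_series_axioms.intro complete_dvr_axioms V)
  interpret \<phi>: ring_hom_cring P.P R \<phi> by (rule alg_hom_cring[OF \<phi> P.P.cring_C R.is_cring])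
  interpret s: ring_hom_cring R W s by (rule alg_hom_cring[OF s_hom R.is_cring W.is_cring])
  have const: "s (\<phi> (power_series_const W w)) = w" if "w \<in> carrier W" for w
    using \<phi> s_hom that by (simp add: alg_hom_def)
  have cc: "power_series_const W w \<in> carrier P.P" if "w \<in> carrier W" for w
    using that P.P.Supp_zero by (simp add: P.const_eq)
  define c where "c i = s (\<phi> (P.Var i))" for i
  have c: "c i \<in> U 1" if i: "i \<in> V" for i
  proof (rule ccontr)
    assume "c i \<notin> U 1"
    moreover have cW: "c i \<in> carrier W" using i by (simp add: c_def)
    ultimately have "c i \<in> Units W" using unit_iff by blast
    then have "P.Var i \<ominus>\<^bsub>P.P\<^esub> power_series_const W (c i) \<in> Units P.P"
      unfolding P.const_eq by (rule P.Var_minus_unit[OF i])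
    then have "s (\<phi> (P.Var i \<ominus>\<^bsub>P.P\<^esub> power_series_const W (c i))) \<in> Units W"
      using hom_Units[OF s.homh R.is_cring W.is_cring hom_Units[OF \<phi>.homh P.P.cring_C R.is_cring]] by blast
    moreover have "s (\<phi> (P.Var i \<ominus>\<^bsub>P.P\<^esub> power_series_const W (c i))) = \<zero>"
      using i cc[OF cW] const[OF cW] cW
      by (simp add: P.P.C.minus_eq R.minus_eq) (simp add: c_def W.r_neg)
    ultimately show False using unit_iff[of \<zero>] by simp
  qed
  obtain h where h: "h \<in> ps_hom W V P.P (power_series_const W)"
    "\<And>i. i \<in> V \<Longrightarrow> h (P.Var i) = P.Var i \<ominus>\<^bsub>P.P\<^esub> power_series_const W (c i)"
    "h ` carrier P.P = carrier P.P"
    using P.translate[of c] c by blast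
  have "presentation W u R \<rho> s V (\<lambda>f. \<phi> (h f))"
  proof (intro presentation.intro presentation_axioms.intro lifting_conditions_axioms P.power_series_axioms)
    show "(\<lambda>f. \<phi> (h f)) \<in> ps_hom W V R \<rho>"
      by (rule alg_hom_comp[OF h(1) \<phi>])
    show "(\<lambda>f. \<phi> (h f)) ` carrier (ps_ring W V) = carrier R"
      using h(3) surj by (metis image_image)
    fix i assume i: "i \<in> V"
    have cW: "c i \<in> carrier W" using i by (simp add: c_def)
    show "s (\<phi> (h (P.Var i))) = \<zero>"
      unfolding h(2)[OF i] using i cc[OF cW] const[OF cW] cW
      by (simp add: P.P.C.minus_eq R.minus_eq) (simp add: c_def W.r_neg)
  qed
  then show ?thesis by blast
qed

text \<open>A presentation with the least number of variables is injective. Its set of variables is any finite set, and is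
renamed to an initial segment in the end.\<close>
lemma conditions_imp_smooth:
  assumes \<phi>: "\<phi> \<in> ps_hom W {..<r} R \<rho>"
    and surj: "\<phi> ` carrier (ps_ring W {..<r}) = carrier R"
    and \<rho>: "\<rho> \<in> ring_hom W R"
  shows "smooth_algebra W R \<rho>"
proof -
  define Q where "Q V \<longleftrightarrow> finite V \<and> (\<exists>\<phi>\<in>ps_hom W V R \<rho>.
    \<phi> ` carrier (ps_ring W V) = carrier R)" for V
  have "Q {..<r}" using \<phi> surj by (auto simp: Q_def)
  then obtain V where V: "Q V" and min: "\<And>V'. Q V' \<Longrightarrow> card V \<le> card V'"
    using ex_has_least_nat[of Q "{..<r}" card] by blast
  have fin: "finite V" using V by (simp add: Q_def)
  obtain \<phi>\<^sub>0 where "\<phi>\<^sub>0 \<in> ps_hom W V R \<rho>"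
    "\<phi>\<^sub>0 ` carrier (ps_ring W V) = carrier R" using V by (auto simp: Q_def)
  then obtain \<phi>' where "presentation W u R \<rho> s V \<phi>'"
    using exists_presentation[OF fin] by blast
  then interpret presentation W u R \<rho> s V \<phi>' .
  have "\<not> Q (V - {i})" if "i \<in> V" for i
    using min[of "V - {i}"] card_Diff1_less[OF fin that] by linarith
  then have "inj_on \<phi>' (carrier P.P)" using fin by (intro injective) (simp add: Q_def)
  then have bij: "bij_betw \<phi>' (carrier P.P) (carrier R)" using \<phi>_surj by (simp add: bij_betw_def)
  obtain \<kappa> where \<kappa>: "bij_betw \<kappa> {..<card V} V"
    using ex_bij_betw_nat_finite[OF fin] by (auto simp: atLeast0LessThan)
  obtain h where h: "h \<in> ps_hom W {..<card V} P.P (power_series_const W)"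
    "bij_betw h (carrier (ps_ring W {..<card V})) (carrier P.P)"
    using P.rename[OF \<kappa>] by auto
  interpret P': power_series W u "{..<card V}"
    by (intro power_series.intro power_series_axioms.intro complete_dvr_axioms) simp
  have const: "power_series_const W \<in> carrier W \<rightarrow> carrier P'.P"
    using P'.P.Supp_zero by (auto simp: P'.const_eq)
  have bij': "bij_betw (\<lambda>f. \<phi>' (h f)) (carrier P'.P) (carrier R)"
    using bij_betw_trans[OF h(2) bij] by (simp add: comp_def)
  note inv = alg_hom_inverse[OF alg_hom_comp[OF h(1) local.\<phi>] bij' P'.P.cring_C R.is_cring const]
  show ?thesis
    unfolding smooth_algebra_def power_series_ring_eq using inv(1,4) by blast
qed

end

theorem theorem2p1:
  fixes W :: "('a, 'm) ring_scheme"
    and R :: "('b, 'n) ring_scheme"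
    and \<rho> :: "'a \<Rightarrow> 'b"
    and u :: 'a
    and p e :: nat
  assumes "discrete_valuation_ring W"
    and "uniformizer W u"
    and "adically_complete W u"
    and "characteristic W = 0"
    and "characteristic (residue_ring_of W) = p" and "p > 0"
    and "e > 0" and "PIdl\<^bsub>W\<^esub> (u [^]\<^bsub>W\<^esub> e) = PIdl\<^bsub>W\<^esub> (add_pow W p \<one>\<^bsub>W\<^esub>)"
    and "e < p"
    and "formal_algebra W R \<rho>"
  shows "smooth_algebra W R \<rho> \<longleftrightarrow>
    (\<exists>f. f \<in> alg_hom W R \<rho> W (\<lambda>w. w)) \<and>
    (\<forall>m::nat. \<forall>f \<in> alg_hom W R \<rho> (W_eps_quot W u m) (W_eps_quot_of W u m).
       \<exists>g \<in> alg_hom W R \<rho> (W_eps W u (m + 1)) (W_eps_of W u (m + 1)).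
         \<forall>x\<in>carrier R. W_eps_proj W u m (g x) = f x) \<and>
    (\<forall>m d::nat. m > 0 \<longrightarrow> d > 0 \<longrightarrow>
       (\<forall>f \<in> alg_hom W R \<rho> (W_dp W u m d) (W_dp_of W u m d).
        \<exists>g \<in> alg_hom W R \<rho> (W_dp W u m (d + 1)) (W_dp_of W u m (d + 1)).
          \<forall>x\<in>carrier R. W_dp_proj W u m d (g x) = f x))"
proof -
  interpret W: complete_dvr W u by (rule complete_dvrI[OF assms(1-3)])
  interpret dp_ring W u by (rule dp_ring.intro[OF W.complete_dvr_axioms])
  have R: "cring R" and \<rho>: "\<rho> \<in> ring_hom W R"
    using assms(10) by (simp_all add: formal_algebra_def local_cring_def)
  obtain r \<phi> where \<phi>: "\<phi> \<in> ps_hom W {..<r} R \<rho>"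
    "\<phi> ` carrier (ps_ring W {..<r}) = carrier R"
    using assms(10) by (auto simp: formal_algebra_def power_series_ring_eq)
  have char: "n = 0" if "add_pow W n \<one>\<^bsub>W\<^esub> = \<zero>\<^bsub>W\<^esub>" for n :: nat
    using assms(4) that unfolding characteristic_def by (auto simp: Gcd_0_iff)
  show ?thesis (is "_ \<longleftrightarrow> ?i \<and> ?ii \<and> ?iii")
  proof
    assume smooth: "smooth_algebra W R \<rho>"
    have ?i
    proof -
      obtain n h where h: "h \<in> alg_hom W R \<rho> (ps_ring W {..<n}) (power_series_const W)"
        using smooth by (auto simp: smooth_algebra_def power_series_ring_eq)
      interpret P: power_series W u "{..<n}"
        by (intro power_series.intro power_series_axioms.intro W.complete_dvr_axioms) simp
      show ?thesis using alg_hom_comp[OF h P.const_coeff_hom] by blast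
    qed
    moreover have ?ii
    proof (intro allI ballI)
      fix m f assume f: "f \<in> alg_hom W R \<rho> (W_eps_quot W u m) (W_eps_quot_of W u m)"
      show "\<exists>g\<in>alg_hom W R \<rho> (W_eps W u (m + 1)) (W_eps_of W u (m + 1)).
          \<forall>x\<in>carrier R. W_eps_proj W u m (g x) = f x"
        by (rule smooth_lifts[OF test_algebra_eps_quot test_algebra_eps _ R \<rho> smooth f]) simp_all
    qed
    moreover have ?iii
    proof (intro allI ballI impI)
      fix m d :: nat and f assume m: "0 < m" and d: "0 < d"
        and f: "f \<in> alg_hom W R \<rho> (W_dp W u m d) (W_dp_of W u m d)"
      have "\<exists>g\<in>alg_hom W R \<rho> (W_dp W u m (Suc d)) (W_dp_of W u m (Suc d)).
          \<forall>x\<in>carrier R. W_dp_proj W u m d (g x) = f x"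
        by (rule smooth_lifts[OF test_algebra_dp[OF m d] test_algebra_dp[OF m zero_less_Suc]
              dp_proj[OF m d] R \<rho> smooth f])
      then show "\<exists>g\<in>alg_hom W R \<rho> (W_dp W u m (d + 1)) (W_dp_of W u m (d + 1)).
          \<forall>x\<in>carrier R. W_dp_proj W u m d (g x) = f x" by simp
    qed
    ultimately show "?i \<and> ?ii \<and> ?iii" by (intro conjI)
  next
    assume conditions: "?i \<and> ?ii \<and> ?iii"
    from conditions[THEN conjunct1] obtain s where s: "s \<in> alg_hom W R \<rho> W (\<lambda>w. w)" ..
    have "lifting_conditions W u R \<rho> s"
    proof (intro lifting_conditions.intro lifting_conditions_axioms.intro dp_ring_axioms R s)
      show "n = 0" if "add_pow W n \<one>\<^bsub>W\<^esub> = \<zero>\<^bsub>W\<^esub>" for n :: nat using char[OF that] .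
      show "\<exists>g\<in>alg_hom W R \<rho> (W_eps W u (Suc m)) (W_eps_of W u (Suc m)).
          \<forall>x\<in>carrier R. W_eps_proj W u m (g x) = f x"
        if "f \<in> alg_hom W R \<rho> (W_eps_quot W u m) (W_eps_quot_of W u m)" for m f
        using conditions[THEN conjunct2, THEN conjunct1, THEN spec, THEN bspec, OF that]
        unfolding Suc_eq_plus1 .
      show "\<exists>g\<in>alg_hom W R \<rho> (W_dp W u m (Suc d)) (W_dp_of W u m (Suc d)).
          \<forall>x\<in>carrier R. W_dp_proj W u m d (g x) = f x"
        if "0 < m" "0 < d" "f \<in> alg_hom W R \<rho> (W_dp W u m d) (W_dp_of W u m d)" for m d f
        using conditions[THEN conjunct2, THEN conjunct2, rule_format, OF that]
        unfolding Suc_eq_plus1 .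
    qed
    then show "smooth_algebra W R \<rho>" by (rule lifting_conditions.conditions_imp_smooth[OF _ \<phi> \<rho>])
  qed
qed

end
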